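(* Let $I$ be either $(0,\infty)$ or $\mathbb R$, and for a continuous drift $b$ on $\overline I$ let $H_D=-\frac12\frac{d^2}{dx^2}-b\frac{d}{dx}$ be the corresponding self-adjoint diffusion operator on $I$ (diffusion coefficient $a=1$; with the Dirichlet boundary condition at $0$ if $I=(0,\infty)$). 1. Let $b(x)=-\gamma(1+|x|)^l$ with $\gamma>0$ and $l\in\mathbb R$. (i) If $l<0$, then $\inf\sigma(H_D)=0$. (ii) If $l\ge0$, then there exist constants $c_l,C_l>0$ (not depending on $\gamma$) such that $$c_l\gamma^2\le\inf\sigma(H_D)\le C_l\gamma^2\quad\text{for }\gamma>1,$$ and $$c_l\gamma^{\frac{2}{l+1}}\le\inf\sigma(H_D)\le C_l\gamma^{\frac{2}{l+1}}\quad\text{for }0<\gamma\le1.$$ 2. Let $b(x)=-\gamma|x|^l$ with $\gamma>0$ and $l\ge0$. Then $$\frac{1}{8C_l}\gamma^{\frac{2}{1+l}}\le\inf\sigma(H_D)\le\frac{1}{2C_l}\gamma^{\frac{2}{1+l}}\quad\text{for all }\gamma>0,$$ where $$C_l=\sup_{x>0}\Big(\int_0^x\exp\Big(\frac{2z^{l+1}}{l+1}\Big)dz\Big)\Big(\int_x^\infty\exp\Big(-\frac{2z^{l+1}}{l+1}\Big)dz\Big)\quad\text{if } I=(0,\infty),$$ $$C_l=\Big(\int_0^\infty\exp\Big(-\frac{2z^{l+1}}{l+1}\Big)dz\Big)^2\quad\text{if } I=\mathbb R.$$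
   Context: With $B(x)=\int_0^x b(y)\,dy$, $H_D$ is the non-negative self-adjoint operator on $L^2(I,e^{2B}dx)$ associated (Friedrichs extension) with the closure of the form $Q_D(f,g)=\frac12\int_I f'g'\,e^{2B}dx$, $f,g\in C_0^1(I)$ ($C^1$ functions with compact support in the open set $I$). $\sigma$ denotes spectrum. *)

theory Defs
  imports "HOL-Analysis.Analysis"
begin

text \<open>
  Square-integrable functions are represented by functions rather than by classes modulo null sets;
  all notions below respect equality almost everywhere.  The scalars are real.
\<close>

definition L2 :: "'a measure \<Rightarrow> ('a \<Rightarrow> real) set"
  where "L2 M = {f \<in> borel_measurable M. integrable M (\<lambda>x. (f x)\<^sup>2)}"

definition L2_inner :: "'a measure \<Rightarrow> ('a \<Rightarrow> real) \<Rightarrow> ('a \<Rightarrow> real) \<Rightarrow> real"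
  where "L2_inner M f g = (LINT x|M. f x * g x)"

definition L2_norm :: "'a measure \<Rightarrow> ('a \<Rightarrow> real) \<Rightarrow> real"
  where "L2_norm M f = sqrt (L2_inner M f f)"

text \<open>
  \<open>form_approx M D q u f\<close>: the sequence \<open>u\<close> in the form domain \<open>D\<close> converges to \<open>f\<close> in \<open>L2 M\<close> and is
  Cauchy with respect to the quadratic form of \<open>q\<close>.
\<close>

definition form_approx ::
  "'a measure \<Rightarrow> ('a \<Rightarrow> real) set \<Rightarrow> (('a \<Rightarrow> real) \<Rightarrow> ('a \<Rightarrow> real) \<Rightarrow> real)
     \<Rightarrow> (nat \<Rightarrow> 'a \<Rightarrow> real) \<Rightarrow> ('a \<Rightarrow> real) \<Rightarrow> bool"
  where "form_approx M D q u f \<longleftrightarrow>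
    f \<in> L2 M \<and> (\<forall>n. u n \<in> D) \<and>
    (\<lambda>n. L2_norm M (\<lambda>x. u n x - f x)) \<longlonglongrightarrow> 0 \<and>
    (\<forall>\<epsilon>>0. \<exists>N. \<forall>m\<ge>N. \<forall>n\<ge>N. q (\<lambda>x. u m x - u n x) (\<lambda>x. u m x - u n x) < \<epsilon>)"

definition closure_dom ::
  "'a measure \<Rightarrow> ('a \<Rightarrow> real) set \<Rightarrow> (('a \<Rightarrow> real) \<Rightarrow> ('a \<Rightarrow> real) \<Rightarrow> real) \<Rightarrow> ('a \<Rightarrow> real) set"
  where "closure_dom M D q = {f. \<exists>u. form_approx M D q u f}"

text \<open>For a closable form the limit does not depend on the approximating sequences.\<close>

definition closure_form ::
  "'a measure \<Rightarrow> ('a \<Rightarrow> real) set \<Rightarrow> (('a \<Rightarrow> real) \<Rightarrow> ('a \<Rightarrow> real) \<Rightarrow> real)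
     \<Rightarrow> ('a \<Rightarrow> real) \<Rightarrow> ('a \<Rightarrow> real) \<Rightarrow> real"
  where "closure_form M D q f g =
    (THE c. \<forall>u v. form_approx M D q u f \<longrightarrow> form_approx M D q v g \<longrightarrow>
       (\<lambda>n. q (u n) (v n)) \<longlonglongrightarrow> c)"

text \<open>
  Graph of the operator \<open>T\<close> associated with the closure of \<open>q\<close>: \<open>f\<close> is in the domain of \<open>T\<close> with
  \<open>T f = h\<close> iff the closed form satisfies \<open>q(f,g) = (h,g)\<close> for all \<open>g\<close> in its domain.
\<close>

definition form_operator ::
  "'a measure \<Rightarrow> ('a \<Rightarrow> real) set \<Rightarrow> (('a \<Rightarrow> real) \<Rightarrow> ('a \<Rightarrow> real) \<Rightarrow> real)
     \<Rightarrow> (('a \<Rightarrow> real) \<times> ('a \<Rightarrow> real)) set"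
  where "form_operator M D q =
    {(f, h). f \<in> closure_dom M D q \<and> h \<in> L2 M \<and>
       (\<forall>g\<in>closure_dom M D q. closure_form M D q f g = L2_inner M h g)}"

text \<open>
  Resolvent set and spectrum of a linear operator on \<open>L2 M\<close> given by its graph: \<open>T - \<mu>\<close> has to be
  onto, injective (implied by the norm estimate) and to have a bounded inverse.  Only real
  \<open>\<mu>\<close> are considered, which is the whole spectrum when \<open>T\<close> is self-adjoint.
\<close>

definition resolvent_set :: "'a measure \<Rightarrow> (('a \<Rightarrow> real) \<times> ('a \<Rightarrow> real)) set \<Rightarrow> real set"
  where "resolvent_set M T =
    {\<mu>. (\<forall>h\<in>L2 M. \<exists>(f, k)\<in>T. AE x in M. k x - \<mu> * f x = h x) \<and>
         (\<exists>K. \<forall>(f, k)\<in>T. L2_norm M f \<le> K * L2_norm M (\<lambda>x. k x - \<mu> * f x))}"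

definition op_spectrum :: "'a measure \<Rightarrow> (('a \<Rightarrow> real) \<times> ('a \<Rightarrow> real)) set \<Rightarrow> real set"
  where "op_spectrum M T = - resolvent_set M T"

text \<open>
  \<open>C\<^sup>1\<close> functions with compact support in the open set \<open>I\<close>, extended by zero to the whole line.
\<close>

definition C1_compact :: "real set \<Rightarrow> (real \<Rightarrow> real) set"
  where "C1_compact I =
    {f. f C1_differentiable_on UNIV \<and> compact (closure {x. f x \<noteq> 0}) \<and> closure {x. f x \<noteq> 0} \<subseteq> I}"

definition drift_primitive :: "(real \<Rightarrow> real) \<Rightarrow> real \<Rightarrow> real"
  where "drift_primitive b x = (LBINT y=ereal 0..ereal x. b y)"

definition weighted_measure :: "real set \<Rightarrow> (real \<Rightarrow> real) \<Rightarrow> real measure"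
  where "weighted_measure I b =
    density (restrict_space lborel I) (\<lambda>x. ennreal (exp (2 * drift_primitive b x)))"

definition Q_D :: "real set \<Rightarrow> (real \<Rightarrow> real) \<Rightarrow> (real \<Rightarrow> real) \<Rightarrow> (real \<Rightarrow> real) \<Rightarrow> real"
  where "Q_D I b f g = 1/2 * (LINT x|weighted_measure I b. deriv f x * deriv g x)"

definition H_D :: "real set \<Rightarrow> (real \<Rightarrow> real) \<Rightarrow> ((real \<Rightarrow> real) \<times> (real \<Rightarrow> real)) set"
  where "H_D I b = form_operator (weighted_measure I b) (C1_compact I) (Q_D I b)"

text \<open>The infimum is taken in the extended reals, so that an empty spectrum gives \<open>\<infinity>\<close>.\<close>

definition inf_spectrum_H_D :: "real set \<Rightarrow> (real \<Rightarrow> real) \<Rightarrow> ereal"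
  where "inf_spectrum_H_D I b = (INF \<mu>\<in>op_spectrum (weighted_measure I b) (H_D I b). ereal \<mu>)"

definition drift_shifted :: "real \<Rightarrow> real \<Rightarrow> real \<Rightarrow> real"
  where "drift_shifted \<gamma> l x = - \<gamma> * (1 + \<bar>x\<bar>) powr l"

text \<open>
  The case distinction is needed because \<open>0 powr 0 = 0\<close>, whereas the drift is the constant \<open>- \<gamma>\<close>
  if \<open>l = 0\<close>.
\<close>

definition drift_power :: "real \<Rightarrow> real \<Rightarrow> real \<Rightarrow> real"
  where "drift_power \<gamma> l x = - \<gamma> * (if l = 0 then 1 else \<bar>x\<bar> powr l)"

definition C_half_line :: "real \<Rightarrow> real"
  where "C_half_line l =
    (SUP x\<in>{0<..}.
       (LBINT z:{0..x}. exp (2 * z powr (l + 1) / (l + 1))) *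
       (LBINT z:{x..}. exp (- (2 * z powr (l + 1) / (l + 1)))))"

definition C_line :: "real \<Rightarrow> real"
  where "C_line l = (LBINT z:{0..}. exp (- (2 * z powr (l + 1) / (l + 1))))\<^sup>2"

end

theory Submission
  imports Defs
begin

text \<open>
  The infimum of the spectrum is the infimum of the Rayleigh quotient
  \<open>\<integral> u'\<^sup>2 w / (2 \<integral> u\<^sup>2 w)\<close>, \<open>w = exp (2 B)\<close>, over the form core: below it the resolvent exists by the
  direct method, and it lies in the spectrum itself because otherwise Cauchy--Schwarz would improve
  the form bound.  Lower bounds come from solutions of the Riccati inequality
  \<open>\<eta>' + \<eta>\<^sup>2 / w \<le> - \<kappa> w\<close>.  With \<open>F' = 1 / w\<close>, \<open>G' = - w\<close> and \<open>F G \<le> C\<close>, the choice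
  \<open>\<eta> = G / (4 C) + 1 / (4 F)\<close> gives \<open>\<kappa> = 1 / (4 C)\<close>, which is Muckenhoupt's form of Hardy's inequality with
  its sharp factor 4.  Upper bounds come from test functions equal to \<open>F - F a\<close> up to a point and
  constant afterwards, cut off far away.
\<close>


text \<open>\<open>closure_form\<close> is a definite description, so nothing is known about the
  operator until the form is shown closable. The core consists of functions that are merely
  \<open>C1\<close>, hence \<open>w * deriv v\<close> is only continuous and cannot be integrated by
  parts. Closability is therefore derived from a weaker property: for fixed \<open>v\<close>, the
  functional \<open>q u v\<close> is bounded by the \<open>L2\<close> norm of \<open>u\<close> up to
  an arbitrarily small multiple of the form norm. The same one-sided averages that prove this also
  carry piecewise test functions into the core.

  The exponents in \<gamma> come from natural lengths: \<open>1 / \<gamma>\<close> where the shifted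
  drift is nearly constant, and \<open>1 / s\<close> with
  \<open>s = \<gamma> powr (1 / (l + 1))\<close> where its power growth dominates; the power drift
  scales exactly by \<open>s\<close>. On the whole line the power drift is even, so the weight at
  \<open>- x\<close> is the reciprocal of the weight at \<open>x\<close>, and the scale function
  vanishing at minus infinity is the reflected tail. The product of the tail with its reflection is
  largest at 0, which is why the constant there is a square rather than a supremum. The gap between
  8 and 2 in the bounds is the factor 4 of Hardy's inequality; the remaining 2 is the factor
  \<open>1/2\<close> in \<open>Q_D\<close>.\<close>

subsection \<open>The space of square-integrable functions\<close>

lemma nonneg_quadratic_discriminant:
  fixes A B C :: real
  assumes nn: "\<And>t. 0 \<le> A + 2 * t * B + t\<^sup>2 * C" and C: "0 \<le> C"
  shows "B\<^sup>2 \<le> A * C"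
proof (cases "C = 0")
  case True
  have "B = 0"
  proof (rule ccontr)
    assume "B \<noteq> 0"
    \<comment> \<open>At this \<open>t\<close> the affine function of \<open>t\<close> takes the
      value \<open>-1\<close>.\<close>
    then show False using nn[of "- (A + 1) / (2 * B)"] True by (simp add: field_simps)
  qed
  then show ?thesis using True by simp
next
  case False
  then have "C > 0" using C by simp
  then show ?thesis using nn[of "- B / C"]
    by (simp add: field_simps power2_eq_square)
qed

context
  fixes M :: "'a measure"
begin

lemma L2_D [dest]:
  assumes "f \<in> L2 M"
  shows "f \<in> borel_measurable M" "integrable M (\<lambda>x. (f x)\<^sup>2)"
  using assms by (auto simp: L2_def)

lemma L2_integrable_mult:
  assumes "f \<in> L2 M" "g \<in> L2 M"
  shows "integrable M (\<lambda>x. f x * g x)"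
proof (rule Bochner_Integration.integrable_bound)
  show "integrable M (\<lambda>x. (f x)\<^sup>2 + (g x)\<^sup>2)" using assms by auto
  show "(\<lambda>x. f x * g x) \<in> borel_measurable M" using assms by (auto simp: L2_def)
  have "\<bar>a * b\<bar> \<le> a\<^sup>2 + b\<^sup>2" for a b :: real
    using sum_squares_bound[of a b] sum_squares_bound[of a "-b"] zero_le_power2[of a] zero_le_power2[of b]
    by (simp add: abs_le_iff)
  then show "AE x in M. norm (f x * g x) \<le> norm ((f x)\<^sup>2 + (g x)\<^sup>2)" by simp
qed

lemma L2_zero: "(\<lambda>x. 0) \<in> L2 M" by (auto simp: L2_def)

lemma L2_scale: "f \<in> L2 M \<Longrightarrow> (\<lambda>x. c * f x) \<in> L2 M"
  by (auto simp: L2_def power_mult_distrib)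

lemma L2_add:
  assumes "f \<in> L2 M" "g \<in> L2 M"
  shows "(\<lambda>x. f x + g x) \<in> L2 M"
proof -
  have "integrable M (\<lambda>x. (f x)\<^sup>2 + (g x)\<^sup>2 + 2 * (f x * g x))"
    using L2_integrable_mult[OF assms] assms by (intro Bochner_Integration.integrable_add integrable_mult_right) auto
  moreover have "(\<lambda>x. (f x)\<^sup>2 + (g x)\<^sup>2 + 2 * (f x * g x)) = (\<lambda>x. (f x + g x)\<^sup>2)"
    by (auto simp: power2_eq_square algebra_simps)
  ultimately show ?thesis using assms by (auto simp: L2_def)
qed

lemma L2_diff: "f \<in> L2 M \<Longrightarrow> g \<in> L2 M \<Longrightarrow> (\<lambda>x. f x - g x) \<in> L2 M"
  using L2_add[of f "\<lambda>x. (-1) * g x"] L2_scale[of g "-1"] by simp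

lemma L2_inner_commute: "L2_inner M f g = L2_inner M g f"
  by (simp add: L2_inner_def mult.commute)

lemma L2_inner_add:
  assumes "f \<in> L2 M" "g \<in> L2 M" "h \<in> L2 M"
  shows "L2_inner M (\<lambda>x. f x + g x) h = L2_inner M f h + L2_inner M g h"
  unfolding L2_inner_def distrib_right
  by (rule Bochner_Integration.integral_add) (auto intro: L2_integrable_mult assms)

lemma L2_inner_diff:
  assumes "f \<in> L2 M" "g \<in> L2 M" "h \<in> L2 M"
  shows "L2_inner M (\<lambda>x. f x - g x) h = L2_inner M f h - L2_inner M g h"
  unfolding L2_inner_def left_diff_distrib
  by (rule Bochner_Integration.integral_diff) (auto intro: L2_integrable_mult assms)

lemma L2_inner_scale: "L2_inner M (\<lambda>x. c * f x) h = c * L2_inner M f h"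
  unfolding L2_inner_def mult.assoc by simp

lemma L2_inner_nonneg: "0 \<le> L2_inner M f f"
  by (simp add: L2_inner_def)

lemma L2_norm_nonneg: "0 \<le> L2_norm M f"
  by (simp add: L2_norm_def L2_inner_nonneg)

lemma L2_norm_square: "(L2_norm M f)\<^sup>2 = L2_inner M f f"
  by (simp add: L2_norm_def L2_inner_nonneg)

end

text \<open>Kept abstract because it is instantiated three ways: by the inner product of
  \<open>L2 M\<close>, by \<open>q\<close>, and by the shifted forms \<open>q - \<mu>\<close> of the
  spectral arguments.\<close>

locale nonneg_form =
  fixes D :: "('a \<Rightarrow> real) set" and q :: "('a \<Rightarrow> real) \<Rightarrow> ('a \<Rightarrow> real) \<Rightarrow> real"
  assumes D_zero: "(\<lambda>x. 0) \<in> D"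
    and D_add: "u \<in> D \<Longrightarrow> v \<in> D \<Longrightarrow> (\<lambda>x. u x + v x) \<in> D"
    and D_scale: "u \<in> D \<Longrightarrow> (\<lambda>x. c * u x) \<in> D"
    and q_commute: "u \<in> D \<Longrightarrow> v \<in> D \<Longrightarrow> q u v = q v u"
    and q_add: "u \<in> D \<Longrightarrow> v \<in> D \<Longrightarrow> z \<in> D \<Longrightarrow> q (\<lambda>x. u x + v x) z = q u z + q v z"
    and q_scale: "u \<in> D \<Longrightarrow> v \<in> D \<Longrightarrow> q (\<lambda>x. c * u x) v = c * q u v"
    and q_nonneg: "u \<in> D \<Longrightarrow> 0 \<le> q u u"
begin

lemma D_diff: "u \<in> D \<Longrightarrow> v \<in> D \<Longrightarrow> (\<lambda>x. u x - v x) \<in> D"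
  using D_add[of u "\<lambda>x. (-1) * v x"] D_scale[of v "-1"] by simp

lemma q_diff: "u \<in> D \<Longrightarrow> v \<in> D \<Longrightarrow> z \<in> D \<Longrightarrow> q (\<lambda>x. u x - v x) z = q u z - q v z"
  using q_add[of u "\<lambda>x. (-1) * v x" z] D_scale[of v "-1"] q_scale[of v z "-1"] by simp

lemma q_add_right: "u \<in> D \<Longrightarrow> v \<in> D \<Longrightarrow> z \<in> D \<Longrightarrow> q z (\<lambda>x. u x + v x) = q z u + q z v"
  by (simp add: q_commute[of z] D_add q_add)

lemma q_diff_right: "u \<in> D \<Longrightarrow> v \<in> D \<Longrightarrow> z \<in> D \<Longrightarrow> q z (\<lambda>x. u x - v x) = q z u - q z v"
  by (simp add: q_commute[of z] D_diff q_diff)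

lemma q_scale_right: "u \<in> D \<Longrightarrow> v \<in> D \<Longrightarrow> q v (\<lambda>x. c * u x) = c * q v u"
  by (simp add: q_commute[of v] D_scale q_scale)

lemma q_diff_square:
  "u \<in> D \<Longrightarrow> v \<in> D \<Longrightarrow>
    q (\<lambda>x. u x - v x) (\<lambda>x. u x - v x) = q u u - 2 * q u v + q v v"
  by (simp add: q_diff q_diff_right D_diff q_commute[of v u])

lemma q_line:
  assumes "u \<in> D" "v \<in> D"
  shows "q (\<lambda>x. u x + t * v x) (\<lambda>x. u x + t * v x) = q u u + 2 * t * q u v + t\<^sup>2 * q v v"
  using assms
  by (simp add: q_add q_add_right q_scale q_scale_right D_add D_scale q_commute[of v u]
      power2_eq_square algebra_simps)

lemma q_Cauchy_Schwarz:
  assumes "u \<in> D" "v \<in> D"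
  shows "(q u v)\<^sup>2 \<le> q u u * q v v"
proof (rule nonneg_quadratic_discriminant)
  show "0 \<le> q u u + 2 * t * q u v + t\<^sup>2 * q v v" for t
    using q_nonneg[of "\<lambda>x. u x + t * v x"] q_line[OF assms] D_add D_scale assms by simp
qed (simp add: q_nonneg assms)

lemma q_Cauchy_Schwarz_sqrt:
  assumes "u \<in> D" "v \<in> D"
  shows "\<bar>q u v\<bar> \<le> sqrt (q u u) * sqrt (q v v)"
  using real_le_rsqrt[of "\<bar>q u v\<bar>" "q u u * q v v"] q_Cauchy_Schwarz[OF assms]
  by (simp add: real_sqrt_mult)

lemma q_triangle:
  assumes "u \<in> D" "v \<in> D"
  shows "sqrt (q (\<lambda>x. u x + v x) (\<lambda>x. u x + v x)) \<le> sqrt (q u u) + sqrt (q v v)"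
proof (rule real_le_lsqrt)
  have "q (\<lambda>x. u x + v x) (\<lambda>x. u x + v x) = q u u + 2 * q u v + q v v"
    using q_line[OF assms, of 1] by simp
  also have "\<dots> \<le> q u u + 2 * (sqrt (q u u) * sqrt (q v v)) + q v v"
    using q_Cauchy_Schwarz_sqrt[OF assms] by simp
  also have "\<dots> = (sqrt (q u u) + sqrt (q v v))\<^sup>2"
    using q_nonneg assms by (simp add: power2_sum)
  finally show "q (\<lambda>x. u x + v x) (\<lambda>x. u x + v x) \<le> (sqrt (q u u) + sqrt (q v v))\<^sup>2" .
qed (use q_nonneg assms in simp)

lemma q_triangle_diff:
  assumes "u \<in> D" "v \<in> D"
  shows "sqrt (q u u) \<le> sqrt (q v v) + sqrt (q (\<lambda>x. u x - v x) (\<lambda>x. u x - v x))"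
  using q_triangle[of v "\<lambda>x. u x - v x"] assms D_diff by simp

lemma q_zero_left: "v \<in> D \<Longrightarrow> q (\<lambda>x. 0) v = 0"
  using q_scale[of "\<lambda>x. 0" v 0] D_zero by simp

end

lemma nonneg_form_L2_inner: "nonneg_form (L2 M) (L2_inner M)"
proof
  show "L2_inner M u v = L2_inner M v u" for u v by (rule L2_inner_commute)
qed (simp_all add: L2_zero L2_add L2_scale L2_inner_add L2_inner_scale L2_inner_nonneg)

lemma L2_Cauchy_Schwarz:
  "f \<in> L2 M \<Longrightarrow> g \<in> L2 M \<Longrightarrow> \<bar>L2_inner M f g\<bar> \<le> L2_norm M f * L2_norm M g"
  unfolding L2_norm_def by (rule nonneg_form.q_Cauchy_Schwarz_sqrt[OF nonneg_form_L2_inner])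

lemma L2_triangle_diff:
  "f \<in> L2 M \<Longrightarrow> g \<in> L2 M \<Longrightarrow> L2_norm M f \<le> L2_norm M g + L2_norm M (\<lambda>x. f x - g x)"
  unfolding L2_norm_def by (rule nonneg_form.q_triangle_diff[OF nonneg_form_L2_inner])

lemma L2_norm_minus_commute: "L2_norm M (\<lambda>x. f x - g x) = L2_norm M (\<lambda>x. g x - f x)"
proof -
  have "(f x - g x) * (f x - g x) = (g x - f x) * (g x - f x)" for x by (simp add: algebra_simps)
  then show ?thesis by (simp add: L2_norm_def L2_inner_def)
qed

lemma ennreal_L2_norm_square:
  assumes "f \<in> L2 M"
  shows "(\<integral>\<^sup>+x. ennreal ((f x)\<^sup>2) \<partial>M) = ennreal ((L2_norm M f)\<^sup>2)"
proof -
  have "(L2_norm M f)\<^sup>2 = (LINT x|M. (f x)\<^sup>2)"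
    unfolding L2_norm_square L2_inner_def by (simp add: power2_eq_square)
  then show ?thesis using L2_D(2)[OF assms] by (simp add: nn_integral_eq_integral)
qed

text \<open>Riesz-Fischer for functions instead of classes. Along a subsequence the increments
  \<open>d k\<close> have squared norm at most \<open>(1/4)^k\<close>, so even the sum of
  \<open>2^k * (d k x)^2\<close> has finite integral. Hence almost everywhere \<open>d k x\<close>
  is dominated by a geometric sequence of ratio \<open>sqrt (1/2)\<close> and the subsequence
  converges.\<close>

lemma L2_complete:
  assumes u: "\<And>n. u n \<in> L2 M"
    and cauchy: "\<And>\<epsilon>. 0 < \<epsilon> \<Longrightarrow> \<exists>N. \<forall>m\<ge>N. \<forall>n\<ge>N. L2_norm M (\<lambda>x. u m x - u n x) < \<epsilon>"
  shows "\<exists>f\<in>L2 M. (\<lambda>n. L2_norm M (\<lambda>x. u n x - f x)) \<longlonglongrightarrow> 0"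
proof -
  have "\<exists>N. \<forall>m\<ge>N. \<forall>n\<ge>N. L2_norm M (\<lambda>x. u m x - u n x) < (1/2)^k" for k
    by (rule cauchy) simp
  then obtain N where N: "\<And>k m n. m \<ge> N k \<Longrightarrow> n \<ge> N k \<Longrightarrow> L2_norm M (\<lambda>x. u m x - u n x) < (1/2)^k"
    by metis
  \<comment> \<open>The running maximum makes \<open>r\<close> monotone while keeping it above
    \<open>N\<close>; the summand \<open>k\<close> makes it unbounded.\<close>
  define r where "r k = Max (N ` {..k}) + k" for k
  have rN: "r k \<ge> N k" for k unfolding r_def
    by (rule trans_le_add1, rule Max_ge) auto
  have rk: "r k \<ge> k" for k unfolding r_def by simp
  have rmono: "r (Suc k) \<ge> r k" for k unfolding r_def
    by (rule add_mono[OF Max_mono]) auto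
  define d where "d k x = u (r (Suc k)) x - u (r k) x" for k x
  have d: "d k \<in> L2 M" for k unfolding d_def by (intro L2_diff u)
  have dmeas [measurable]: "d k \<in> borel_measurable M" for k using d by auto
  have dnorm: "(L2_norm M (d k))\<^sup>2 \<le> (1/4)^k" for k
  proof -
    have "L2_norm M (d k) \<le> (1/2)^k" unfolding d_def
      using N[of k "r (Suc k)" "r k"] rN[of k] rmono[of k] by simp
    then have "(L2_norm M (d k))\<^sup>2 \<le> ((1/2)^k)\<^sup>2" by (intro power_mono L2_norm_nonneg)
    also have "\<dots> = (1/4::real)^k" by (simp add: power2_eq_square flip: power_mult_distrib)
    finally show ?thesis .
  qed
  have "(\<integral>\<^sup>+x. (\<Sum>k. ennreal (2^k * (d k x)\<^sup>2)) \<partial>M) = (\<Sum>k. \<integral>\<^sup>+x. ennreal (2^k * (d k x)\<^sup>2) \<partial>M)"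
    by (rule nn_integral_suminf) simp
  also have "\<dots> = (\<Sum>k. ennreal (2^k * (L2_norm M (d k))\<^sup>2))"
  proof (intro suminf_cong)
    fix k
    have "(\<integral>\<^sup>+x. ennreal (2^k * (d k x)\<^sup>2) \<partial>M) = (\<integral>\<^sup>+x. ennreal (2^k) * ennreal ((d k x)\<^sup>2) \<partial>M)"
      by (simp add: ennreal_mult)
    also have "\<dots> = ennreal (2^k) * ennreal ((L2_norm M (d k))\<^sup>2)"
      by (subst nn_integral_cmult) (simp_all add: ennreal_L2_norm_square[OF d])
    finally show "(\<integral>\<^sup>+x. ennreal (2^k * (d k x)\<^sup>2) \<partial>M) = ennreal (2^k * (L2_norm M (d k))\<^sup>2)"
      by (simp add: ennreal_mult)
  qed
  also have "\<dots> \<le> (\<Sum>k. ennreal ((1/2)^k))"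
  proof (rule suminf_le)
    fix k
    have "2^k * (L2_norm M (d k))\<^sup>2 \<le> 2^k * (1/4)^k"
      using dnorm[of k] by simp
    also have "\<dots> = (1/2::real)^k" by (simp flip: power_mult_distrib)
    finally show "ennreal (2^k * (L2_norm M (d k))\<^sup>2) \<le> ennreal ((1/2)^k)" by (rule ennreal_leI)
  qed auto
  also have "\<dots> < \<infinity>"
    by (subst suminf_ennreal2) (auto intro: summable_geometric)
  finally have "(\<integral>\<^sup>+x. (\<Sum>k. ennreal (2^k * (d k x)\<^sup>2)) \<partial>M) \<noteq> \<infinity>" by simp
  then have "AE x in M. (\<Sum>k. ennreal (2^k * (d k x)\<^sup>2)) \<noteq> \<infinity>"
    by (intro nn_integral_PInf_AE) auto
  then have conv: "AE x in M. convergent (\<lambda>k. u (r k) x)"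
  proof (eventually_elim)
    case (elim x)
    define s where "s = enn2real (\<Sum>k. ennreal (2^k * (d k x)\<^sup>2))"
    have s: "ennreal s = (\<Sum>k. ennreal (2^k * (d k x)\<^sup>2))" unfolding s_def using elim
      by (intro ennreal_enn2real) (simp add: top.not_eq_extremum)
    have b: "\<bar>d k x\<bar> \<le> sqrt s * (sqrt (1/2))^k" for k
    proof -
      have "ennreal (2^k * (d k x)\<^sup>2) = (\<Sum>j\<in>{k}. ennreal (2^j * (d j x)\<^sup>2))" by simp
      also have "\<dots> \<le> (\<Sum>j. ennreal (2^j * (d j x)\<^sup>2))"
        by (rule sum_le_suminf[OF summableI]) (simp, rule zero_le)
      finally have "ennreal (2^k * (d k x)\<^sup>2) \<le> ennreal s" unfolding s .
      then have "2^k * (d k x)\<^sup>2 \<le> s" by (subst (asm) ennreal_le_iff) (simp_all add: s_def)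
      then have "(d k x)\<^sup>2 \<le> s * (1/2)^k" by (simp add: field_simps)
      then have "sqrt ((d k x)\<^sup>2) \<le> sqrt (s * (1/2)^k)" by (rule real_sqrt_le_mono)
      then show ?thesis unfolding real_sqrt_abs real_sqrt_mult real_sqrt_power[of "1/2"] .
    qed
    have "summable (\<lambda>k. d k x)"
    proof (rule summable_comparison_test')
      show "summable (\<lambda>k. sqrt s * (sqrt (1/2))^k)"
        by (intro summable_mult summable_geometric) (simp add: real_less_lsqrt)
      show "norm (d k x) \<le> sqrt s * (sqrt (1/2))^k" for k using b by simp
    qed
    then have "convergent (\<lambda>n. \<Sum>k<n. d k x)" by (simp add: summable_iff_convergent)
    then have "convergent (\<lambda>n. u (r n) x - u (r 0) x)"
      unfolding d_def sum_lessThan_telescope[of "\<lambda>k. u (r k) x"] .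
    then show ?case using convergent_add[OF _ convergent_const, of "\<lambda>n. u (r n) x - u (r 0) x" "u (r 0) x"] by simp
  qed
  \<comment> \<open>On the null set of divergence \<open>lim\<close> takes some default value;
    \<open>f\<close> is measurable all the same.\<close>
  define f where "f x = lim (\<lambda>k. u (r k) x)" for x
  have umeas [measurable]: "u n \<in> borel_measurable M" for n using u by auto
  have fmeas [measurable]: "f \<in> borel_measurable M" unfolding f_def by measurable
  \<comment> \<open>Fatou's lemma: for fixed \<open>m\<close>, the differences
    \<open>u (r j) - u m\<close> converge almost everywhere to \<open>f - u m\<close>, and their
    norms are eventually below \<open>(1/2)^k\<close>.\<close>
  have key: "(\<integral>\<^sup>+x. ennreal ((f x - u m x)\<^sup>2) \<partial>M) \<le> ennreal (((1/2)^k)\<^sup>2)" if "m \<ge> N k" for m k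
  proof -
    have "(\<integral>\<^sup>+x. ennreal ((f x - u m x)\<^sup>2) \<partial>M)
       = (\<integral>\<^sup>+x. liminf (\<lambda>j. ennreal ((u (r j) x - u m x)\<^sup>2)) \<partial>M)"
    proof (rule nn_integral_cong_AE)
      show "AE x in M. ennreal ((f x - u m x)\<^sup>2) = liminf (\<lambda>j. ennreal ((u (r j) x - u m x)\<^sup>2))"
        using conv
      proof eventually_elim
        case (elim x)
        then have "(\<lambda>j. u (r j) x) \<longlonglongrightarrow> f x" unfolding f_def by (simp add: convergent_LIMSEQ_iff)
        then have "(\<lambda>j. ennreal ((u (r j) x - u m x)\<^sup>2)) \<longlonglongrightarrow> ennreal ((f x - u m x)\<^sup>2)"
          by (intro tendsto_ennrealI tendsto_intros)
        then show ?case by (rule lim_imp_Liminf[OF trivial_limit_sequentially, symmetric])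
      qed
    qed
    also have "\<dots> \<le> liminf (\<lambda>j. \<integral>\<^sup>+x. ennreal ((u (r j) x - u m x)\<^sup>2) \<partial>M)"
      by (rule nn_integral_liminf) measurable
    also have "\<dots> \<le> limsup (\<lambda>j. \<integral>\<^sup>+x. ennreal ((u (r j) x - u m x)\<^sup>2) \<partial>M)"
      by (rule Liminf_le_Limsup) simp
    also have "\<dots> \<le> ennreal (((1/2)^k)\<^sup>2)"
    proof (rule Limsup_bounded)
      have "(\<integral>\<^sup>+x. ennreal ((u (r j) x - u m x)\<^sup>2) \<partial>M) \<le> ennreal (((1/2)^k)\<^sup>2)" if "j \<ge> N k" for j
        unfolding ennreal_L2_norm_square[OF L2_diff[OF u u]]
        using N[of k "r j" m] rk[of j] \<open>m \<ge> N k\<close> that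
        by (intro ennreal_leI power_mono L2_norm_nonneg) auto
      then show "\<forall>\<^sub>F j in sequentially. (\<integral>\<^sup>+x. ennreal ((u (r j) x - u m x)\<^sup>2) \<partial>M) \<le> ennreal (((1/2)^k)\<^sup>2)"
        unfolding eventually_sequentially by blast
    qed
    finally show ?thesis .
  qed
  have fu: "(\<lambda>x. f x - u m x) \<in> L2 M" if "m \<ge> N k" for m k
    unfolding L2_def using le_less_trans[OF key[OF that]]
    by (auto intro!: integrableI_nonneg)
  have "(\<lambda>x. (f x - u (N 0) x) + u (N 0) x) \<in> L2 M" by (rule L2_add[OF fu[OF order_refl] u])
  then have f: "f \<in> L2 M" by simp
  moreover have "(\<lambda>n. L2_norm M (\<lambda>x. u n x - f x)) \<longlonglongrightarrow> 0"
  proof (rule LIMSEQ_I)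
    fix \<epsilon> :: real assume "\<epsilon> > 0"
    then obtain k where k: "(1/2)^k < \<epsilon>" using real_arch_pow_inv[of \<epsilon> "1/2"] by auto
    have "L2_norm M (\<lambda>x. u n x - f x) < \<epsilon>" if "n \<ge> N k" for n
    proof -
      have "ennreal ((L2_norm M (\<lambda>x. f x - u n x))\<^sup>2) \<le> ennreal (((1/2)^k)\<^sup>2)"
        using key[OF that] unfolding ennreal_L2_norm_square[OF fu[OF that]] .
      then have "(L2_norm M (\<lambda>x. f x - u n x))\<^sup>2 \<le> ((1/2)^k)\<^sup>2"
        by (subst (asm) ennreal_le_iff) auto
      then have "L2_norm M (\<lambda>x. f x - u n x) \<le> (1/2)^k"
        by (rule power2_le_imp_le) simp
      then show ?thesis using k L2_norm_minus_commute[of M f "u n"] by simp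
    qed
    then show "\<exists>no. \<forall>n\<ge>no. norm (L2_norm M (\<lambda>x. u n x - f x) - 0) < \<epsilon>"
      using L2_norm_nonneg by (metis abs_of_nonneg diff_zero real_norm_def)
  qed
  ultimately show ?thesis by blast
qed


subsection \<open>Spectrum of the operator of a closable form\<close>

text \<open>\<open>q_bound\<close> is the form of closability that can be checked for
  \<open>Q_D\<close>. Integration by parts against a smoother \<open>v\<close> would allow
  \<epsilon> to be 0; for \<open>v\<close> of class \<open>C1\<close> an error term of arbitrarily
  small relative size remains.\<close>

locale closable_L2_form = nonneg_form D q
  for M :: "'a measure" and D :: "('a \<Rightarrow> real) set" and q +
  assumes D_subset_L2: "u \<in> D \<Longrightarrow> u \<in> L2 M"
    and q_bound: "v \<in> D \<Longrightarrow> 0 < \<epsilon> \<Longrightarrow>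
      \<exists>K. \<forall>u\<in>D. \<bar>q u v\<bar> \<le> K * L2_norm M u + \<epsilon> * sqrt (q u u)"
begin

section \<open>Closability and the closed form\<close>

lemma q_Cauchy_bounded:
  fixes u :: "nat \<Rightarrow> 'a \<Rightarrow> real"
  assumes u: "\<And>n. u n \<in> D"
    and cauchy: "\<forall>\<epsilon>>0. \<exists>N. \<forall>m\<ge>N. \<forall>n\<ge>N. q (\<lambda>x. u m x - u n x) (\<lambda>x. u m x - u n x) < \<epsilon>"
  obtains B where "B > 0" "\<And>n. sqrt (q (u n) (u n)) \<le> B"
proof -
  obtain N where "\<forall>m\<ge>N. \<forall>n\<ge>N. q (\<lambda>x. u m x - u n x) (\<lambda>x. u m x - u n x) < 1"
    using cauchy[rule_format, OF zero_less_one] ..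
  then have N: "\<And>n. n \<ge> N \<Longrightarrow> q (\<lambda>x. u n x - u N x) (\<lambda>x. u n x - u N x) < 1"
    using order_refl[of N] by blast
  define B where "B = 1 + sqrt (q (u N) (u N)) + (\<Sum>n<N. sqrt (q (u n) (u n)))"
  have s0: "0 \<le> (\<Sum>n<N. sqrt (q (u n) (u n)))" by (intro sum_nonneg) (simp add: q_nonneg u)
  have "sqrt (q (u n) (u n)) \<le> B" for n
  proof (cases "n \<ge> N")
    case True
    have "sqrt (q (\<lambda>x. u n x - u N x) (\<lambda>x. u n x - u N x)) \<le> 1" using N[OF True] by simp
    then show ?thesis using q_triangle_diff[OF u u, of n N] s0 unfolding B_def by linarith
  next
    case False
    then have "sqrt (q (u n) (u n)) \<le> (\<Sum>n<N. sqrt (q (u n) (u n)))"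
      by (intro member_le_sum) (auto simp: q_nonneg u)
    then show ?thesis using real_sqrt_ge_zero[OF q_nonneg[OF u, of N]] unfolding B_def by linarith
  qed
  moreover have "B > 0" using s0 q_nonneg[OF u, of N] by (simp add: B_def add_pos_nonneg)
  ultimately show ?thesis using that by blast
qed

text \<open>Split \<open>q (u n) (u n)\<close> at a late index \<open>N\<close> into
  \<open>q (u n) (u N)\<close> and \<open>q (u n) (u n - u N)\<close>. The second part is small by
  Cauchy-Schwarz. The first is handled by \<open>q_bound\<close> for the fixed function
  \<open>u N\<close>, where the \<open>L2\<close> part tends to 0 and the form part is small because
  the form norms are bounded by \<open>B\<close>. Each of the three pieces gets a quarter of
  \<epsilon>.\<close>

lemma form_closable:
  assumes u: "\<And>n. u n \<in> D" and u0: "(\<lambda>n. L2_norm M (u n)) \<longlonglongrightarrow> 0"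
    and cauchy: "\<forall>\<epsilon>>0. \<exists>N. \<forall>m\<ge>N. \<forall>n\<ge>N. q (\<lambda>x. u m x - u n x) (\<lambda>x. u m x - u n x) < \<epsilon>"
  shows "(\<lambda>n. q (u n) (u n)) \<longlonglongrightarrow> 0"
proof (rule LIMSEQ_I)
  fix \<epsilon> :: real assume e: "\<epsilon> > 0"
  obtain B where B: "B > 0" "\<And>n. sqrt (q (u n) (u n)) \<le> B"
    using q_Cauchy_bounded[OF u cauchy] by metis
  have "(\<epsilon> / (4 * B))\<^sup>2 > 0" using e B by simp
  then obtain N where N: "\<And>n. n \<ge> N \<Longrightarrow>
      q (\<lambda>x. u n x - u N x) (\<lambda>x. u n x - u N x) < (\<epsilon> / (4 * B))\<^sup>2"
    using cauchy by blast
  have "\<epsilon> / (4 * B) > 0" using e B by simp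
  then obtain K where K: "\<And>v. v \<in> D \<Longrightarrow> \<bar>q v (u N)\<bar> \<le> K * L2_norm M v + \<epsilon> / (4 * B) * sqrt (q v v)"
    using q_bound[OF u[of N]] by blast
  have "(\<lambda>n. K * L2_norm M (u n)) \<longlonglongrightarrow> K * 0" by (intro tendsto_intros u0)
  then have "\<forall>\<^sub>F n in sequentially. K * L2_norm M (u n) < \<epsilon> / 4"
    by (rule order_tendstoD) (use e in simp)
  then obtain N' where N': "\<And>n. n \<ge> N' \<Longrightarrow> K * L2_norm M (u n) < \<epsilon> / 4"
    unfolding eventually_sequentially by blast
  have "norm (q (u n) (u n) - 0) < \<epsilon>" if n: "n \<ge> max N N'" for n
  proof -
    have "q (u n) (u n) = q (u n) (u N) + q (u n) (\<lambda>x. u n x - u N x)"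
      by (simp add: q_diff_right u)
    also have "q (u n) (u N) \<le> \<epsilon> / 4 + \<epsilon> / (4 * B) * B"
    proof -
      have "\<epsilon> / (4 * B) * sqrt (q (u n) (u n)) \<le> \<epsilon> / (4 * B) * B"
        using B e by (intro mult_left_mono) auto
      then show ?thesis using K[OF u, of n] N'[of n] n by simp
    qed
    also have "q (u n) (\<lambda>x. u n x - u N x) \<le> B * (\<epsilon> / (4 * B))"
    proof -
      have "sqrt (q (\<lambda>x. u n x - u N x) (\<lambda>x. u n x - u N x)) \<le> \<epsilon> / (4 * B)"
        using N[of n] n e B by (intro real_le_lsqrt) auto
      then have "sqrt (q (u n) (u n)) * sqrt (q (\<lambda>x. u n x - u N x) (\<lambda>x. u n x - u N x)) \<le> B * (\<epsilon> / (4 * B))"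
        using B e q_nonneg u D_diff by (intro mult_mono) auto
      then show ?thesis
        using q_Cauchy_Schwarz_sqrt[OF u[of n] D_diff[OF u[of n] u[of N]]] by linarith
    qed
    finally have "q (u n) (u n) \<le> 3 * \<epsilon> / 4" using B by (simp add: field_simps)
    then show ?thesis using q_nonneg[OF u, of n] e by simp
  qed
  then show "\<exists>N. \<forall>n\<ge>N. norm (q (u n) (u n) - 0) < \<epsilon>" by blast
qed

lemma form_approx_D:
  assumes "form_approx M D q u f"
  shows "f \<in> L2 M" "\<And>n. u n \<in> D" "\<And>n. u n \<in> L2 M" "(\<lambda>n. L2_norm M (\<lambda>x. u n x - f x)) \<longlonglongrightarrow> 0"
    "\<forall>\<epsilon>>0. \<exists>N. \<forall>m\<ge>N. \<forall>n\<ge>N. q (\<lambda>x. u m x - u n x) (\<lambda>x. u m x - u n x) < \<epsilon>"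
  using assms D_subset_L2 by (auto simp: form_approx_def)

lemma form_approx_const:
  assumes "v \<in> D"
  shows "form_approx M D q (\<lambda>n. v) v"
  using assms D_subset_L2[OF assms] q_zero_left[OF D_zero]
  by (simp add: form_approx_def L2_norm_def L2_inner_def)

lemma D_subset_closure_dom: "v \<in> D \<Longrightarrow> v \<in> closure_dom M D q"
  using form_approx_const by (auto simp: closure_dom_def)

lemma form_approx_q_Cauchy:
  assumes u: "form_approx M D q u f" and v: "form_approx M D q v g"
  shows "Cauchy (\<lambda>n. q (u n) (v n))"
proof (rule metric_CauchyI)
  fix \<epsilon> :: real assume e: "\<epsilon> > 0"
  note ud = form_approx_D[OF u] and vd = form_approx_D[OF v]
  obtain B where B: "B > 0" "\<And>n. sqrt (q (u n) (u n)) \<le> B" using q_Cauchy_bounded[OF ud(2,5)] by metis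
  obtain B' where B': "B' > 0" "\<And>n. sqrt (q (v n) (v n)) \<le> B'" using q_Cauchy_bounded[OF vd(2,5)] by metis
  have p: "\<epsilon> / (4 * B') > 0" "\<epsilon> / (4 * B) > 0" using e B B' by auto
  then have "(\<epsilon> / (4 * B'))\<^sup>2 > 0" "(\<epsilon> / (4 * B))\<^sup>2 > 0" by (blast intro: zero_less_power)+
  then obtain N1 N2 where
    N1: "\<And>m n. m \<ge> N1 \<Longrightarrow> n \<ge> N1 \<Longrightarrow> q (\<lambda>x. u m x - u n x) (\<lambda>x. u m x - u n x) < (\<epsilon> / (4 * B'))\<^sup>2" and
    N2: "\<And>m n. m \<ge> N2 \<Longrightarrow> n \<ge> N2 \<Longrightarrow> q (\<lambda>x. v m x - v n x) (\<lambda>x. v m x - v n x) < (\<epsilon> / (4 * B))\<^sup>2"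
    using ud(5) vd(5) by meson
  have "dist (q (u m) (v m)) (q (u n) (v n)) < \<epsilon>" if mn: "m \<ge> max N1 N2" "n \<ge> max N1 N2" for m n
  proof -
    have "q (u m) (v m) - q (u n) (v n) = q (\<lambda>x. u m x - u n x) (v m) + q (u n) (\<lambda>x. v m x - v n x)"
      by (simp add: q_diff q_diff_right ud vd)
    moreover have "\<bar>q (\<lambda>x. u m x - u n x) (v m)\<bar> \<le> \<epsilon> / (4 * B') * B'"
    proof -
      have "sqrt (q (\<lambda>x. u m x - u n x) (\<lambda>x. u m x - u n x)) \<le> \<epsilon> / (4 * B')"
        using N1[of m n] mn p by (intro real_le_lsqrt) auto
      then have "sqrt (q (\<lambda>x. u m x - u n x) (\<lambda>x. u m x - u n x)) * sqrt (q (v m) (v m)) \<le> \<epsilon> / (4 * B') * B'"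
        using B' p q_nonneg vd D_diff by (intro mult_mono) auto
      then show ?thesis
        using q_Cauchy_Schwarz_sqrt[OF D_diff[OF ud(2)[of m] ud(2)[of n]] vd(2)[of m]] by linarith
    qed
    moreover have "\<bar>q (u n) (\<lambda>x. v m x - v n x)\<bar> \<le> B * (\<epsilon> / (4 * B))"
    proof -
      have "sqrt (q (\<lambda>x. v m x - v n x) (\<lambda>x. v m x - v n x)) \<le> \<epsilon> / (4 * B)"
        using N2[of m n] mn p by (intro real_le_lsqrt) auto
      then have "sqrt (q (u n) (u n)) * sqrt (q (\<lambda>x. v m x - v n x) (\<lambda>x. v m x - v n x)) \<le> B * (\<epsilon> / (4 * B))"
        using B p q_nonneg vd ud D_diff by (intro mult_mono) auto
      then show ?thesis
        using q_Cauchy_Schwarz_sqrt[OF ud(2)[of n] D_diff[OF vd(2)[of m] vd(2)[of n]]] by linarith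
    qed
    moreover have "\<epsilon> / (4 * B') * B' = \<epsilon> / 4" "B * (\<epsilon> / (4 * B)) = \<epsilon> / 4" using B B' by auto
    ultimately show ?thesis using e unfolding dist_real_def by linarith
  qed
  then show "\<exists>N. \<forall>m\<ge>N. \<forall>n\<ge>N. dist (q (u m) (v m)) (q (u n) (v n)) < \<epsilon>" by blast
qed

text \<open>Two sequences approximating the same \<open>f\<close> differ by a sequence that is
  \<open>L2\<close>-null and form-Cauchy, so closability makes the difference form-null.\<close>

lemma form_approx_diff_null:
  assumes u: "form_approx M D q u f" and u': "form_approx M D q u' f"
  shows "(\<lambda>n. q (\<lambda>x. u n x - u' n x) (\<lambda>x. u n x - u' n x)) \<longlonglongrightarrow> 0"
proof (rule form_closable)
  note ud = form_approx_D[OF u] and vd = form_approx_D[OF u']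
  show "(\<lambda>x. u n x - u' n x) \<in> D" for n by (intro D_diff ud vd)
  show "(\<lambda>n. L2_norm M (\<lambda>x. u n x - u' n x)) \<longlonglongrightarrow> 0"
  proof (rule tendsto_sandwich[OF always_eventually always_eventually tendsto_const])
    show "\<forall>n. 0 \<le> L2_norm M (\<lambda>x. u n x - u' n x)" by (simp add: L2_norm_nonneg)
    have "L2_norm M (\<lambda>x. u n x - u' n x) \<le>
        L2_norm M (\<lambda>x. u n x - f x) + L2_norm M (\<lambda>x. (u n x - u' n x) - (u n x - f x))" for n
      by (rule L2_triangle_diff) (intro L2_diff ud vd)+
    moreover have "L2_norm M (\<lambda>x. (u n x - u' n x) - (u n x - f x)) = L2_norm M (\<lambda>x. u' n x - f x)" for n
      using L2_norm_minus_commute[of M f "u' n"] by (simp add: algebra_simps)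
    ultimately show "\<forall>n. L2_norm M (\<lambda>x. u n x - u' n x)
        \<le> L2_norm M (\<lambda>x. u n x - f x) + L2_norm M (\<lambda>x. u' n x - f x)" by simp
    show "(\<lambda>n. L2_norm M (\<lambda>x. u n x - f x) + L2_norm M (\<lambda>x. u' n x - f x)) \<longlonglongrightarrow> 0"
      using tendsto_add[OF ud(4) vd(4)] by simp
  qed
  show "\<forall>\<epsilon>>0. \<exists>N. \<forall>m\<ge>N. \<forall>n\<ge>N. q (\<lambda>x. (u m x - u' m x) - (u n x - u' n x))
      (\<lambda>x. (u m x - u' m x) - (u n x - u' n x)) < \<epsilon>"
  proof (intro allI impI)
    fix \<epsilon> :: real assume "\<epsilon> > 0"
    then have "\<epsilon> / 4 > 0" by simp
    then obtain N1 N2 where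
      N1: "\<And>m n. m \<ge> N1 \<Longrightarrow> n \<ge> N1 \<Longrightarrow> q (\<lambda>x. u m x - u n x) (\<lambda>x. u m x - u n x) < \<epsilon> / 4" and
      N2: "\<And>m n. m \<ge> N2 \<Longrightarrow> n \<ge> N2 \<Longrightarrow> q (\<lambda>x. u' m x - u' n x) (\<lambda>x. u' m x - u' n x) < \<epsilon> / 4"
      using ud(5) vd(5) by meson
    have "q (\<lambda>x. (u m x - u' m x) - (u n x - u' n x)) (\<lambda>x. (u m x - u' m x) - (u n x - u' n x)) < \<epsilon>"
      if mn: "m \<ge> max N1 N2" "n \<ge> max N1 N2" for m n
    proof -
      let ?a = "\<lambda>x. u m x - u n x" and ?b = "\<lambda>x. u' m x - u' n x"
      have ab: "?a \<in> D" "?b \<in> D" by (intro D_diff ud vd)+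
      \<comment> \<open>Together with the nonnegativity of the form at \<open>?a + ?b\<close>, this
        eliminates the cross term and bounds the left side by twice the sum of the two
        forms.\<close>
      have "q (\<lambda>x. ?a x - ?b x) (\<lambda>x. ?a x - ?b x) = q ?a ?a - 2 * q ?a ?b + q ?b ?b"
        by (rule q_diff_square[OF ab])
      moreover have "0 \<le> q ?a ?a + 2 * q ?a ?b + q ?b ?b"
        using q_line[OF ab, of 1] q_nonneg[OF D_add[OF ab]] by simp
      moreover have "(\<lambda>x. (u m x - u' m x) - (u n x - u' n x)) = (\<lambda>x. ?a x - ?b x)" by auto
      ultimately show ?thesis using N1[of m n] N2[of m n] mn by simp
    qed
    then show "\<exists>N. \<forall>m\<ge>N. \<forall>n\<ge>N. q (\<lambda>x. (u m x - u' m x) - (u n x - u' n x))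
      (\<lambda>x. (u m x - u' m x) - (u n x - u' n x)) < \<epsilon>" by blast
  qed
qed

text \<open>This is what makes the description in \<open>closure_form\<close> meaningful: a limit
  exists by the Cauchy property, and any other pair of approximating sequences changes
  \<open>q (u n) (v n)\<close> by a null sequence.\<close>

lemma closure_form_tendsto:
  assumes u: "form_approx M D q u f" and v: "form_approx M D q v g"
  shows "(\<lambda>n. q (u n) (v n)) \<longlonglongrightarrow> closure_form M D q f g"
proof -
  have uniq: "(\<lambda>n. q (u' n) (v' n)) \<longlonglongrightarrow> c" if c: "(\<lambda>n. q (u n) (v n)) \<longlonglongrightarrow> c"
    and u': "form_approx M D q u' f" and v': "form_approx M D q v' g" for u' v' c
  proof -
    note ud = form_approx_D[OF u] and vd = form_approx_D[OF v]
      and ud' = form_approx_D[OF u'] and vd' = form_approx_D[OF v']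
    obtain B where B: "B > 0" "\<And>n. sqrt (q (u n) (u n)) \<le> B" using q_Cauchy_bounded[OF ud(2,5)] by metis
    obtain B' where B': "B' > 0" "\<And>n. sqrt (q (v' n) (v' n)) \<le> B'" using q_Cauchy_bounded[OF vd'(2,5)] by metis
    have "(\<lambda>n. q (u' n) (v' n) - q (u n) (v n)) \<longlonglongrightarrow> 0"
    proof (rule tendsto_rabs_zero_cancel, rule tendsto_sandwich[OF always_eventually always_eventually tendsto_const])
      show "\<forall>n. 0 \<le> \<bar>q (u' n) (v' n) - q (u n) (v n)\<bar>" by simp
      let ?r = "\<lambda>n. sqrt (q (\<lambda>x. u' n x - u n x) (\<lambda>x. u' n x - u n x)) * B'
        + B * sqrt (q (\<lambda>x. v' n x - v n x) (\<lambda>x. v' n x - v n x))"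
      show "\<forall>n. \<bar>q (u' n) (v' n) - q (u n) (v n)\<bar> \<le> ?r n"
      proof
        fix n
        have "q (u' n) (v' n) - q (u n) (v n) = q (\<lambda>x. u' n x - u n x) (v' n) + q (u n) (\<lambda>x. v' n x - v n x)"
          by (simp add: q_diff q_diff_right ud vd ud' vd')
        moreover have "\<bar>q (\<lambda>x. u' n x - u n x) (v' n)\<bar> \<le> sqrt (q (\<lambda>x. u' n x - u n x) (\<lambda>x. u' n x - u n x)) * B'"
          by (rule order_trans[OF q_Cauchy_Schwarz_sqrt mult_left_mono])
            (auto intro!: D_diff ud ud' vd' B' q_nonneg)
        moreover have "\<bar>q (u n) (\<lambda>x. v' n x - v n x)\<bar> \<le> B * sqrt (q (\<lambda>x. v' n x - v n x) (\<lambda>x. v' n x - v n x))"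
          by (rule order_trans[OF q_Cauchy_Schwarz_sqrt mult_right_mono])
            (auto intro!: D_diff ud vd vd' B q_nonneg)
        ultimately show "\<bar>q (u' n) (v' n) - q (u n) (v n)\<bar> \<le> ?r n" by linarith
      qed
      have "?r \<longlonglongrightarrow> sqrt 0 * B' + B * sqrt 0"
        by (intro tendsto_intros form_approx_diff_null[OF u' u] form_approx_diff_null[OF v' v])
      then show "?r \<longlonglongrightarrow> 0" by simp
    qed
    from tendsto_add[OF this c] show ?thesis by simp
  qed
  obtain c where c: "(\<lambda>n. q (u n) (v n)) \<longlonglongrightarrow> c"
    using form_approx_q_Cauchy[OF u v] by (auto simp: Cauchy_convergent_iff convergent_def)
  have "closure_form M D q f g = c"
    unfolding closure_form_def using uniq[OF c] u v
    by (intro the_equality) (blast intro: LIMSEQ_unique[OF _ c])+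
  then show ?thesis using c by simp
qed

lemma L2_inner_tendsto:
  assumes "\<And>n. u n \<in> L2 M" "f \<in> L2 M" "(\<lambda>n. L2_norm M (\<lambda>x. u n x - f x)) \<longlonglongrightarrow> 0"
    and "\<And>n. v n \<in> L2 M" "g \<in> L2 M" "(\<lambda>n. L2_norm M (\<lambda>x. v n x - g x)) \<longlonglongrightarrow> 0"
  shows "(\<lambda>n. L2_inner M (u n) (v n)) \<longlonglongrightarrow> L2_inner M f g"
proof -
  let ?r = "\<lambda>n. L2_norm M (\<lambda>x. u n x - f x) * (L2_norm M g + L2_norm M (\<lambda>x. v n x - g x))
      + L2_norm M (\<lambda>x. v n x - g x) * L2_norm M f"
  have "\<bar>L2_inner M (u n) (v n) - L2_inner M f g\<bar> \<le> ?r n" for n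
  proof -
    have "L2_inner M (u n) (v n) - L2_inner M f g =
        L2_inner M (\<lambda>x. u n x - f x) (v n) + L2_inner M (\<lambda>x. v n x - g x) f"
      using assms by (simp add: L2_inner_diff L2_inner_commute[of M f])
    moreover have "\<bar>L2_inner M (\<lambda>x. u n x - f x) (v n)\<bar> \<le>
        L2_norm M (\<lambda>x. u n x - f x) * (L2_norm M g + L2_norm M (\<lambda>x. v n x - g x))"
      by (rule order_trans[OF L2_Cauchy_Schwarz mult_left_mono])
        (auto intro!: L2_diff assms L2_triangle_diff L2_norm_nonneg)
    moreover have "\<bar>L2_inner M (\<lambda>x. v n x - g x) f\<bar> \<le> L2_norm M (\<lambda>x. v n x - g x) * L2_norm M f"
      by (rule L2_Cauchy_Schwarz) (intro L2_diff assms)+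
    ultimately show ?thesis by linarith
  qed
  moreover
  have "?r \<longlonglongrightarrow> 0 * (L2_norm M g + 0) + 0 * L2_norm M f"
    by (intro tendsto_intros assms)
  then have "?r \<longlonglongrightarrow> 0" by simp
  ultimately have "(\<lambda>n. L2_inner M (u n) (v n) - L2_inner M f g) \<longlonglongrightarrow> 0"
    using Lim_null_comparison[of "\<lambda>n. L2_inner M (u n) (v n) - L2_inner M f g" ?r sequentially]
      always_eventually by force
  then show ?thesis by (simp add: LIM_zero_iff)
qed

lemma form_approx_inner_tendsto:
  assumes "form_approx M D q u f" "form_approx M D q v g"
  shows "(\<lambda>n. L2_inner M (u n) (v n)) \<longlonglongrightarrow> L2_inner M f g"
  using form_approx_D[OF assms(1)] form_approx_D[OF assms(2)] by (intro L2_inner_tendsto)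

lemma closure_form_ge:
  assumes coercive: "\<And>u. u \<in> D \<Longrightarrow> \<Lambda> * L2_inner M u u \<le> q u u" and f: "f \<in> closure_dom M D q"
  shows "\<Lambda> * L2_inner M f f \<le> closure_form M D q f f"
proof -
  obtain u where u: "form_approx M D q u f" using f by (auto simp: closure_dom_def)
  have "(\<lambda>n. \<Lambda> * L2_inner M (u n) (u n)) \<longlonglongrightarrow> \<Lambda> * L2_inner M f f"
    by (intro tendsto_intros form_approx_inner_tendsto[OF u u])
  then show ?thesis
    by (rule LIMSEQ_le[OF _ closure_form_tendsto[OF u u]])
      (use coercive form_approx_D(2)[OF u] in blast)
qed

text \<open>
  Surjectivity of \<open>T - \<mu>\<close> by the direct method: a minimising sequence of
  \<open>u \<mapsto> q(u,u) - \<mu>(u,u) - 2(h,u)\<close> is Cauchy in the form norm, and its limit solves the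
  Euler--Lagrange equation.
\<close>

lemma form_resolvent_equation:
  assumes coercive: "\<And>u. u \<in> D \<Longrightarrow> \<Lambda> * L2_inner M u u \<le> q u u" and \<mu>: "\<mu> < \<Lambda>" and h: "h \<in> L2 M"
  obtains f where "f \<in> closure_dom M D q"
    "\<And>g. g \<in> closure_dom M D q \<Longrightarrow> closure_form M D q f g = \<mu> * L2_inner M f g + L2_inner M h g"
proof -
  define \<delta> where "\<delta> = \<Lambda> - \<mu>"
  have \<delta>: "\<delta> > 0" using \<mu> by (simp add: \<delta>_def)
  define a where "a u v = q u v - \<mu> * L2_inner M u v" for u v
  have a_ge: "\<delta> * (L2_norm M u)\<^sup>2 \<le> a u u" if "u \<in> D" for u
    using coercive[OF that] by (simp add: a_def \<delta>_def L2_norm_square algebra_simps)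
  interpret I: nonneg_form "L2 M" "L2_inner M" by (rule nonneg_form_L2_inner)
  interpret a: nonneg_form D a
  proof
    show "a u v = a v u" if "u \<in> D" "v \<in> D" for u v
      using that by (simp add: a_def q_commute L2_inner_commute[of M u v])
    show "0 \<le> a u u" if "u \<in> D" for u using a_ge[OF that] \<delta>
      by (meson less_eq_real_def mult_nonneg_nonneg order_trans zero_le_power2)
  qed (auto simp: a_def D_zero D_add D_scale q_add q_scale L2_inner_add L2_inner_scale D_subset_L2 algebra_simps)
  define J where "J u = a u u - 2 * L2_inner M h u" for u
  have J_line: "J (\<lambda>x. u x + t * v x) = J u + 2 * t * (a u v - L2_inner M h v) + t\<^sup>2 * a v v"
    if "u \<in> D" "v \<in> D" for u v t
    unfolding J_def a.q_line[OF that]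
    using that h by (simp add: I.q_add_right I.q_scale_right D_subset_L2 L2_scale algebra_simps)
  \<comment> \<open>Completing the square in the norm of \<open>u\<close> bounds the functional
    below.\<close>
  have J_bound: "J u \<ge> - (L2_norm M h)\<^sup>2 / \<delta>" if "u \<in> D" for u
  proof -
    have "L2_inner M h u \<le> L2_norm M h * L2_norm M u"
      using L2_Cauchy_Schwarz[OF h D_subset_L2[OF that]] by linarith
    moreover have "0 \<le> (\<delta> * L2_norm M u - L2_norm M h)\<^sup>2 / \<delta>" using \<delta> by simp
    then have "2 * (L2_norm M h * L2_norm M u) \<le> \<delta> * (L2_norm M u)\<^sup>2 + (L2_norm M h)\<^sup>2 / \<delta>"
      using \<delta> by (simp add: field_simps power2_eq_square)
    ultimately show ?thesis using a_ge[OF that] unfolding J_def by simp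
  qed
  define m where "m = Inf (J ` D)"
  have bdd: "bdd_below (J ` D)" using J_bound by (auto simp: bdd_below_def)
  have m_le: "m \<le> J u" if "u \<in> D" for u unfolding m_def using bdd that by (auto intro: cInf_lower)
  have "\<exists>u\<in>D. J u < m + 1 / (real n + 1)" for n
    using cInf_lessD[of "J ` D" "m + 1 / (real n + 1)"] D_zero by (auto simp: m_def)
  then obtain u where uD: "\<And>n. u n \<in> D" and uJ: "\<And>n. J (u n) < m + 1 / (real n + 1)" by metis
  have a_cauchy: "a (\<lambda>x. u i x - u j x) (\<lambda>x. u i x - u j x) \<le> 2 / (real i + 1) + 2 / (real j + 1)" for i j
  proof -
    let ?d = "\<lambda>x. u j x - u i x"
    have d: "?d \<in> D" by (intro D_diff uD)
    \<comment> \<open>The midpoint of two nearly minimising functions is a competitor. Since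
      \<open>J\<close> is quadratic with leading part \<open>a\<close>, its value there being at
      least \<open>m\<close> forces \<open>a\<close> of the difference to be small.\<close>
    have "m \<le> J (\<lambda>x. u i x + (1/2) * ?d x)" by (intro m_le D_add D_scale d uD)
    moreover have "J (u j) = J (\<lambda>x. u i x + 1 * ?d x)" by simp
    ultimately have "a ?d ?d \<le> 2 * J (u i) + 2 * J (u j) - 4 * m"
      unfolding J_line[OF uD d] by (simp add: power2_eq_square field_simps)
    also have "\<dots> \<le> 2 / (real i + 1) + 2 / (real j + 1)" using uJ[of i] uJ[of j] by argo
    finally show ?thesis
      using a.q_diff_square[OF uD uD, of i j] a.q_diff_square[OF uD uD, of j i] a.q_commute[OF uD uD, of i j] by simp
  qed
  have ev: "\<exists>N. \<forall>i\<ge>N. \<forall>j\<ge>N. a (\<lambda>x. u i x - u j x) (\<lambda>x. u i x - u j x) < \<epsilon>" if "\<epsilon> > 0" for \<epsilon>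
  proof -
    obtain N where N: "4 / \<epsilon> < real N" using reals_Archimedean2 by blast
    have "2 / (real i + 1) < \<epsilon> / 2" if "i \<ge> N" for i
    proof -
      have "4 / \<epsilon> < real i + 1" using N that by linarith
      then show ?thesis using \<open>\<epsilon> > 0\<close> by (simp add: field_simps)
    qed
    then have "a (\<lambda>x. u i x - u j x) (\<lambda>x. u i x - u j x) < \<epsilon>" if "i \<ge> N" "j \<ge> N" for i j
      using a_cauchy[of i j] that by (smt (verit) field_sum_of_halves)
    then show ?thesis by blast
  qed
  have l2_cauchy: "\<exists>N. \<forall>i\<ge>N. \<forall>j\<ge>N. L2_norm M (\<lambda>x. u i x - u j x) < \<epsilon>" if "\<epsilon> > 0" for \<epsilon>
  proof -
    obtain N where N: "\<And>i j. i \<ge> N \<Longrightarrow> j \<ge> N \<Longrightarrow> a (\<lambda>x. u i x - u j x) (\<lambda>x. u i x - u j x) < \<delta> * \<epsilon>\<^sup>2"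
      using ev[OF mult_pos_pos[OF \<delta> zero_less_power[OF \<open>\<epsilon> > 0\<close>, of 2]]] by blast
    have "L2_norm M (\<lambda>x. u i x - u j x) < \<epsilon>" if "i \<ge> N" "j \<ge> N" for i j
    proof -
      have "\<delta> * (L2_norm M (\<lambda>x. u i x - u j x))\<^sup>2 < \<delta> * \<epsilon>\<^sup>2"
        using a_ge[OF D_diff[OF uD uD, of i j]] N[OF that] by linarith
      then show ?thesis using \<delta> \<open>\<epsilon> > 0\<close> by (simp add: power2_less_imp_less)
    qed
    then show ?thesis by blast
  qed
  obtain f where f: "f \<in> L2 M" and uf: "(\<lambda>n. L2_norm M (\<lambda>x. u n x - f x)) \<longlonglongrightarrow> 0"
    using L2_complete[OF D_subset_L2[OF uD] l2_cauchy] by blast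
  have q_cauchy: "\<exists>N. \<forall>i\<ge>N. \<forall>j\<ge>N. q (\<lambda>x. u i x - u j x) (\<lambda>x. u i x - u j x) < \<epsilon>" if "\<epsilon> > 0" for \<epsilon>
  proof -
    \<comment> \<open>\<open>q\<close> differs from \<open>a\<close> by \<mu> times the squared
      \<open>L2\<close> norm, and \<mu> may have either sign; \<open>s\<close> is the norm threshold
      at which this term is at most half of \<epsilon>.\<close>
    define s where "s = sqrt (\<epsilon> / (2 * (\<bar>\<mu>\<bar> + 1)))"
    have s: "s > 0" "s\<^sup>2 = \<epsilon> / (2 * (\<bar>\<mu>\<bar> + 1))" using that by (simp_all add: s_def)
    obtain N1 where N1: "\<And>i j. i \<ge> N1 \<Longrightarrow> j \<ge> N1 \<Longrightarrow> a (\<lambda>x. u i x - u j x) (\<lambda>x. u i x - u j x) < \<epsilon> / 2"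
      using ev[OF half_gt_zero[OF \<open>\<epsilon> > 0\<close>]] by blast
    obtain N2 where N2: "\<And>i j. i \<ge> N2 \<Longrightarrow> j \<ge> N2 \<Longrightarrow> L2_norm M (\<lambda>x. u i x - u j x) < s"
      using l2_cauchy[OF s(1)] by blast
    have "q (\<lambda>x. u i x - u j x) (\<lambda>x. u i x - u j x) < \<epsilon>" if ij: "i \<ge> max N1 N2" "j \<ge> max N1 N2" for i j
    proof -
      let ?d = "\<lambda>x. u i x - u j x"
      have "L2_inner M ?d ?d \<le> s\<^sup>2"
        using N2[of i j] ij L2_norm_nonneg[of M ?d] unfolding L2_norm_square[symmetric] by (intro power_mono) auto
      then have "\<mu> * L2_inner M ?d ?d \<le> (\<bar>\<mu>\<bar> + 1) * s\<^sup>2"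
        by (intro mult_mono) (auto simp: L2_inner_nonneg)
      also have "\<dots> = \<epsilon> / 2" unfolding s(2) by (simp add: field_simps)
      finally show ?thesis using N1[of i j] ij by (simp add: a_def)
    qed
    then show ?thesis by blast
  qed
  have app: "form_approx M D q u f" using f uD uf q_cauchy by (simp add: form_approx_def)
  show thesis
  proof (rule that)
    show "f \<in> closure_dom M D q" using app by (auto simp: closure_dom_def)
    fix g assume "g \<in> closure_dom M D q"
    then obtain v where v: "form_approx M D q v g" by (auto simp: closure_dom_def)
    note vd = form_approx_D[OF v]
    have avv: "(\<lambda>n. a (v n) (v n)) \<longlonglongrightarrow> closure_form M D q g g - \<mu> * L2_inner M g g"
      unfolding a_def by (intro tendsto_intros closure_form_tendsto form_approx_inner_tendsto v)
    \<comment> \<open>First variation at an approximate minimiser: the gap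
      \<open>1 / (n + 1)\<close> between \<open>J (u n)\<close> and its infimum plays the role of
      the constant term in the discriminant inequality, so the derivative of \<open>J\<close> at
      \<open>u n\<close> in direction \<open>v n\<close> is nearly 0.\<close>
    have bound: "(a (u n) (v n) - L2_inner M h (v n))\<^sup>2 \<le> 1 / (real n + 1) * a (v n) (v n)" for n
    proof (rule nonneg_quadratic_discriminant)
      fix t :: real
      have "m \<le> J (\<lambda>x. u n x + t * v n x)" by (intro m_le D_add D_scale uD vd)
      then show "0 \<le> 1 / (real n + 1) + 2 * t * (a (u n) (v n) - L2_inner M h (v n)) + t\<^sup>2 * a (v n) (v n)"
        unfolding J_line[OF uD vd(2)] using uJ[of n] by simp
    qed (rule a.q_nonneg[OF vd(2)])
    have "(\<lambda>n. 1 / (real n + 1) * a (v n) (v n)) \<longlonglongrightarrow> 0 * (closure_form M D q g g - \<mu> * L2_inner M g g)"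
      using LIMSEQ_inverse_real_of_nat by (intro tendsto_intros avv) (simp add: inverse_eq_divide add.commute)
    then have lim: "(\<lambda>n. 1 / (real n + 1) * a (v n) (v n)) \<longlonglongrightarrow> 0" by simp
    have "(\<lambda>n. (a (u n) (v n) - L2_inner M h (v n))\<^sup>2) \<longlonglongrightarrow> 0"
      by (rule tendsto_sandwich[OF always_eventually always_eventually tendsto_const lim])
        (simp, use bound in blast)
    then have "(\<lambda>n. a (u n) (v n) - L2_inner M h (v n)) \<longlonglongrightarrow> 0"
      by simp
    moreover have "(\<lambda>n. a (u n) (v n) - L2_inner M h (v n)) \<longlonglongrightarrow>
        (closure_form M D q f g - \<mu> * L2_inner M f g) - L2_inner M h g"
      unfolding a_def
      by (intro tendsto_intros closure_form_tendsto form_approx_inner_tendsto v app L2_inner_tendsto[OF h h _ vd(3) vd(1) vd(4)])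
        (simp add: L2_norm_def L2_inner_def)
    ultimately have "(closure_form M D q f g - \<mu> * L2_inner M f g) - L2_inner M h g = 0"
      by (rule LIMSEQ_unique[symmetric])
    then show "closure_form M D q f g = \<mu> * L2_inner M f g + L2_inner M h g" by simp
  qed
qed

text \<open>Onto: a solution \<open>f\<close> of the weak equation lies in the graph with image
  \<open>\<mu> * f + h\<close>. Bounded inverse: coercivity gives \<open>(\<Lambda> - \<mu>)\<close>
  times the squared norm of \<open>f\<close> at most the inner product of the residual with
  \<open>f\<close>, and Cauchy-Schwarz yields the constant
  \<open>1 / (\<Lambda> - \<mu>)\<close>.\<close>

lemma below_form_bound_in_resolvent_set:
  assumes coercive: "\<And>u. u \<in> D \<Longrightarrow> \<Lambda> * L2_inner M u u \<le> q u u" and \<mu>: "\<mu> < \<Lambda>"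
  shows "\<mu> \<in> resolvent_set M (form_operator M D q)"
  unfolding resolvent_set_def
proof (intro CollectI conjI ballI exI)
  fix h assume h: "h \<in> L2 M"
  obtain f where f: "f \<in> closure_dom M D q"
    "\<And>g. g \<in> closure_dom M D q \<Longrightarrow> closure_form M D q f g = \<mu> * L2_inner M f g + L2_inner M h g"
    using form_resolvent_equation[OF coercive \<mu> h] by blast
  have cl: "g \<in> L2 M" if "g \<in> closure_dom M D q" for g
    using that form_approx_D(1) by (auto simp: closure_dom_def)
  have "(f, \<lambda>x. \<mu> * f x + h x) \<in> form_operator M D q"
    using f h cl by (auto simp: form_operator_def L2_inner_add L2_inner_scale L2_add L2_scale)
  then show "\<exists>(f, k)\<in>form_operator M D q. AE x in M. k x - \<mu> * f x = h x"
    by (intro bexI) auto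
next
  fix p assume p: "p \<in> form_operator M D q"
  obtain f k where fk: "p = (f, k)" by force
  have f: "f \<in> closure_dom M D q" "f \<in> L2 M" and k: "k \<in> L2 M" and eq: "closure_form M D q f f = L2_inner M k f"
    using p form_approx_D(1) unfolding fk by (auto simp: form_operator_def closure_dom_def)
  let ?r = "\<lambda>x. k x - \<mu> * f x"
  have r: "?r \<in> L2 M" by (intro L2_diff k L2_scale f)
  have "(\<Lambda> - \<mu>) * (L2_norm M f)\<^sup>2 \<le> L2_inner M ?r f"
    using closure_form_ge[OF coercive f(1)] f k
    by (simp add: eq L2_inner_diff L2_inner_scale L2_scale L2_norm_square algebra_simps)
  also have "\<dots> \<le> L2_norm M ?r * L2_norm M f"
    using L2_Cauchy_Schwarz[OF r f(2)] by linarith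
  finally have "(\<Lambda> - \<mu>) * L2_norm M f * L2_norm M f \<le> L2_norm M ?r * L2_norm M f"
    by (simp add: power2_eq_square algebra_simps)
  then have "(\<Lambda> - \<mu>) * L2_norm M f \<le> L2_norm M ?r"
    using L2_norm_nonneg[of M f] L2_norm_nonneg[of M ?r]
    by (cases "L2_norm M f = 0") (auto simp: mult_le_cancel_right)
  then have "L2_norm M f \<le> 1 / (\<Lambda> - \<mu>) * L2_norm M ?r" using \<mu> by (simp add: field_simps)
  then show "case p of (f, k) \<Rightarrow> L2_norm M f \<le> 1 / (\<Lambda> - \<mu>) * L2_norm M (\<lambda>x. k x - \<mu> * f x)"
    by (simp add: fk)
qed

text \<open>
  If \<open>\<nu>\<close> is a lower form bound in the resolvent set, Cauchy--Schwarz for \<open>q - \<nu>\<close> applied to \<open>u\<close> and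
  \<open>(T - \<nu>)\<^bsup>-1\<^esup> u\<close> improves the bound.
\<close>

lemma form_bound_improvement:
  assumes coercive: "\<And>u. u \<in> D \<Longrightarrow> \<nu> * L2_inner M u u \<le> q u u"
    and res: "\<nu> \<in> resolvent_set M (form_operator M D q)"
  obtains K where "\<And>u. u \<in> D \<Longrightarrow> L2_inner M u u \<le> K * (q u u - \<nu> * L2_inner M u u)"
proof -
  obtain K where onto: "\<And>h. h \<in> L2 M \<Longrightarrow> \<exists>(f, k)\<in>form_operator M D q. AE x in M. k x - \<nu> * f x = h x"
    and K: "\<And>f k. (f, k) \<in> form_operator M D q \<Longrightarrow> L2_norm M f \<le> K * L2_norm M (\<lambda>x. k x - \<nu> * f x)"
    using res unfolding resolvent_set_def by blast
  define a where "a u v = q u v - \<nu> * L2_inner M u v" for u v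
  interpret I: nonneg_form "L2 M" "L2_inner M" by (rule nonneg_form_L2_inner)
  interpret a: nonneg_form D a
  proof
    show "a u v = a v u" if "u \<in> D" "v \<in> D" for u v
      using that by (simp add: a_def q_commute L2_inner_commute[of M u v])
    show "0 \<le> a u u" if "u \<in> D" for u using coercive[OF that] by (simp add: a_def)
  qed (auto simp: a_def D_zero D_add D_scale q_add q_scale L2_inner_add L2_inner_scale D_subset_L2 algebra_simps)
  have "L2_inner M u u \<le> K * a u u" if u: "u \<in> D" for u
  proof -
    note uL = D_subset_L2[OF u]
    obtain f k where fk: "(f, k) \<in> form_operator M D q" and ae: "AE x in M. k x - \<nu> * f x = u x"
      using onto[OF uL] by blast
    have f: "f \<in> closure_dom M D q" "f \<in> L2 M" and k: "k \<in> L2 M"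
      and eq: "\<And>g. g \<in> closure_dom M D q \<Longrightarrow> closure_form M D q f g = L2_inner M k g"
      using fk form_approx_D(1) by (auto simp: form_operator_def closure_dom_def)
    obtain v where v: "form_approx M D q v f" using f by (auto simp: closure_dom_def)
    let ?r = "\<lambda>x. k x - \<nu> * f x"
    \<comment> \<open>The resolvent equation holds only almost everywhere, so it is used through
      inner products.\<close>
    have inner: "L2_inner M ?r g = L2_inner M u g" if "g \<in> L2 M" for g
      unfolding L2_inner_def
    proof (rule integral_cong_AE)
      show "AE x in M. ?r x * g x = u x * g x" using ae by eventually_elim simp
    qed (intro borel_measurable_times borel_measurable_diff borel_measurable_const L2_D(1) that f k uL)+
    have cl: "closure_form M D q f g - \<nu> * L2_inner M f g = L2_inner M u g"
      if "g \<in> closure_dom M D q" for g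
    proof -
      have "g \<in> L2 M" using that form_approx_D(1) by (auto simp: closure_dom_def)
      then show ?thesis using inner[of g] eq[OF that] f k by (simp add: L2_inner_diff L2_inner_scale L2_scale)
    qed
    have lim1: "(\<lambda>n. a (v n) u) \<longlonglongrightarrow> L2_inner M u u"
      unfolding cl[OF D_subset_closure_dom[OF u], symmetric] a_def
      by (intro tendsto_intros closure_form_tendsto form_approx_inner_tendsto v form_approx_const u)
    have lim2: "(\<lambda>n. a (v n) (v n)) \<longlonglongrightarrow> L2_inner M u f"
      unfolding cl[OF f(1), symmetric] a_def
      by (intro tendsto_intros closure_form_tendsto form_approx_inner_tendsto v)
    have "(L2_inner M u u)\<^sup>2 \<le> L2_inner M u f * a u u"
      by (rule LIMSEQ_le[OF tendsto_power[OF lim1] tendsto_mult[OF lim2 tendsto_const]])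
        (use a.q_Cauchy_Schwarz[OF form_approx_D(2)[OF v] u] in blast)
    also have "L2_inner M u f \<le> K * L2_inner M u u"
    proof -
      have "L2_norm M ?r = L2_norm M u"
        unfolding L2_norm_def using inner[of ?r] inner[OF uL] L2_inner_commute[of M ?r u] L2_diff[OF k L2_scale[OF f(2)]]
        by simp
      then have "L2_norm M u * L2_norm M f \<le> L2_norm M u * (K * L2_norm M u)"
        using K[OF fk] L2_norm_nonneg[of M u] by (intro mult_left_mono) auto
      then show ?thesis using L2_Cauchy_Schwarz[OF uL f(2)]
        by (simp flip: L2_norm_square add: power2_eq_square algebra_simps)
    qed
    finally have le: "(L2_inner M u u)\<^sup>2 \<le> K * L2_inner M u u * a u u"
      using a.q_nonneg[OF u] by (simp add: mult_right_mono)
    show ?thesis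
    proof (cases "L2_inner M u u = 0")
      case True
      then have "L2_norm M u = 0" by (simp add: L2_norm_def)
      \<comment> \<open>The sign of \<open>K\<close> is unknown, so \<open>q u u\<close> itself must
        vanish. The constant sequence \<open>u\<close> converges in \<open>L2\<close> to 0 because
        \<open>u\<close> has norm 0, and closability then gives the claim.\<close>
      have "q u u = 0"
      proof -
        have "form_approx M D q (\<lambda>n. u) (\<lambda>x. 0)" using u \<open>L2_norm M u = 0\<close> L2_zero q_zero_left[OF D_zero]
          by (simp add: form_approx_def)
        from form_approx_diff_null[OF this form_approx_const[OF D_zero]]
        show ?thesis by (simp add: LIMSEQ_const_iff)
      qed
      then show ?thesis using True by (simp add: a_def)
    next
      case False
      then have "L2_inner M u u > 0" using L2_inner_nonneg[of M u] by simp
      then show ?thesis using le by (simp add: power2_eq_square mult.assoc mult.left_commute)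
    qed
  qed
  then show thesis using that unfolding a_def by blast
qed

theorem inf_op_spectrum_ge:
  assumes "\<And>u. u \<in> D \<Longrightarrow> \<Lambda> * L2_inner M u u \<le> q u u"
  shows "ereal \<Lambda> \<le> (INF \<mu>\<in>op_spectrum M (form_operator M D q). ereal \<mu>)"
proof (rule INF_greatest)
  fix \<mu> assume "\<mu> \<in> op_spectrum M (form_operator M D q)"
  then show "ereal \<Lambda> \<le> ereal \<mu>"
    using below_form_bound_in_resolvent_set[OF assms, of \<mu>] by (auto simp: op_spectrum_def not_less[symmetric])
qed

theorem inf_op_spectrum_le:
  assumes u0: "u0 \<in> D" "0 < L2_inner M u0 u0" and le: "q u0 u0 \<le> \<Lambda> * L2_inner M u0 u0"
  shows "(INF \<mu>\<in>op_spectrum M (form_operator M D q). ereal \<mu>) \<le> ereal \<Lambda>"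
proof -
  define R where "R = {q u u / L2_inner M u u |u. u \<in> D \<and> 0 < L2_inner M u u}"
  define \<nu> where "\<nu> = Inf R"
  have bdd: "bdd_below R" by (rule bdd_belowI[of _ 0]) (auto simp: R_def q_nonneg)
  have ne: "R \<noteq> {}" using u0 by (auto simp: R_def)
  have coercive: "\<nu> * L2_inner M u u \<le> q u u" if "u \<in> D" for u
  proof (cases "L2_inner M u u = 0")
    case False
    then have p: "L2_inner M u u > 0" using L2_inner_nonneg[of M u] by simp
    then have "\<nu> \<le> q u u / L2_inner M u u" unfolding \<nu>_def using that
      by (intro cInf_lower bdd) (auto simp: R_def)
    then show ?thesis using p by (simp add: field_simps)
  qed (simp add: q_nonneg that)
  have "\<nu> \<in> op_spectrum M (form_operator M D q)"
  proof (rule ccontr)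
    assume "\<not> ?thesis"
    then have "\<nu> \<in> resolvent_set M (form_operator M D q)" by (simp add: op_spectrum_def)
    then obtain K where K: "\<And>u. u \<in> D \<Longrightarrow> L2_inner M u u \<le> K * (q u u - \<nu> * L2_inner M u u)"
      using form_bound_improvement[OF coercive] by blast
    have "0 < K * (q u0 u0 - \<nu> * L2_inner M u0 u0)" using K[OF u0(1)] u0(2) by linarith
    moreover have "0 \<le> q u0 u0 - \<nu> * L2_inner M u0 u0" using coercive[OF u0(1)] by simp
    \<comment> \<open>The resolvent bound carries no sign for \<open>K\<close>; the test function of
      positive norm supplies it, so that \<open>1 / K\<close> is a genuine gain over the infimum
      \<nu>.\<close>
    ultimately have Kpos: "K > 0" by (simp add: zero_less_mult_iff)
    have "\<nu> + 1 / K \<le> Inf R"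
    proof (rule cInf_greatest[OF ne])
      fix r assume "r \<in> R"
      then obtain u where u: "u \<in> D" "0 < L2_inner M u u" "r = q u u / L2_inner M u u" by (auto simp: R_def)
      then show "\<nu> + 1 / K \<le> r"
      proof -
        have "L2_inner M u u * (\<nu> + 1 / K) \<le> q u u"
          using K[OF u(1)] Kpos by (simp add: field_simps)
        then show ?thesis using u(2,3) by (simp add: le_divide_eq mult.commute)
      qed
    qed
    then show False using Kpos by (simp add: \<nu>_def)
  qed
  then have "(INF \<mu>\<in>op_spectrum M (form_operator M D q). ereal \<mu>) \<le> ereal \<nu>" by (rule INF_lower)
  also have "\<nu> \<le> q u0 u0 / L2_inner M u0 u0" unfolding \<nu>_def using u0
    by (intro cInf_lower bdd) (auto simp: R_def)
  then have "ereal \<nu> \<le> ereal \<Lambda>" using le u0(2) by (simp add: field_simps) (smt (verit) mult_le_cancel_right)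
  finally show ?thesis by simp
qed

end


subsection \<open>Compactly supported functions\<close>

lemma drift_primitive_has_derivative:
  assumes "continuous_on UNIV g"
  shows "(drift_primitive g has_real_derivative g x) (at x)"
proof -
  \<comment> \<open>An interval that contains the base point 0 and has \<open>x\<close> in its
    interior, so that the one-interval fundamental theorem yields a full derivative.\<close>
  let ?a = "- \<bar>x\<bar> - 1" and ?b = "\<bar>x\<bar> + 1"
  have "(drift_primitive g has_vector_derivative g x) (at x within {?a..?b})"
    unfolding drift_primitive_def
    by (rule interval_integral_FTC2) (auto intro: continuous_on_subset[OF assms])
  then have "(drift_primitive g has_real_derivative g x) (at x within {?a..?b})"
    by (simp add: has_real_derivative_iff_has_vector_derivative)
  moreover have "at x within {?a..?b} = at x"
    by (rule at_within_interior) auto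
  ultimately show ?thesis by simp
qed

lemma drift_primitive_0: "drift_primitive g 0 = 0"
  by (simp add: drift_primitive_def)

lemma DERIV_eq_primitive:
  fixes B :: "real \<Rightarrow> real"
  assumes "continuous_on UNIV g" "\<And>x. (B has_real_derivative g x) (at x)" "B 0 = 0"
  shows "B = drift_primitive g"
proof
  fix x
  have "((\<lambda>x. B x - drift_primitive g x) has_real_derivative 0) (at x)" for x
    using DERIV_diff[OF assms(2) drift_primitive_has_derivative[OF assms(1)], of x] by simp
  then have "B x - drift_primitive g x = B 0 - drift_primitive g 0"
    by (intro DERIV_isconst_all allI)
  then show "B x = drift_primitive g x" by (simp add: assms drift_primitive_0)
qed

text \<open>Asks for continuity only, on the whole line, and for any compact set carrying the
  function: this is stable under products with continuous functions and applies equally to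
  \<open>u\<close>, \<open>deriv u\<close> and their multiples by \<open>w\<close>.\<close>

definition compactly_supported :: "real set \<Rightarrow> (real \<Rightarrow> real) \<Rightarrow> bool" where
  "compactly_supported I f \<longleftrightarrow> continuous_on UNIV f \<and> (\<exists>K. compact K \<and> K \<subseteq> I \<and> (\<forall>x. x \<notin> K \<longrightarrow> f x = 0))"

lemma compactly_supportedI:
  "continuous_on UNIV f \<Longrightarrow> compact K \<Longrightarrow> K \<subseteq> I \<Longrightarrow> (\<And>x. x \<notin> K \<Longrightarrow> f x = 0) \<Longrightarrow> compactly_supported I f"
  by (auto simp: compactly_supported_def)

lemma compactly_supportedE:
  assumes "compactly_supported I f"
  obtains K where "continuous_on UNIV f" "compact K" "K \<subseteq> I" "\<And>x. x \<notin> K \<Longrightarrow> f x = 0"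
  using assms by (auto simp: compactly_supported_def)

lemma compactly_supported_mult:
  assumes "compactly_supported I f" "continuous_on UNIV g"
  shows "compactly_supported I (\<lambda>x. f x * g x)" "compactly_supported I (\<lambda>x. g x * f x)"
  using assms by (auto simp: compactly_supported_def intro!: continuous_intros)

lemma compactly_supported_add:
  assumes "compactly_supported I f" "compactly_supported I g"
  shows "compactly_supported I (\<lambda>x. f x + g x)"
proof -
  obtain K where K: "continuous_on UNIV f" "compact K" "K \<subseteq> I" "\<And>x. x \<notin> K \<Longrightarrow> f x = 0"
    using compactly_supportedE[OF assms(1)] by blast
  obtain K' where K': "continuous_on UNIV g" "compact K'" "K' \<subseteq> I" "\<And>x. x \<notin> K' \<Longrightarrow> g x = 0"
    using compactly_supportedE[OF assms(2)] by blast
  show ?thesis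
    by (rule compactly_supportedI[where K="K \<union> K'"]) (use K K' in \<open>auto intro!: continuous_intros\<close>)
qed

lemma compactly_supported_diff:
  assumes "compactly_supported I f" "compactly_supported I g"
  shows "compactly_supported I (\<lambda>x. f x - g x)"
  using compactly_supported_add[OF assms(1) compactly_supported_mult(1)[OF assms(2) continuous_on_const[of _ "-1"]]]
  by simp

lemma compactly_supported_integrable:
  assumes "compactly_supported I f"
  shows "integrable lborel f"
proof -
  obtain K where K: "continuous_on UNIV f" "compact K" "K \<subseteq> I" "\<And>x. x \<notin> K \<Longrightarrow> f x = 0"
    using compactly_supportedE[OF assms] by blast
  have "integrable lborel (\<lambda>x. indicator K x *\<^sub>R f x)"
    using K continuous_on_subset[OF K(1) subset_UNIV] by (intro borel_integrable_compact)
  moreover have "(\<lambda>x. indicator K x *\<^sub>R f x) = f" using K(4) by (auto simp: indicator_def fun_eq_iff)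
  ultimately show ?thesis by simp
qed

lemma compactly_supported_bounded:
  assumes "compactly_supported I f"
  obtains B where "\<And>x. \<bar>f x\<bar> \<le> B"
proof -
  obtain K where K: "continuous_on UNIV f" "compact K" "K \<subseteq> I" "\<And>x. x \<notin> K \<Longrightarrow> f x = 0"
    using compactly_supportedE[OF assms] by blast
  have "bounded (f ` K)"
    using K continuous_on_subset[OF K(1) subset_UNIV] by (intro compact_imp_bounded compact_continuous_image)
  then obtain B where "\<And>x. x \<in> K \<Longrightarrow> \<bar>f x\<bar> \<le> B" by (auto simp: bounded_iff)
  then have "\<bar>f x\<bar> \<le> max B 0" for x using K(4)[of x] by (cases "x \<in> K") fastforce+
  then show ?thesis using that by blast
qed

lemma compactly_supported_integral_deriv:
  assumes h: "compactly_supported I h" and d: "\<And>x. (h has_real_derivative h' x) (at x)"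
    and h': "compactly_supported I h'"
  shows "(LBINT x. h' x) = 0"
proof -
  obtain K where K: "continuous_on UNIV h" "compact K" "K \<subseteq> I" "\<And>x. x \<notin> K \<Longrightarrow> h x = 0"
    using compactly_supportedE[OF h] by blast
  obtain K' where K': "continuous_on UNIV h'" "compact K'" "K' \<subseteq> I" "\<And>x. x \<notin> K' \<Longrightarrow> h' x = 0"
    using compactly_supportedE[OF h'] by blast
  have "bounded (K \<union> K')" using K K' by (auto intro: compact_imp_bounded)
  then obtain R where R: "R > 0" "\<And>x. x \<in> K \<union> K' \<Longrightarrow> \<bar>x\<bar> \<le> R" by (auto simp: bounded_pos)
  have "(LBINT x. h' x) = (LBINT x. h' x * indicator {-R-1..R+1} x)"
    using K'(4) R(2) by (intro Bochner_Integration.integral_cong) (force simp: indicator_def)+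
  also have "\<dots> = h (R+1) - h (-R-1)"
    by (rule integral_FTC_Icc_real) (use R d K'(1) in \<open>auto simp: continuous_on_eq_continuous_at\<close>)
  also have "h (R+1) = 0" using R(2)[of "R+1"] R(1) by (intro K(4)) auto
  also have "h (-R-1) = 0" using R(2)[of "-R-1"] R(1) by (intro K(4)) auto
  finally show ?thesis by simp
qed

lemma C1_compact_D:
  assumes u: "u \<in> C1_compact I"
  shows "(u has_real_derivative deriv u x) (at x)" "compactly_supported I u" "compactly_supported I (deriv u)"
proof -
  have c1: "u C1_differentiable_on UNIV" and K: "compact (closure {x. u x \<noteq> 0})" "closure {x. u x \<noteq> 0} \<subseteq> I"
    using u by (auto simp: C1_compact_def)
  obtain D where D: "\<And>x. (u has_vector_derivative D x) (at x)" "continuous_on UNIV D"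
    using c1 by (auto simp: C1_differentiable_on_def)
  have der: "(u has_real_derivative D x) (at x)" for x
    using D(1) by (simp add: has_real_derivative_iff_has_vector_derivative)
  then have Deq: "deriv u = D" using DERIV_imp_deriv by blast
  show "(u has_real_derivative deriv u x) (at x)" using der Deq by simp
  have out: "u x = 0" if "x \<notin> closure {x. u x \<noteq> 0}" for x
    using that closure_subset[of "{x. u x \<noteq> 0}"] by blast
  have "continuous_on UNIV u" by (rule DERIV_continuous_on[of _ _ D]) (simp add: der)
  then show "compactly_supported I u"
    using K out by (rule compactly_supportedI)
  \<comment> \<open>The complement of the closed support is open, so \<open>u\<close> vanishes near
    \<open>x\<close>.\<close>
  have "D x = 0" if "x \<notin> closure {x. u x \<noteq> 0}" for x
  proof -
    have "(u has_real_derivative 0) (at x)"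
    proof (rule has_field_derivative_transform_within_open)
      show "((\<lambda>x. 0) has_real_derivative 0) (at x)" by simp
      show "open (- closure {x. u x \<noteq> 0})" by (rule open_Compl[OF closed_closure])
      show "x \<in> - closure {x. u x \<noteq> 0}" using that by (simp only: Compl_iff not_False_eq_True)
      show "0 = u y" if "y \<in> - closure {x. u x \<noteq> 0}" for y
        by (rule out[symmetric]) (use that in \<open>simp only: Compl_iff not_False_eq_True\<close>)
    qed
    then show ?thesis using DERIV_unique der by blast
  qed
  then show "compactly_supported I (deriv u)" unfolding Deq using K D(2)
    by (intro compactly_supportedI[where K="closure {x. u x \<noteq> 0}"]) auto
qed

lemma C1_compact_I:
  assumes d: "\<And>x. (u has_real_derivative u' x) (at x)" and c: "continuous_on UNIV u'"
    and K: "compact K" "K \<subseteq> I" "\<And>x. x \<notin> K \<Longrightarrow> u x = 0"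
  shows "u \<in> C1_compact I" "deriv u = u'"
proof -
  have sub: "closure {x. u x \<noteq> 0} \<subseteq> K"
    using K by (intro closure_minimal) (auto intro: compact_imp_closed)
  then have "compact (closure {x. u x \<noteq> 0})"
    using K(1) by (meson bounded_subset closed_closure compact_eq_bounded_closed)
  moreover have "u C1_differentiable_on UNIV"
    using d c unfolding C1_differentiable_on_def has_real_derivative_iff_has_vector_derivative by blast
  ultimately show "u \<in> C1_compact I" using sub K(2) by (auto simp: C1_compact_def)
  show "deriv u = u'" using d DERIV_imp_deriv by blast
qed

text \<open>One-sided averages move supports to the right only, hence keep them inside \<open>(0, \<infinity>)\<close>.\<close>

definition backward_average :: "(real \<Rightarrow> real) \<Rightarrow> nat \<Rightarrow> real \<Rightarrow> real" where
  "backward_average f n x = (drift_primitive f x - drift_primitive f (x - 1 / (real n + 1))) * (real n + 1)"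

definition backward_quotient :: "(real \<Rightarrow> real) \<Rightarrow> nat \<Rightarrow> real \<Rightarrow> real" where
  "backward_quotient f n x = (f x - f (x - 1 / (real n + 1))) * (real n + 1)"

lemma backward_quotient_tendsto:
  assumes "(f has_real_derivative d) (at x)"
  shows "(\<lambda>n. backward_quotient f n x) \<longlonglongrightarrow> d"
proof -
  have *: "((\<lambda>h. (f (x + h) - f x) / h) \<longlongrightarrow> d) (at 0)" using assms by (simp add: DERIV_def)
  have "(\<lambda>n. - inverse (real (Suc n))) \<longlonglongrightarrow> - 0" by (intro tendsto_intros LIMSEQ_inverse_real_of_nat)
  then have "filterlim (\<lambda>n. - inverse (real (Suc n))) (at 0) sequentially"
    by (auto simp: filterlim_at intro!: always_eventually)
  from filterlim_compose[OF * this] show ?thesis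
    unfolding backward_quotient_def
    by (rule back_subst[of "\<lambda>f. f \<longlonglongrightarrow> d"]) (auto simp: fun_eq_iff field_simps)
qed

text \<open>The average of \<open>f\<close> is the backward quotient of its primitive, so both
  claims come from differentiating that primitive.\<close>

lemma
  assumes "continuous_on UNIV f"
  shows backward_average_tendsto: "(\<lambda>n. backward_average f n x) \<longlonglongrightarrow> f x"
    and backward_average_has_derivative:
      "(backward_average f n has_real_derivative backward_quotient f n x) (at x)"
proof -
  note d = drift_primitive_has_derivative[OF assms]
  show "(\<lambda>n. backward_average f n x) \<longlonglongrightarrow> f x"
    using backward_quotient_tendsto[OF d] by (simp add: backward_quotient_def backward_average_def)
  show "(backward_average f n has_real_derivative backward_quotient f n x) (at x)"
    unfolding backward_average_def backward_quotient_def
    by (auto intro!: derivative_eq_intros d DERIV_chain'[where g="drift_primitive f", OF _ d])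
qed

lemma backward_average_bound:
  assumes c: "continuous_on UNIV f" and B: "\<And>x. \<bar>f x\<bar> \<le> B"
  shows "\<bar>backward_average f n x\<bar> \<le> B"
proof -
  let ?e = "1 / (real n + 1)"
  have "\<bar>drift_primitive f x - drift_primitive f (x - ?e)\<bar> \<le> B * \<bar>x - (x - ?e)\<bar>"
    using field_differentiable_bound[of UNIV "drift_primitive f" f B x "x - ?e"]
      drift_primitive_has_derivative[OF c] B by (simp add: real_norm_def)
  then have "\<bar>drift_primitive f x - drift_primitive f (x - ?e)\<bar> * (real n + 1) \<le> B * \<bar>x - (x - ?e)\<bar> * (real n + 1)"
    by (rule mult_right_mono) simp
  then show ?thesis by (simp add: backward_average_def abs_mult)
qed

lemma backward_average_eq_0:
  assumes c: "continuous_on UNIV f" and K: "\<And>y. x - 1 \<le> y \<Longrightarrow> y \<le> x \<Longrightarrow> f y = 0"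
  shows "backward_average f n x = 0"
proof -
  let ?e = "1 / (real n + 1)"
  have "\<exists>z. x - ?e < z \<and> z < x \<and> drift_primitive f x - drift_primitive f (x - ?e) = (x - (x - ?e)) * f z"
    by (rule MVT2) (auto intro: drift_primitive_has_derivative[OF c])
  then obtain z where z: "x - ?e < z" "z < x" "drift_primitive f x - drift_primitive f (x - ?e) = (x - (x - ?e)) * f z"
    by blast
  have "?e \<le> 1" by simp
  then have "f z = 0" using z by (intro K) linarith+
  then show ?thesis using z(3) by (simp add: backward_average_def)
qed

text \<open>The Minkowski sum of \<open>K\<close> with the unit interval: adding nonnegative numbers
  cannot leave \<open>(0, \<infinity>)\<close>. All averaging steps \<open>1 / (n + 1)\<close> are
  at most 1, so one set serves every \<open>n\<close>.\<close>

lemma thicken_right: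
  assumes I: "I = {0<..} \<or> I = (UNIV::real set)" and K: "compact K" "K \<subseteq> I"
  obtains K' where "compact K'" "K' \<subseteq> I" "K \<subseteq> K'" "\<And>x y. x - 1 \<le> y \<Longrightarrow> y \<le> x \<Longrightarrow> y \<in> K \<Longrightarrow> x \<in> K'"
proof
  let ?K = "{y + t |y t. y \<in> K \<and> t \<in> {0..1::real}}"
  show "compact ?K" by (rule compact_sums[OF K(1) compact_Icc])
  show "?K \<subseteq> I" using I K(2) by force
  show "K \<subseteq> ?K" by force
  show "x \<in> ?K" if "x - 1 \<le> y" "y \<le> x" "y \<in> K" for x y
    using that by (intro CollectI exI[of _ y] exI[of _ "x - y"]) auto
qed


subsection \<open>The weighted line\<close>

locale weighted_line =
  fixes I :: "real set" and b :: "real \<Rightarrow> real"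
  assumes I: "I = {0<..} \<or> I = UNIV" and b_continuous: "continuous_on UNIV b"
begin

definition w :: "real \<Rightarrow> real" where "w x = exp (2 * drift_primitive b x)"

abbreviation M :: "real measure" where "M \<equiv> weighted_measure I b"

lemma w_pos: "0 < w x" by (simp add: w_def)

lemma w_nonzero: "w x \<noteq> 0" using w_pos[of x] by simp

lemma w_has_derivative: "(w has_real_derivative 2 * b x * w x) (at x)"
  unfolding w_def
  by (auto intro!: derivative_eq_intros drift_primitive_has_derivative b_continuous)

lemma w_continuous: "continuous_on S w"
  by (rule DERIV_continuous_on) (rule has_field_derivative_at_within[OF w_has_derivative])

lemma w_measurable [measurable]: "w \<in> borel_measurable borel"
  using w_continuous[of UNIV] by (rule borel_measurable_continuous_onI)

lemma I_borel [measurable]: "I \<in> sets borel"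
  using I by auto

lemma M_eq: "M = density (restrict_space lborel I) (\<lambda>x. ennreal (w x))"
  by (simp add: weighted_measure_def w_def)

lemma borel_measurable_M: "f \<in> borel_measurable borel \<Longrightarrow> f \<in> borel_measurable M"
  unfolding M_eq by (simp add: measurable_restrict_space1)

text \<open>Transfers integrals to Lebesgue measure on the whole line, where the fundamental theorem
  and the support arguments apply without reference to \<open>I\<close>.\<close>

lemma
  assumes f: "f \<in> borel_measurable borel" and out: "\<And>x. x \<notin> I \<Longrightarrow> f x = 0"
  shows integrable_M: "integrable M f \<longleftrightarrow> integrable lborel (\<lambda>x. w x * f x)"
    and integral_M: "integral\<^sup>L M f = (LBINT x. w x * f x)"
proof -
  have meas: "f \<in> borel_measurable (restrict_space lborel I)" "w \<in> borel_measurable (restrict_space lborel I)"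
    using f w_measurable by (auto intro: measurable_restrict_space1)
  have eq: "(\<lambda>x. indicator I x *\<^sub>R (w x *\<^sub>R f x)) = (\<lambda>x. w x * f x)"
    using out by (auto simp: fun_eq_iff indicator_def)
  show "integrable M f \<longleftrightarrow> integrable lborel (\<lambda>x. w x * f x)"
    unfolding M_eq using meas w_pos
    by (subst integrable_density) (auto simp: integrable_restrict_space less_imp_le eq[simplified])
  show "integral\<^sup>L M f = (LBINT x. w x * f x)"
    unfolding M_eq using meas w_pos
    by (subst integral_density) (auto simp: integral_restrict_space less_imp_le eq[simplified])
qed

lemma compactly_supported_M:
  assumes "compactly_supported I f"
  shows "f \<in> borel_measurable borel" "integrable M f" "integral\<^sup>L M f = (LBINT x. w x * f x)" "f \<in> L2 M"
proof -
  obtain K where K: "continuous_on UNIV f" "compact K" "K \<subseteq> I" "\<And>x. x \<notin> K \<Longrightarrow> f x = 0"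
    using compactly_supportedE[OF assms] by blast
  have f: "f \<in> borel_measurable borel" using K(1) by (rule borel_measurable_continuous_onI)
  have out: "f x = 0" if "x \<notin> I" for x using K that by blast
  have sq: "compactly_supported I (\<lambda>x. (f x)\<^sup>2)"
    unfolding power2_eq_square by (rule compactly_supported_mult[OF assms K(1)])
  have 1: "integrable lborel (\<lambda>x. w x * f x)" "integrable lborel (\<lambda>x. w x * (f x)\<^sup>2)"
    by (rule compactly_supported_integrable, rule compactly_supported_mult, fact, rule w_continuous)+
  show "f \<in> borel_measurable borel" by (rule f)
  show "integrable M f" "integral\<^sup>L M f = (LBINT x. w x * f x)"
    using integrable_M[OF f out] integral_M[OF f out] 1 by auto
  have "integrable M (\<lambda>x. (f x)\<^sup>2)"
    using f out 1 by (subst integrable_M) auto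
  then show "f \<in> L2 M" using borel_measurable_M[OF f] by (simp add: L2_def)
qed

lemma compactly_supported_inner:
  assumes "compactly_supported I f" "continuous_on UNIV g"
  shows "L2_inner M f g = (LBINT x. w x * (f x * g x))"
  unfolding L2_inner_def by (rule compactly_supported_M(3)[OF compactly_supported_mult(1)[OF assms]])

lemma C1_compact_continuous:
  assumes "u \<in> C1_compact I"
  shows "continuous_on UNIV u" "continuous_on UNIV (deriv u)"
  using C1_compact_D(2,3)[OF assms] by (auto simp: compactly_supported_def)

lemma Q_D_eq: "Q_D I b u v = 1/2 * L2_inner M (deriv u) (deriv v)"
  by (simp add: Q_D_def L2_inner_def)

lemma C1_compact_add:
  assumes u: "u \<in> C1_compact I" and v: "v \<in> C1_compact I"
  shows "(\<lambda>x. u x + v x) \<in> C1_compact I" "deriv (\<lambda>x. u x + v x) = (\<lambda>x. deriv u x + deriv v x)"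
proof -
  obtain K where K: "compact K" "K \<subseteq> I" "\<And>x. x \<notin> K \<Longrightarrow> u x + v x = 0"
    using compactly_supported_add[OF C1_compact_D(2)[OF u] C1_compact_D(2)[OF v]]
    by (auto simp: compactly_supported_def)
  have d: "((\<lambda>x. u x + v x) has_real_derivative deriv u x + deriv v x) (at x)" for x
    by (intro DERIV_add C1_compact_D[OF u] C1_compact_D[OF v])
  have c: "continuous_on UNIV (\<lambda>x. deriv u x + deriv v x)"
    by (intro continuous_intros C1_compact_continuous u v)
  show "(\<lambda>x. u x + v x) \<in> C1_compact I" "deriv (\<lambda>x. u x + v x) = (\<lambda>x. deriv u x + deriv v x)"
    using C1_compact_I[OF d c K(1,2)] K(3) by blast+
qed

lemma C1_compact_scale:
  assumes u: "u \<in> C1_compact I"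
  shows "(\<lambda>x. c * u x) \<in> C1_compact I" "deriv (\<lambda>x. c * u x) = (\<lambda>x. c * deriv u x)"
proof -
  obtain K where K: "compact K" "K \<subseteq> I" "\<And>x. x \<notin> K \<Longrightarrow> c * u x = 0"
    using C1_compact_D(2)[OF u] by (auto simp: compactly_supported_def)
  have d: "((\<lambda>x. c * u x) has_real_derivative c * deriv u x) (at x)" for x
    by (intro DERIV_cmult C1_compact_D[OF u])
  have c: "continuous_on UNIV (\<lambda>x. c * deriv u x)"
    by (intro continuous_intros C1_compact_continuous u)
  show "(\<lambda>x. c * u x) \<in> C1_compact I" "deriv (\<lambda>x. c * u x) = (\<lambda>x. c * deriv u x)"
    using C1_compact_I[OF d c K(1,2)] K(3) by blast+
qed

text \<open>One compact subset of \<open>I\<close> for all \<open>n\<close>, as needed for dominated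
  convergence.\<close>

lemma backward_average_support:
  assumes f: "continuous_on UNIV f" and K: "compact K" "K \<subseteq> I" "\<And>x. x \<notin> K \<Longrightarrow> f x = 0"
  obtains K' where "compact K'" "K' \<subseteq> I" "\<And>x. x \<notin> K' \<Longrightarrow> f x = 0"
    "\<And>n x. x \<notin> K' \<Longrightarrow> backward_average f n x = 0"
    "\<And>n x. x \<notin> K' \<Longrightarrow> backward_quotient f n x = 0"
proof -
  obtain K' where K': "compact K'" "K' \<subseteq> I" "K \<subseteq> K'"
    "\<And>x y. x - 1 \<le> y \<Longrightarrow> y \<le> x \<Longrightarrow> y \<in> K \<Longrightarrow> x \<in> K'"
    using thicken_right[OF I K(1,2)] by blast
  have 0: "f y = 0" if "x \<notin> K'" "x - 1 \<le> y" "y \<le> x" for x y using K' K(3) that by blast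
  show thesis
  proof (rule that[OF K'(1,2)])
    show "backward_average f n x = 0" if "x \<notin> K'" for n x
      using 0[OF that] by (rule backward_average_eq_0[OF f])
    show "backward_quotient f n x = 0" if "x \<notin> K'" for n x
      unfolding backward_quotient_def using 0[OF that, of x] 0[OF that, of "x - 1 / (real n + 1)"] by simp
  qed (use 0 in auto)
qed

lemma backward_quotient_continuous:
  assumes "continuous_on UNIV f"
  shows "continuous_on UNIV (backward_quotient f n)"
proof -
  have "continuous_on UNIV (\<lambda>x. f (x - 1 / (real n + 1)))"
    by (rule continuous_on_compose2[OF assms]) (auto intro!: continuous_intros)
  then show ?thesis
    unfolding backward_quotient_def by (intro continuous_intros assms)
qed

lemma backward_average_continuous:
  "continuous_on UNIV f \<Longrightarrow> continuous_on UNIV (backward_average f n)"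
  by (rule DERIV_continuous_on) (rule has_field_derivative_at_within[OF backward_average_has_derivative])

lemma compact_dominated_convergence:
  fixes f :: "nat \<Rightarrow> real \<Rightarrow> real" and p g :: "real \<Rightarrow> real"
  assumes K: "compact K" "K \<subseteq> I" and p: "continuous_on UNIV p"
    and fm: "\<And>n. f n \<in> borel_measurable borel" and gm: "g \<in> borel_measurable borel"
    and lim: "AE x in lborel. (\<lambda>n. f n x) \<longlonglongrightarrow> g x"
    and B: "\<And>n x. \<bar>f n x\<bar> \<le> B" and out: "\<And>n x. x \<notin> K \<Longrightarrow> f n x = 0"
  shows "(\<lambda>n. LBINT x. p x * f n x) \<longlonglongrightarrow> (LBINT x. p x * g x)"
proof (rule integral_dominated_convergence)
  have pm [measurable]: "p \<in> borel_measurable borel" using p by (rule borel_measurable_continuous_onI)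
  show "(\<lambda>x. p x * g x) \<in> borel_measurable lborel" "\<And>n. (\<lambda>x. p x * f n x) \<in> borel_measurable lborel"
    using gm fm pm by auto
  show "AE x in lborel. (\<lambda>n. p x * f n x) \<longlonglongrightarrow> p x * g x"
    using lim by eventually_elim (intro tendsto_intros)
  show "integrable lborel (\<lambda>x. indicator K x *\<^sub>R (\<bar>p x\<bar> * B))"
    by (rule borel_integrable_compact[OF K(1)]) (intro continuous_intros continuous_on_subset[OF p], simp)
  show "AE x in lborel. norm (p x * f n x) \<le> indicator K x *\<^sub>R (\<bar>p x\<bar> * B)" for n
    using B[of n] out[of _ n] by (intro AE_I2) (auto simp: indicator_def abs_mult intro: mult_left_mono)
qed

text \<open>
  Replacing \<open>w v'\<close> by its backward averages \<open>m\<close>, which are \<open>C\<^sup>1\<close>, allows an integration by parts;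
  the error is controlled by the form.
\<close>

lemma Q_D_bound:
  assumes v: "v \<in> C1_compact I" and \<epsilon>: "0 < \<epsilon>"
  shows "\<exists>K. \<forall>u\<in>C1_compact I. \<bar>Q_D I b u v\<bar> \<le> K * L2_norm M u + \<epsilon> * sqrt (Q_D I b u u)"
proof -
  define f where "f x = w x * deriv v x" for x
  have fs: "compactly_supported I f"
    unfolding f_def by (rule compactly_supported_mult(2)[OF C1_compact_D(3)[OF v] w_continuous])
  obtain K where K: "continuous_on UNIV f" "compact K" "K \<subseteq> I" "\<And>x. x \<notin> K \<Longrightarrow> f x = 0"
    using compactly_supportedE[OF fs] by blast
  obtain K' where K': "compact K'" "K' \<subseteq> I" "\<And>x. x \<notin> K' \<Longrightarrow> f x = 0"
    "\<And>n x. x \<notin> K' \<Longrightarrow> backward_average f n x = 0"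
    "\<And>n x. x \<notin> K' \<Longrightarrow> backward_quotient f n x = 0"
    using backward_average_support[OF K] by blast
  obtain B where B: "\<And>x. \<bar>f x\<bar> \<le> B" using compactly_supported_bounded[OF fs] by blast
  \<comment> \<open>Division by \<open>w\<close> turns the Lebesgue integral of
    \<open>deriv u\<close> against the averaging error into an inner product in \<open>L2 M\<close>,
    so that Cauchy-Schwarz bounds it by the form norm of \<open>u\<close>.\<close>
  define r where "r n x = (f x - backward_average f n x) / w x" for n x
  have wi: "continuous_on UNIV (\<lambda>x. 1 / w x)" by (intro continuous_intros w_continuous) (simp add: w_nonzero)
  have ac: "continuous_on UNIV (backward_average f n)" for n by (rule backward_average_continuous[OF K(1)])
  have as: "compactly_supported I (backward_average f n)" for n
    by (rule compactly_supportedI[OF ac K'(1,2,4)])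
  have qs: "compactly_supported I (backward_quotient f n)" for n
    by (rule compactly_supportedI[OF backward_quotient_continuous[OF K(1)] K'(1,2,5)])
  have rs: "compactly_supported I (r n)" for n
    unfolding r_def
    using compactly_supported_mult(1)[OF compactly_supported_diff[OF fs as] wi, of n] by simp
  have rc: "continuous_on UNIV (r n)" for n using rs by (auto simp: compactly_supported_def)
  have "(\<lambda>n. LBINT x. (1 / w x) * (f x - backward_average f n x)\<^sup>2) \<longlonglongrightarrow> (LBINT x. (1 / w x) * 0)"
  proof (rule compact_dominated_convergence[OF K'(1,2) wi])
    show "(\<lambda>x. (f x - backward_average f n x)\<^sup>2) \<in> borel_measurable borel" for n
      by (intro borel_measurable_continuous_onI continuous_intros K(1) ac)
    have "(\<lambda>n. (f x - backward_average f n x)\<^sup>2) \<longlonglongrightarrow> (f x - f x)\<^sup>2" for x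
      by (intro tendsto_intros backward_average_tendsto K(1))
    then show "AE x in lborel. (\<lambda>n. (f x - backward_average f n x)\<^sup>2) \<longlonglongrightarrow> 0" by simp
    show "\<bar>(f x - backward_average f n x)\<^sup>2\<bar> \<le> (2 * B)\<^sup>2" for n x
    proof -
      have "\<bar>f x - backward_average f n x\<bar> \<le> 2 * B"
        using B[of x] backward_average_bound[OF K(1) B, of n x] by linarith
      then have "\<bar>f x - backward_average f n x\<bar>\<^sup>2 \<le> (2 * B)\<^sup>2" by (rule power_mono) simp
      then show ?thesis by simp
    qed
    show "(f x - backward_average f n x)\<^sup>2 = 0" if "x \<notin> K'" for n x using K'(3,4)[OF that] by simp
  qed simp
  moreover have "L2_inner M (r n) (r n) = (LBINT x. (1 / w x) * (f x - backward_average f n x)\<^sup>2)" for n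
    unfolding compactly_supported_inner[OF rs rc] r_def
    by (simp add: power2_eq_square w_nonzero)
  ultimately have "(\<lambda>n. L2_inner M (r n) (r n)) \<longlonglongrightarrow> 0" by simp
  then have "\<forall>\<^sub>F n in sequentially. L2_inner M (r n) (r n) < \<epsilon>\<^sup>2" by (rule order_tendstoD) (use \<epsilon> in simp)
  then obtain n where n: "L2_inner M (r n) (r n) < \<epsilon>\<^sup>2" by (auto simp: eventually_sequentially)
  have rn: "L2_norm M (r n) \<le> \<epsilon>" unfolding L2_norm_def using n \<epsilon> by (intro real_le_lsqrt) auto
  \<comment> \<open>Once the derivative has been moved onto the average, what remains is the inner
    product of \<open>u\<close> with this fixed function; its norm is the required
    \<open>K\<close>.\<close>
  define m' where "m' x = backward_quotient f n x / w x" for x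
  have ms: "compactly_supported I m'"
    unfolding m'_def using compactly_supported_mult(1)[OF qs wi, of n] by simp
  have mc: "continuous_on UNIV m'" using ms by (auto simp: compactly_supported_def)
  have "\<bar>Q_D I b u v\<bar> \<le> L2_norm M m' * L2_norm M u + \<epsilon> * sqrt (Q_D I b u u)" if u: "u \<in> C1_compact I" for u
  proof -
    note us = C1_compact_D[OF u] and uc = C1_compact_continuous[OF u] and vc = C1_compact_continuous[OF v]
    have parts: "(LBINT x. deriv u x * backward_average f n x + u x * backward_quotient f n x) = 0"
    proof (rule compactly_supported_integral_deriv)
      show "compactly_supported I (\<lambda>x. u x * backward_average f n x)"
        by (rule compactly_supported_mult(1)[OF us(2) ac])
      show "((\<lambda>x. u x * backward_average f n x) has_real_derivative
          deriv u x * backward_average f n x + u x * backward_quotient f n x) (at x)" for x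
        by (rule derivative_eq_intros us(1) backward_average_has_derivative[OF K(1)])+ simp
      show "compactly_supported I (\<lambda>x. deriv u x * backward_average f n x + u x * backward_quotient f n x)"
        by (intro compactly_supported_add compactly_supported_mult us ac backward_quotient_continuous K(1))
    qed
    have i1: "L2_inner M (deriv u) (r n) = (LBINT x. deriv u x * f x) - (LBINT x. deriv u x * backward_average f n x)"
    proof -
      have "w x * (deriv u x * r n x) = deriv u x * f x - deriv u x * backward_average f n x" for x
        using w_nonzero[of x] by (simp add: r_def field_simps)
      then show ?thesis unfolding compactly_supported_inner[OF us(3) rc]
        by (simp add: Bochner_Integration.integral_diff compactly_supported_integrable[of I]
            compactly_supported_mult us K(1) ac)
    qed
    have i2: "L2_inner M u m' = (LBINT x. u x * backward_quotient f n x)"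
      unfolding compactly_supported_inner[OF us(2) mc] m'_def by (simp add: w_nonzero)
    have i3: "L2_inner M (deriv u) (deriv v) = (LBINT x. deriv u x * f x)"
      unfolding compactly_supported_inner[OF us(3) vc(2)] f_def by (simp add: mult.left_commute)
    have i4: "(LBINT x. deriv u x * backward_average f n x) + (LBINT x. u x * backward_quotient f n x) = 0"
      unfolding parts[symmetric]
      by (rule Bochner_Integration.integral_add[symmetric])
        (rule compactly_supported_integrable, rule compactly_supported_mult(1), rule us,
          rule ac backward_quotient_continuous[OF K(1)])+
    have "2 * Q_D I b u v = L2_inner M (deriv u) (r n) - L2_inner M u m'"
      unfolding Q_D_eq i3 i1 i2 using i4 by simp
    moreover have "\<bar>L2_inner M (deriv u) (r n)\<bar> \<le> L2_norm M (deriv u) * L2_norm M (r n)"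
      by (intro L2_Cauchy_Schwarz compactly_supported_M(4) us rs)
    moreover have "L2_norm M (deriv u) * L2_norm M (r n) \<le> L2_norm M (deriv u) * \<epsilon>"
      by (intro mult_left_mono rn L2_norm_nonneg)
    moreover have "\<bar>L2_inner M u m'\<bar> \<le> L2_norm M u * L2_norm M m'"
      by (intro L2_Cauchy_Schwarz compactly_supported_M(4) us ms)
    moreover have "L2_norm M (deriv u) * \<epsilon> \<le> 2 * (\<epsilon> * sqrt (Q_D I b u u))"
    proof -
      have "L2_norm M (deriv u) = sqrt 2 * sqrt (Q_D I b u u)"
        unfolding Q_D_eq L2_norm_def by (simp flip: real_sqrt_mult)
      also have "\<dots> \<le> 2 * sqrt (Q_D I b u u)"
        \<comment> \<open>Replacing \<open>sqrt 2\<close> by 2 is harmless, since the factor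
          \<open>1/2\<close> in \<open>Q_D\<close> leaves a 2 to spare on the left.\<close>
        by (intro mult_right_mono) (auto simp: Q_D_eq L2_inner_nonneg real_le_lsqrt)
      finally show ?thesis using \<epsilon> by simp
    qed
    moreover have "0 \<le> L2_norm M u * L2_norm M m'" "0 \<le> \<epsilon> * sqrt (Q_D I b u u)"
      using \<epsilon> by (auto simp: L2_norm_nonneg Q_D_eq L2_inner_nonneg)
    ultimately show ?thesis by (simp add: mult.commute)
  qed
  then show ?thesis by blast
qed

lemma closable_Q_D: "closable_L2_form M (C1_compact I) (Q_D I b)"
proof
  show "(\<lambda>x. 0) \<in> C1_compact I" by (rule C1_compact_I(1)[of _ "\<lambda>x. 0" "{}"]) auto
  show "(\<lambda>x. c * u x) \<in> C1_compact I" if "u \<in> C1_compact I" for u c by (rule C1_compact_scale(1)[OF that])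
  show "(\<lambda>x. u x + v x) \<in> C1_compact I" if "u \<in> C1_compact I" "v \<in> C1_compact I" for u v
    by (rule C1_compact_add(1)[OF that])
  show "Q_D I b u v = Q_D I b v u" for u v by (simp add: Q_D_eq L2_inner_commute)
  show "Q_D I b (\<lambda>x. u x + v x) z = Q_D I b u z + Q_D I b v z"
    if "u \<in> C1_compact I" "v \<in> C1_compact I" "z \<in> C1_compact I" for u v z
    using that by (simp add: Q_D_eq C1_compact_add(2) L2_inner_add compactly_supported_M(4) C1_compact_D(3) distrib_left)
  show "Q_D I b (\<lambda>x. c * u x) v = c * Q_D I b u v" if "u \<in> C1_compact I" for u v c
    using that by (simp add: Q_D_eq C1_compact_scale(2) L2_inner_scale)
  show "0 \<le> Q_D I b u u" for u by (simp add: Q_D_eq L2_inner_nonneg)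
  show "u \<in> L2 M" if "u \<in> C1_compact I" for u by (rule compactly_supported_M(4)[OF C1_compact_D(2)[OF that]])
qed (rule Q_D_bound)

lemma inf_spectrum_ge:
  assumes "\<And>u. u \<in> C1_compact I \<Longrightarrow> \<Lambda> * L2_inner M u u \<le> Q_D I b u u"
  shows "ereal \<Lambda> \<le> inf_spectrum_H_D I b"
  unfolding inf_spectrum_H_D_def H_D_def
  by (rule closable_L2_form.inf_op_spectrum_ge[OF closable_Q_D assms])

lemma inf_spectrum_le:
  assumes "u \<in> C1_compact I" "0 < L2_inner M u u" "Q_D I b u u \<le> \<Lambda> * L2_inner M u u"
  shows "inf_spectrum_H_D I b \<le> ereal \<Lambda>"
  unfolding inf_spectrum_H_D_def H_D_def
  by (rule closable_L2_form.inf_op_spectrum_le[OF closable_Q_D assms])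

lemma inf_spectrum_nonneg: "0 \<le> inf_spectrum_H_D I b"
  using inf_spectrum_ge[of 0] by (simp add: Q_D_eq L2_inner_nonneg zero_ereal_def)

end

lemma compact_subset_Icc:
  assumes I: "I = {0<..} \<or> I = (UNIV::real set)" and K: "compact K" "K \<subseteq> I"
  obtains \<alpha> \<beta> where "\<alpha> < \<beta>" "{\<alpha>..\<beta>} \<subseteq> I" "K \<subseteq> {\<alpha><..<\<beta>}"
proof (cases "K = {}")
  case True
  show ?thesis by (rule that[of 1 2]) (use True I in auto)
next
  case False
  obtain m where m: "m \<in> K" "\<And>x. x \<in> K \<Longrightarrow> m \<le> x" using compact_attains_inf[OF K(1) False] by blast
  obtain s where s: "s \<in> K" "\<And>x. x \<in> K \<Longrightarrow> x \<le> s" using compact_attains_sup[OF K(1) False] by blast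
  \<comment> \<open>On the half line the left end must stay positive, so the minimum is halved
    instead of lowered by 1.\<close>
  define \<alpha> where "\<alpha> = (if I = UNIV then m - 1 else m / 2)"
  have \<alpha>: "\<alpha> < m" "{\<alpha>..} \<subseteq> I" using I K m(1) by (auto simp: \<alpha>_def)
  show ?thesis
    by (rule that[of \<alpha> "s + 1"]) (use \<alpha> m s in fastforce)+
qed

context weighted_line
begin

text \<open>
  The Riccati inequality says that \<open>exp (\<integral> \<eta> / w)\<close> is a positive supersolution; the bound is the
  integrated form of \<open>0 \<le> w (u' - u \<eta> / w)\<^sup>2\<close>.
\<close>

lemma riccati_lower_bound:
  assumes \<eta>: "\<And>x. x \<in> I \<Longrightarrow> (\<eta> has_real_derivative \<eta>' x) (at x)"
    and riccati: "\<And>x. x \<in> I \<Longrightarrow> \<eta>' x + (\<eta> x)\<^sup>2 / w x \<le> - \<kappa> * w x"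
  shows "ereal (\<kappa> / 2) \<le> inf_spectrum_H_D I b"
proof (rule inf_spectrum_ge)
  fix u assume u: "u \<in> C1_compact I"
  note us = C1_compact_D[OF u] and uc = C1_compact_continuous[OF u]
  obtain K where K: "compact K" "K \<subseteq> I" "\<And>x. x \<notin> K \<Longrightarrow> u x = 0"
    using us(2) by (auto simp: compactly_supported_def)
  obtain K' where K': "compact K'" "K' \<subseteq> I" "\<And>x. x \<notin> K' \<Longrightarrow> deriv u x = 0"
    using us(3) by (auto simp: compactly_supported_def)
  obtain \<alpha> \<beta> where ab: "\<alpha> < \<beta>" "{\<alpha>..\<beta>} \<subseteq> I" "K \<union> K' \<subseteq> {\<alpha><..<\<beta>}"
    using compact_subset_Icc[OF I, of "K \<union> K'"] K K' by (metis compact_Un Un_least)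
  define h where "h x = w x * (deriv u x * deriv u x) - \<kappa> * (w x * (u x * u x))" for x
  have hs: "compactly_supported I h" unfolding h_def
    by (intro compactly_supported_diff compactly_supported_mult(2) us w_continuous continuous_intros uc)
  have "\<alpha> \<notin> K" "\<beta> \<notin> K" using ab(3) by auto
  then have 0: "u \<alpha> = 0" "u \<beta> = 0" using K(3) by blast+
  have deriv: "((\<lambda>x. (u x)\<^sup>2 * \<eta> x) has_real_derivative 2 * u x * deriv u x * \<eta> x + (u x)\<^sup>2 * \<eta>' x) (at x)"
    if "x \<in> I" for x
    by (rule derivative_eq_intros us(1) \<eta>[OF that] refl)+ simp
  \<comment> \<open>The gauge integral integrates every derivative, so no regularity of \<eta>'
    enters. The boundary terms vanish because \<open>u\<close> does at both ends.\<close>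
  have "((\<lambda>x. 2 * u x * deriv u x * \<eta> x + (u x)\<^sup>2 * \<eta>' x) has_integral (u \<beta>)\<^sup>2 * \<eta> \<beta> - (u \<alpha>)\<^sup>2 * \<eta> \<alpha>) {\<alpha>..\<beta>}"
  proof (rule fundamental_theorem_of_calculus)
    show "((\<lambda>x. (u x)\<^sup>2 * \<eta> x) has_vector_derivative 2 * u x * deriv u x * \<eta> x + (u x)\<^sup>2 * \<eta>' x) (at x within {\<alpha>..\<beta>})"
      if "x \<in> {\<alpha>..\<beta>}" for x
    proof -
      have "x \<in> I" using that ab(2) by auto
      from deriv[OF this] show ?thesis
        unfolding has_real_derivative_iff_has_vector_derivative by (rule has_vector_derivative_at_within)
    qed
  qed (use ab in simp)
  then have i0: "((\<lambda>x. 2 * u x * deriv u x * \<eta> x + (u x)\<^sup>2 * \<eta>' x) has_integral 0) {\<alpha>..\<beta>}" by (simp add: 0)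
  have "continuous_on UNIV h" using hs by (simp add: compactly_supported_def)
  then have "set_integrable lborel {\<alpha>..\<beta>} h"
    by (intro borel_integrable_atLeastAtMost') (rule continuous_on_subset[OF _ subset_UNIV])
  from set_borel_integral_eq_integral[OF this]
  have "h integrable_on {\<alpha>..\<beta>}" "(LBINT x:{\<alpha>..\<beta>}. h x) = integral {\<alpha>..\<beta>} h" .
  moreover have "(LBINT x:{\<alpha>..\<beta>}. h x) = (LBINT x. h x)"
  proof -
    have "indicator {\<alpha>..\<beta>} x *\<^sub>R h x = h x" for x
    proof (cases "x \<in> {\<alpha>..\<beta>}")
      case False
      then have "x \<notin> K" "x \<notin> K'" using ab(3) by auto
      then have "u x = 0" "deriv u x = 0" using K(3) K'(3) by blast+
      then show ?thesis by (simp add: h_def)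
    qed simp
    then show ?thesis unfolding set_lebesgue_integral_def by (rule Bochner_Integration.integral_cong[OF refl])
  qed
  ultimately have i1: "(h has_integral (LBINT x. h x)) {\<alpha>..\<beta>}" by auto
  have "0 \<le> (LBINT x. h x)"
  proof (rule has_integral_le[OF i0 i1])
    fix x assume x: "x \<in> {\<alpha>..\<beta>}"
    have "0 \<le> w x * (deriv u x - u x * \<eta> x / w x)\<^sup>2" using w_pos[of x] by simp
    also have "\<dots> = w x * (deriv u x * deriv u x) - 2 * u x * deriv u x * \<eta> x + (u x)\<^sup>2 * ((\<eta> x)\<^sup>2 / w x)"
      using w_pos[of x] by (simp add: power2_eq_square field_simps)
    also have "\<dots> \<le> w x * (deriv u x * deriv u x) - 2 * u x * deriv u x * \<eta> x + (u x)\<^sup>2 * (- \<kappa> * w x - \<eta>' x)"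
      using riccati[of x] x ab(2) by (intro add_left_mono mult_left_mono) auto
    also have "\<dots> = h x - (2 * u x * deriv u x * \<eta> x + (u x)\<^sup>2 * \<eta>' x)"
      by (simp add: h_def power2_eq_square algebra_simps)
    finally show "2 * u x * deriv u x * \<eta> x + (u x)\<^sup>2 * \<eta>' x \<le> h x" by simp
  qed
  also have "(LBINT x. h x) = (LBINT x. w x * (deriv u x * deriv u x)) - \<kappa> * (LBINT x. w x * (u x * u x))"
    unfolding h_def
    by (subst Bochner_Integration.integral_diff)
      (auto intro!: compactly_supported_integrable[of I] compactly_supported_mult(2) us w_continuous continuous_intros uc)
  finally show "\<kappa> / 2 * L2_inner M u u \<le> Q_D I b u u"
    unfolding Q_D_eq compactly_supported_inner[OF us(2) uc(1)] compactly_supported_inner[OF us(3) uc(2)]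
    by simp
qed

text \<open>Backward averages of \<open>f\<close> lie in the core. Their derivatives are difference
  quotients of \<open>f\<close>, which are bounded by the Lipschitz constant and converge to
  \<open>g\<close> off a finite set, so both integrals converge. The strict inequalities
  \<open>pos\<close> and \<open>less\<close> therefore survive for large \<open>n\<close>.\<close>

lemma lipschitz_test_function:
  assumes lip: "\<And>x y. \<bar>f x - f y\<bar> \<le> L * \<bar>x - y\<bar>"
    and K: "compact K" "K \<subseteq> I" "\<And>x. x \<notin> K \<Longrightarrow> f x = 0"
    and S: "finite S" and der: "\<And>x. x \<notin> S \<Longrightarrow> (f has_real_derivative g x) (at x)"
    and g: "g \<in> borel_measurable borel"
    and pos: "0 < (LBINT x. w x * (f x)\<^sup>2)"
    and less: "1/2 * (LBINT x. w x * (g x)\<^sup>2) < \<Lambda> * (LBINT x. w x * (f x)\<^sup>2)"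
  shows "inf_spectrum_H_D I b \<le> ereal \<Lambda>"
proof -
  have L: "L \<ge> 0" using lip[of 0 1] by simp
  have f: "continuous_on UNIV f"
    by (rule lipschitz_on_continuous_on[of L], rule lipschitz_onI) (use lip L in \<open>auto simp: dist_real_def\<close>)
  have fs: "compactly_supported I f" using f K by (rule compactly_supportedI)
  obtain B where B: "\<And>x. \<bar>f x\<bar> \<le> B" using compactly_supported_bounded[OF fs] by blast
  obtain K' where K': "compact K'" "K' \<subseteq> I" "\<And>x. x \<notin> K' \<Longrightarrow> f x = 0"
    "\<And>n x. x \<notin> K' \<Longrightarrow> backward_average f n x = 0"
    "\<And>n x. x \<notin> K' \<Longrightarrow> backward_quotient f n x = 0"
    using backward_average_support[OF f K] by blast
  let ?u = "backward_average f"
  have ac: "continuous_on UNIV (?u n)" and qc: "continuous_on UNIV (backward_quotient f n)" for n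
    by (rule backward_average_continuous[OF f] backward_quotient_continuous[OF f])+
  have u: "?u n \<in> C1_compact I" and du: "deriv (?u n) = backward_quotient f n" for n
    using C1_compact_I[OF backward_average_has_derivative[OF f] qc K'(1,2)] K'(4) by blast+
  have l1: "(\<lambda>n. LBINT x. w x * (?u n x)\<^sup>2) \<longlonglongrightarrow> (LBINT x. w x * (f x)\<^sup>2)"
  proof (rule compact_dominated_convergence[OF K'(1,2) w_continuous])
    show "(\<lambda>x. (?u n x)\<^sup>2) \<in> borel_measurable borel" for n
      by (intro borel_measurable_continuous_onI continuous_intros ac)
    show "(\<lambda>x. (f x)\<^sup>2) \<in> borel_measurable borel"
      by (intro borel_measurable_continuous_onI continuous_intros f)
    show "AE x in lborel. (\<lambda>n. (?u n x)\<^sup>2) \<longlonglongrightarrow> (f x)\<^sup>2"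
      by (intro AE_I2 tendsto_intros backward_average_tendsto f)
    show "\<bar>(?u n x)\<^sup>2\<bar> \<le> B\<^sup>2" for n x
      using power_mono[OF backward_average_bound[OF f B, of n x] abs_ge_zero, of 2] by simp
    show "(?u n x)\<^sup>2 = 0" if "x \<notin> K'" for n x using K'(4)[OF that] by simp
  qed
  have l2: "(\<lambda>n. LBINT x. w x * (backward_quotient f n x)\<^sup>2) \<longlonglongrightarrow> (LBINT x. w x * (g x)\<^sup>2)"
  proof (rule compact_dominated_convergence[OF K'(1,2) w_continuous])
    show "(\<lambda>x. (backward_quotient f n x)\<^sup>2) \<in> borel_measurable borel" for n
      by (intro borel_measurable_continuous_onI continuous_intros qc)
    show "(\<lambda>x. (g x)\<^sup>2) \<in> borel_measurable borel" using g by simp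
    have "AE x in lborel. x \<notin> S"
      by (rule AE_not_in[OF finite_imp_null_set_lborel[OF S]])
    then show "AE x in lborel. (\<lambda>n. (backward_quotient f n x)\<^sup>2) \<longlonglongrightarrow> (g x)\<^sup>2"
      by eventually_elim (intro tendsto_intros backward_quotient_tendsto der)
    show "\<bar>(backward_quotient f n x)\<^sup>2\<bar> \<le> L\<^sup>2" for n x
    proof -
      have "\<bar>f x - f (x - 1 / (real n + 1))\<bar> * (real n + 1) \<le> L * \<bar>x - (x - 1 / (real n + 1))\<bar> * (real n + 1)"
        by (intro mult_right_mono lip) simp
      then have "\<bar>backward_quotient f n x\<bar> \<le> L" by (simp add: backward_quotient_def abs_mult)
      from power_mono[OF this abs_ge_zero, of 2] show ?thesis by simp
    qed
    show "(backward_quotient f n x)\<^sup>2 = 0" if "x \<notin> K'" for n x using K'(5)[OF that] by simp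
  qed
  have e1: "L2_inner M (?u n) (?u n) = (LBINT x. w x * (?u n x)\<^sup>2)" for n
    unfolding compactly_supported_inner[OF C1_compact_D(2)[OF u] ac] by (simp add: power2_eq_square)
  have e2: "Q_D I b (?u n) (?u n) = 1/2 * (LBINT x. w x * (backward_quotient f n x)\<^sup>2)" for n
    unfolding Q_D_eq using compactly_supported_inner[OF C1_compact_D(3)[OF u] C1_compact_continuous(2)[OF u], of n n]
    by (simp add: power2_eq_square du)
  have "(\<lambda>n. \<Lambda> * L2_inner M (?u n) (?u n) - Q_D I b (?u n) (?u n)) \<longlonglongrightarrow>
      \<Lambda> * (LBINT x. w x * (f x)\<^sup>2) - 1/2 * (LBINT x. w x * (g x)\<^sup>2)"
    unfolding e1 e2 by (intro tendsto_intros l1 l2)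
  then have "\<forall>\<^sub>F n in sequentially. 0 < \<Lambda> * L2_inner M (?u n) (?u n) - Q_D I b (?u n) (?u n)"
    by (rule order_tendstoD) (use less in simp)
  moreover have "\<forall>\<^sub>F n in sequentially. 0 < L2_inner M (?u n) (?u n)"
    unfolding e1 by (rule order_tendstoD(1)[OF l1 pos])
  ultimately have "\<forall>\<^sub>F n in sequentially. inf_spectrum_H_D I b \<le> ereal \<Lambda>"
    by eventually_elim (intro inf_spectrum_le[OF u], auto)
  then show ?thesis by simp
qed

end


subsection \<open>Upper and lower bounds in terms of scale and speed\<close>

context weighted_line
begin

lemma inverse_w_continuous: "continuous_on S (\<lambda>x. 1 / w x)"
  by (intro continuous_intros w_continuous) (simp add: w_nonzero)

text \<open>
  The test function is \<open>F - F a\<close> on \<open>[a, x0]\<close>, constant on \<open>[x0, R]\<close> and falls linearly to 0 on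
  \<open>[R, R + \<delta>]\<close>.
\<close>

lemma trapezoid_upper_bound:
  assumes F: "\<And>x. (F has_real_derivative 1 / w x) (at x)"
    and G: "\<And>x. (G has_real_derivative - w x) (at x)"
    and a: "a \<in> I" "a < x0" "x0 < R" "0 < \<delta>"
    and less: "1/2 * (1 / (F x0 - F a) + (G R - G (R + \<delta>)) / \<delta>\<^sup>2) < \<Lambda> * (G x0 - G R)"
  shows "inf_spectrum_H_D I b \<le> ereal \<Lambda>"
proof -
  have F_mono: "F x \<le> F y" if "x \<le> y" for x y
    by (rule DERIV_nonneg_imp_nondecreasing[OF that]) (use F w_pos in \<open>auto intro!: exI less_imp_le\<close>)
  define k where "k = F x0 - F a"
  have k: "k > 0" unfolding k_def
    using DERIV_pos_imp_increasing[OF a(2), of F] F w_pos by fastforce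
  have cont: "continuous_on S F" for S
    by (rule DERIV_continuous_on) (rule has_field_derivative_at_within[OF F])
  obtain W where W: "\<And>x. x \<in> {a..x0} \<Longrightarrow> 1 / w x \<le> W"
  proof -
    have "compact ((\<lambda>x. 1 / w x) ` {a..x0})"
      by (intro compact_continuous_image inverse_w_continuous compact_Icc)
    then have "bdd_above ((\<lambda>x. 1 / w x) ` {a..x0})" by (intro bounded_imp_bdd_above compact_imp_bounded)
    then obtain W where "\<forall>y\<in>(\<lambda>x. 1 / w x) ` {a..x0}. y \<le> W" unfolding bdd_above_def by blast
    then show thesis by (intro that[of W]) blast
  qed
  have F_lip: "\<bar>F x - F y\<bar> \<le> W * \<bar>x - y\<bar>" if "x \<in> {a..x0}" "y \<in> {a..x0}" for x y
    using field_differentiable_bound[of "{a..x0}" F "\<lambda>x. 1 / w x" W x y] that W w_pos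
    by (auto simp: real_norm_def less_imp_le intro: has_field_derivative_at_within[OF F])
  have W0: "W \<ge> 0" using W[of a] w_pos[of a] a(2) by (auto intro: order_trans[of _ "1 / w a"] less_imp_le)
  define p where "p x = min (max x a) x0" for x
  define t where "t x = max 0 (min 1 ((R + \<delta> - x) / \<delta>))" for x
  \<comment> \<open>As the minimum of two globally Lipschitz functions, \<open>f\<close> is
    Lipschitz without gluing five pieces. The clamp \<open>p\<close> keeps the argument of
    \<open>F\<close> in \<open>[a, x0]\<close>, where \<open>1 / w\<close> is bounded by
    \<open>W\<close>.\<close>
  define f where "f x = min (F (p x) - F a) (k * t x)" for x
  define g where "g x = indicator {a..x0} x * (1 / w x) - k / \<delta> * indicator {R..R+\<delta>} x" for x
  have f_left: "f x = 0" if "x \<le> a" for x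
    using that a k by (simp add: f_def p_def t_def)
  have f_rise: "f x = F x - F a" if "a \<le> x" "x \<le> x0" for x
  proof -
    have "(R + \<delta> - x) / \<delta> \<ge> 1" using that a by (simp add: field_simps)
    then show ?thesis using that F_mono[of x x0] by (simp add: f_def p_def t_def k_def)
  qed
  have f_flat: "f x = k" if "x0 \<le> x" "x \<le> R" for x
  proof -
    have "(R + \<delta> - x) / \<delta> \<ge> 1" using that a by (simp add: field_simps)
    then show ?thesis using that a by (simp add: f_def p_def t_def k_def)
  qed
  have f_fall: "f x = k * ((R + \<delta> - x) / \<delta>)" if "R \<le> x" "x \<le> R + \<delta>" for x
  proof -
    have t: "0 \<le> (R + \<delta> - x) / \<delta>" "(R + \<delta> - x) / \<delta> \<le> 1" using that a by (simp_all add: field_simps)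
    then have "k * ((R + \<delta> - x) / \<delta>) \<le> k" using mult_left_mono[OF t(2), of k] k by simp
    then show ?thesis using that a t by (simp add: f_def p_def t_def flip: k_def)
  qed
  have f_right: "f x = 0" if "R + \<delta> \<le> x" for x
  proof -
    have "(R + \<delta> - x) / \<delta> \<le> 0" using that a by (simp add: field_simps)
    then show ?thesis using that a k by (simp add: f_def p_def t_def flip: k_def)
  qed
  have f_lip: "\<bar>f x - f y\<bar> \<le> (W + k / \<delta>) * \<bar>x - y\<bar>" for x y
  proof -
    have min_lip: "\<bar>min p1 q1 - min p2 q2\<bar> \<le> \<bar>p1 - p2\<bar> + \<bar>q1 - q2\<bar>" for p1 p2 q1 q2 :: real
      by linarith
    have "\<bar>p x - p y\<bar> \<le> \<bar>x - y\<bar>" unfolding p_def by linarith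
    then have "W * \<bar>p x - p y\<bar> \<le> W * \<bar>x - y\<bar>" using W0 by (rule mult_left_mono)
    moreover have "p x \<in> {a..x0}" "p y \<in> {a..x0}" using a by (auto simp: p_def)
    ultimately have 1: "\<bar>(F (p x) - F a) - (F (p y) - F a)\<bar> \<le> W * \<bar>x - y\<bar>"
      using F_lip[of "p x" "p y"] by simp
    have "\<bar>t x - t y\<bar> \<le> \<bar>(R + \<delta> - x) / \<delta> - (R + \<delta> - y) / \<delta>\<bar>" unfolding t_def by linarith
    also have "\<dots> = \<bar>x - y\<bar> / \<delta>" using a by (simp flip: diff_divide_distrib add: abs_divide abs_minus_commute)
    finally have "k * \<bar>t x - t y\<bar> \<le> k * (\<bar>x - y\<bar> / \<delta>)" using k by (simp only: mult_le_cancel_left_pos)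
    then have 2: "\<bar>k * t x - k * t y\<bar> \<le> k / \<delta> * \<bar>x - y\<bar>"
      using k by (simp flip: right_diff_distrib add: abs_mult)
    show ?thesis unfolding f_def using min_lip[of "F (p x) - F a" "k * t x" "F (p y) - F a" "k * t y"] 1 2
      by (simp add: distrib_right)
  qed
  have f_cont: "continuous_on UNIV f"
    by (rule lipschitz_on_continuous_on[of "W + k / \<delta>"], rule lipschitz_onI)
      (use f_lip W0 k a in \<open>auto simp: dist_real_def\<close>)
  have K: "{a..R+\<delta>} \<subseteq> I" using I a(1) by auto
  have f_out: "f x = 0" if "x \<notin> {a..R+\<delta>}" for x using that f_left[of x] f_right[of x] by force
  have f_supp: "compactly_supported I (\<lambda>x. w x * (f x)\<^sup>2)"
    by (rule compactly_supportedI[where K="{a..R+\<delta>}"])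
      (use f_cont K f_out in \<open>auto intro!: continuous_intros w_continuous\<close>)
  have der: "(f has_real_derivative g x) (at x)" if x: "x \<notin> {a, x0, R, R + \<delta>}" for x
  proof -
    note tr = has_field_derivative_transform_within_open
    consider "x < a" | "a < x" "x < x0" | "x0 < x" "x < R" | "R < x" "x < R + \<delta>" | "R + \<delta> < x"
      using x by fastforce
    then show ?thesis
    proof cases
      case 1
      have "(f has_real_derivative 0) (at x)"
        by (rule tr[of "\<lambda>_. 0" _ _ "{..<a}"]) (use 1 f_left in auto)
      then show ?thesis using 1 a by (simp add: g_def)
    next
      case 2
      have "(f has_real_derivative 1 / w x) (at x)"
        by (rule tr[of "\<lambda>x. F x - F a" _ _ "{a<..<x0}"])
          (use 2 f_rise F in \<open>auto intro!: derivative_eq_intros\<close>)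
      then show ?thesis using 2 a by (simp add: g_def)
    next
      case 3
      have "(f has_real_derivative 0) (at x)"
        by (rule tr[of "\<lambda>_. k" _ _ "{x0<..<R}"]) (use 3 f_flat in auto)
      then show ?thesis using 3 a by (simp add: g_def)
    next
      case 4
      have "(f has_real_derivative - (k / \<delta>)) (at x)"
        by (rule tr[of "\<lambda>x. k * ((R + \<delta> - x) / \<delta>)" _ _ "{R<..<R+\<delta>}"])
          (use 4 f_fall a in \<open>auto intro!: derivative_eq_intros simp: divide_simps\<close>)
      then show ?thesis using 4 a by (simp add: g_def)
    next
      case 5
      have "(f has_real_derivative 0) (at x)"
        by (rule tr[of "\<lambda>_. 0" _ _ "{R+\<delta><..}"]) (use 5 f_right in auto)
      then show ?thesis using 5 a by (simp add: g_def)
    qed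
  qed
  have w1: "has_bochner_integral lborel (\<lambda>x. 1 / w x * indicator {a..x0} x) (F x0 - F a)"
    by (rule has_bochner_integral_FTC_Icc_real)
      (use a F inverse_w_continuous[of UNIV] in \<open>auto simp: continuous_on_eq_continuous_at\<close>)
  have w2: "has_bochner_integral lborel (\<lambda>x. w x * indicator {c..d} x) (G c - G d)" if "c \<le> d" for c d
  proof -
    have "has_bochner_integral lborel (\<lambda>x. w x * indicator {c..d} x) ((- G d) - (- G c))"
    proof (rule has_bochner_integral_FTC_Icc_real[OF that])
      show "((\<lambda>x. - G x) has_real_derivative w x) (at x)" for x using DERIV_minus[OF G[of x]] by simp
      show "isCont w x" for x using w_continuous[of UNIV] by (auto simp: continuous_on_eq_continuous_at)
    qed
    then show ?thesis by simp
  qed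
  have "has_bochner_integral lborel (\<lambda>x. 1 / w x * indicator {a..x0} x + (k / \<delta>)\<^sup>2 * (w x * indicator {R..R+\<delta>} x))
      ((F x0 - F a) + (k / \<delta>)\<^sup>2 * (G R - G (R + \<delta>)))"
    by (intro has_bochner_integral_add w1 has_bochner_integral_mult_right w2) (use a in simp)
  \<comment> \<open>The two indicators have disjoint supports because \<open>x0 < R\<close>, so
    squaring \<open>g\<close> produces no cross term.\<close>
  moreover have "(\<lambda>x. 1 / w x * indicator {a..x0} x + (k / \<delta>)\<^sup>2 * (w x * indicator {R..R+\<delta>} x)) = (\<lambda>x. w x * (g x)\<^sup>2)"
    using a by (auto simp: fun_eq_iff g_def indicator_def power2_eq_square w_nonzero)
  ultimately have Ig: "(LBINT x. w x * (g x)\<^sup>2) = k + (k / \<delta>)\<^sup>2 * (G R - G (R + \<delta>))"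
    by (simp add: has_bochner_integral_iff flip: k_def)
  have "has_bochner_integral lborel (\<lambda>x. k\<^sup>2 * (w x * indicator {x0..R} x)) (k\<^sup>2 * (G x0 - G R))"
    by (intro has_bochner_integral_mult_right w2) (use a in simp)
  \<comment> \<open>Only the plateau, where \<open>f = k\<close>, is kept in the denominator of the
    Rayleigh quotient.\<close>
  moreover have "(LBINT x. k\<^sup>2 * (w x * indicator {x0..R} x)) \<le> (LBINT x. w x * (f x)\<^sup>2)"
  proof (rule integral_mono)
    show "integrable lborel (\<lambda>x. k\<^sup>2 * (w x * indicator {x0..R} x))"
      using calculation by (simp only: has_bochner_integral_iff)
    show "integrable lborel (\<lambda>x. w x * (f x)\<^sup>2)" by (rule compactly_supported_integrable[OF f_supp])
    show "k\<^sup>2 * (w x * indicator {x0..R} x) \<le> w x * (f x)\<^sup>2" for x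
      using f_flat[of x] w_pos[of x] by (auto simp: indicator_def)
  qed
  ultimately have If: "k\<^sup>2 * (G x0 - G R) \<le> (LBINT x. w x * (f x)\<^sup>2)"
    using has_bochner_integral_integral_eq by metis
  have G_less: "G y < G x" if "x < y" for x y
    using DERIV_neg_imp_decreasing[OF that, of G] G w_pos by fastforce
  have G_pos: "G x0 - G R > 0" "G R - G (R + \<delta>) > 0" using G_less[of x0 R] G_less[of R "R + \<delta>"] a by auto
  have "0 < 1/2 * (1 / k + (G R - G (R + \<delta>)) / \<delta>\<^sup>2)" using k G_pos a by (intro mult_pos_pos add_pos_pos) auto
  then have "0 < \<Lambda> * (G x0 - G R)" using less unfolding k_def by linarith
  then have \<Lambda>: "\<Lambda> > 0" using G_pos by (simp add: zero_less_mult_iff)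
  have fin: "finite {a, x0, R, R + \<delta>}" by simp
  show ?thesis
  proof (rule lipschitz_test_function[OF f_lip compact_Icc K f_out fin der])
    show "g \<in> borel_measurable borel" unfolding g_def by measurable
    show "0 < (LBINT x. w x * (f x)\<^sup>2)" using If mult_pos_pos[OF zero_less_power[OF k, of 2] G_pos(1)] by linarith
    \<comment> \<open>The factor \<open>k^2\<close> comes out of both sides, which explains the
      normalised form of the assumption \<open>less\<close>.\<close>
    have "1/2 * (LBINT x. w x * (g x)\<^sup>2) = k\<^sup>2 * (1/2 * (1 / k + (G R - G (R + \<delta>)) / \<delta>\<^sup>2))"
      using k a unfolding Ig by (simp add: power2_eq_square field_simps)
    also have "\<dots> < k\<^sup>2 * (\<Lambda> * (G x0 - G R))"
      by (rule mult_strict_left_mono[OF less[folded k_def] zero_less_power[OF k]])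
    also have "\<dots> \<le> \<Lambda> * (LBINT x. w x * (f x)\<^sup>2)" using If \<Lambda> by (simp add: mult.left_commute)
    finally show "1/2 * (LBINT x. w x * (g x)\<^sup>2) < \<Lambda> * (LBINT x. w x * (f x)\<^sup>2)" .
  qed
qed

text \<open>Three consecutive windows of length \<open>L\<close> for rise, plateau and descent. By
  the mean value theorem each integral is \<open>L\<close> times a value of \<open>w\<close> or
  \<open>1 / w\<close>, and monotonicity replaces these values by the extremes \<open>w a\<close>
  and \<open>w (a + 3 * L)\<close>.\<close>

lemma window_upper_bound:
  assumes decreasing: "\<And>x y. a \<le> x \<Longrightarrow> x \<le> y \<Longrightarrow> w y \<le> w x" and a: "a \<in> I" "0 < L"
    and less: "w a / (w (a + 3 * L) * L\<^sup>2) < \<Lambda>"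
  shows "inf_spectrum_H_D I b \<le> ereal \<Lambda>"
proof -
  define F where "F = drift_primitive (\<lambda>x. 1 / w x)"
  define G where "G x = - drift_primitive w x" for x
  have F: "(F has_real_derivative 1 / w x) (at x)" for x
    unfolding F_def by (rule drift_primitive_has_derivative[OF inverse_w_continuous])
  have G: "(G has_real_derivative - w x) (at x)" for x
    unfolding G_def by (intro DERIV_minus drift_primitive_has_derivative w_continuous)
  have "\<exists>z. a < z \<and> z < a + L \<and> F (a + L) - F a = ((a + L) - a) * (1 / w z)"
    by (rule MVT2) (use a F in auto)
  then obtain z where z: "a < z" "F (a + L) - F a = L * (1 / w z)" by auto
  have "\<exists>z. a + L < z \<and> z < a + 2 * L \<and> G (a + 2 * L) - G (a + L) = ((a + 2 * L) - (a + L)) * (- w z)"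
    by (rule MVT2) (use a G in auto)
  then obtain y where "a + L < y" "y < a + 2 * L" "G (a + 2 * L) - G (a + L) = - (L * w y)" by auto
  then have y: "a < y" "y < a + 3 * L" "G (a + L) - G (a + 2 * L) = L * w y" using a(2) by linarith+
  have "\<exists>z. a + 2 * L < z \<and> z < a + 3 * L \<and> G (a + 3 * L) - G (a + 2 * L) = ((a + 3 * L) - (a + 2 * L)) * (- w z)"
    by (rule MVT2) (use a G in auto)
  then obtain v where "a + 2 * L < v" "G (a + 3 * L) - G (a + 2 * L) = - (L * w v)" by auto
  then have v: "a < v" "G (a + 2 * L) - G (a + 3 * L) = L * w v" using a(2) by linarith+
  have "1/2 * (1 / (L * (1 / w z)) + L * w v / L\<^sup>2) \<le> w a / L"
  proof -
    have "1/2 * (1 / (L * (1 / w z)) + L * w v / L\<^sup>2) = (w z + w v) / (2 * L)"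
      using a by (simp add: power2_eq_square field_simps)
    also have "\<dots> \<le> (2 * w a) / (2 * L)"
      using decreasing[of a z] decreasing[of a v] z v a by (intro divide_right_mono) auto
    finally show ?thesis by simp
  qed
  also have "\<dots> < \<Lambda> * (L * w (a + 3 * L))"
    using less w_pos[of "a + 3 * L"] a by (simp add: power2_eq_square field_simps)
  also have "\<dots> \<le> \<Lambda> * (L * w y)"
  proof -
    have "0 < w a / (w (a + 3 * L) * L\<^sup>2)" using w_pos a by simp
    then show ?thesis using less decreasing[of y "a + 3 * L"] y a by (intro mult_left_mono) auto
  qed
  finally have "1/2 * (1 / (L * (1 / w z)) + L * w v / L\<^sup>2) < \<Lambda> * (L * w y)" .
  moreover have "a + 2 * L + L = a + 3 * L" by simp
  ultimately have "1/2 * (1 / (F (a + L) - F a) + (G (a + 2 * L) - G (a + 2 * L + L)) / L\<^sup>2)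
      < \<Lambda> * (G (a + L) - G (a + 2 * L))"
    by (simp only: z(2) y(3) v(2))
  then show ?thesis
    by (rule trapezoid_upper_bound[OF F G a(1)  _ _ a(2), rotated 2]) (use a in auto)
qed

text \<open>The bound on \<open>F * G\<close> makes the first summand of \<eta> at most the second,
  so \<eta> is at most \<open>1 / (2 * F)\<close>. Then \<eta> squared over \<open>w\<close> is
  compensated exactly by the derivative of \<open>1 / (4 * F)\<close>, and the derivative of
  \<open>G / (4 * C)\<close> is what remains.\<close>

lemma muckenhoupt_lower_bound:
  assumes F: "\<And>x. (F has_real_derivative 1 / w x) (at x)"
    and G: "\<And>x. (G has_real_derivative - w x) (at x)"
    and pos: "\<And>x. x \<in> I \<Longrightarrow> 0 < F x" "\<And>x. x \<in> I \<Longrightarrow> 0 < G x"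
    and bound: "\<And>x. x \<in> I \<Longrightarrow> F x * G x \<le> C" and C: "0 < C"
  shows "ereal (1 / (8 * C)) \<le> inf_spectrum_H_D I b"
proof -
  define \<eta> where "\<eta> x = G x / (4 * C) + 1 / (4 * F x)" for x
  have "ereal (1 / (4 * C) / 2) \<le> inf_spectrum_H_D I b"
  proof (rule riccati_lower_bound)
    fix x assume x: "x \<in> I"
    note p = pos[OF x] w_pos[of x]
    show "(\<eta> has_real_derivative - w x / (4 * C) - 1 / (4 * (F x)\<^sup>2 * w x)) (at x)"
      unfolding \<eta>_def
      using p C by (auto intro!: derivative_eq_intros F G simp: power2_eq_square field_simps)
    have "G x / (4 * C) \<le> 1 / (4 * F x)" using bound[OF x] p C by (simp add: field_simps)
    then have "\<eta> x \<le> 1 / (2 * F x)" by (simp add: \<eta>_def)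
    moreover have "0 \<le> \<eta> x" using p C by (simp add: \<eta>_def)
    ultimately have "(\<eta> x)\<^sup>2 \<le> (1 / (2 * F x))\<^sup>2" by (rule power_mono)
    then have "(\<eta> x)\<^sup>2 / w x \<le> (1 / (2 * F x))\<^sup>2 / w x" using p by (intro divide_right_mono) auto
    also have "\<dots> = 1 / (4 * (F x)\<^sup>2 * w x)" by (simp add: power2_eq_square)
    finally show "- w x / (4 * C) - 1 / (4 * (F x)\<^sup>2 * w x) + (\<eta> x)\<^sup>2 / w x \<le> - (1 / (4 * C)) * w x" by simp
  qed
  then show ?thesis by simp
qed

text \<open>The sequence \<open>a\<close> runs to the left end of \<open>I\<close>, where
  \<open>F\<close> vanishes; this covers an approach to 0 on the half line and to minus infinity on
  the line. With the descent on \<open>[n, n + 1]\<close>, its energy is an increment of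
  \<open>G\<close> and tends to 0.\<close>

lemma muckenhoupt_upper_bound:
  assumes F: "\<And>x. (F has_real_derivative 1 / w x) (at x)"
    and G: "\<And>x. (G has_real_derivative - w x) (at x)"
    and x0: "0 < F x0" "0 < G x0"
    and a: "\<forall>\<^sub>F n in sequentially. a n \<in> I \<and> a n < x0" "(\<lambda>n. F (a n)) \<longlonglongrightarrow> 0"
    and G_top: "(G \<longlongrightarrow> 0) at_top"
  shows "inf_spectrum_H_D I b \<le> ereal (1 / (2 * (F x0 * G x0)))"
proof (rule ereal_le_epsilon2)
  fix e :: real assume e: "0 < e"
  \<comment> \<open>The extra \<open>e\<close> gives the strict inequality required of the test
    function.\<close>
  define \<Lambda> where "\<Lambda> = 1 / (2 * (F x0 * G x0)) + e"
  have lim: "filterlim (\<lambda>n. real n) at_top sequentially" by (rule filterlim_real_sequentially)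
  have G1: "(\<lambda>n. G (real n)) \<longlonglongrightarrow> 0" by (rule filterlim_compose[OF G_top lim])
  have G2: "(\<lambda>n. G (real n + 1)) \<longlonglongrightarrow> 0"
    using LIMSEQ_Suc[OF G1] by (simp add: add.commute)
  have "(\<lambda>n. \<Lambda> * (G x0 - G (real n)) - 1/2 * (1 / (F x0 - F (a n)) + (G (real n) - G (real n + 1)) / 1\<^sup>2))
      \<longlonglongrightarrow> \<Lambda> * (G x0 - 0) - 1/2 * (1 / (F x0 - 0) + (0 - 0) / 1\<^sup>2)"
    by (intro tendsto_intros G1 G2 a) (use x0 in auto)
  moreover have "0 < \<Lambda> * (G x0 - 0) - 1/2 * (1 / (F x0 - 0) + (0 - 0) / 1\<^sup>2)"
    using x0 e unfolding \<Lambda>_def by (simp add: field_simps)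
  ultimately have "\<forall>\<^sub>F n in sequentially. 0 < \<Lambda> * (G x0 - G (real n)) - 1/2 * (1 / (F x0 - F (a n)) + (G (real n) - G (real n + 1)) / 1\<^sup>2)"
    by (rule order_tendstoD)
  moreover have "\<forall>\<^sub>F n in sequentially. x0 < real n"
    using lim by (simp add: filterlim_at_top_dense)
  ultimately have "\<forall>\<^sub>F n in sequentially. inf_spectrum_H_D I b \<le> ereal \<Lambda>"
    using a(1)
  proof eventually_elim
    case (elim n)
    then show ?case by (intro trapezoid_upper_bound[OF F G, of "a n" x0 "real n" 1]) auto
  qed
  then show "inf_spectrum_H_D I b \<le> ereal (1 / (2 * (F x0 * G x0))) + ereal e"
    by (simp add: \<Lambda>_def)
qed

end


subsection \<open>The shifted drift\<close>

context weighted_line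
begin

text \<open>Over the total length \<open>3 * L\<close> the primitive of \<open>b\<close> falls by at
  most \<open>3 * L * \<beta>\<close>; the exponent of the weight is twice the primitive, hence the
  6.\<close>

lemma drift_window_upper_bound:
  assumes neg: "\<And>x. a \<le> x \<Longrightarrow> b x \<le> 0" and \<beta>: "\<And>x. a \<le> x \<Longrightarrow> x \<le> a + 3 * L \<Longrightarrow> - \<beta> \<le> b x"
    and a: "a \<in> I" "0 < L"
  shows "inf_spectrum_H_D I b \<le> ereal (exp (6 * L * \<beta>) / L\<^sup>2)"
proof (rule ereal_le_epsilon2)
  fix e :: real assume e: "0 < e"
  have dec: "w y \<le> w x" if "a \<le> x" "x \<le> y" for x y
  proof (rule DERIV_nonpos_imp_nonincreasing[OF that(2)])
    fix z assume "x \<le> z"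
    then have "2 * b z \<le> 0" using neg[of z] that(1) by simp
    then have "2 * b z * w z \<le> 0" by (rule mult_nonpos_nonneg) (simp add: w_pos less_imp_le)
    then show "\<exists>d. (w has_real_derivative d) (at z) \<and> d \<le> 0" using w_has_derivative by blast
  qed
  have "\<exists>z. a < z \<and> z < a + 3 * L \<and> drift_primitive b (a + 3 * L) - drift_primitive b a = ((a + 3 * L) - a) * b z"
    by (rule MVT2) (use a drift_primitive_has_derivative[OF b_continuous] in auto)
  then obtain z where z: "a < z" "z < a + 3 * L" "drift_primitive b (a + 3 * L) - drift_primitive b a = 3 * L * b z"
    by auto
  have "2 * drift_primitive b a - 2 * drift_primitive b (a + 3 * L) = 2 * (- (3 * L * b z))"
    using z(3) by linarith
  then have "w a / w (a + 3 * L) = exp (2 * (- (3 * L * b z)))"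
    unfolding w_def exp_diff[symmetric] by (rule arg_cong)
  also have "\<dots> \<le> exp (6 * L * \<beta>)"
  proof -
    have "L * (- b z) \<le> L * \<beta>" using \<beta>[of z] z a by (intro mult_left_mono) auto
    then show ?thesis by simp
  qed
  finally have "w a / w (a + 3 * L) / L\<^sup>2 \<le> exp (6 * L * \<beta>) / L\<^sup>2" by (rule divide_right_mono) simp
  then have "w a / (w (a + 3 * L) * L\<^sup>2) < exp (6 * L * \<beta>) / L\<^sup>2 + e" using e by simp
  then show "inf_spectrum_H_D I b \<le> ereal (exp (6 * L * \<beta>) / L\<^sup>2) + ereal e"
    using window_upper_bound[OF dec a] by simp
qed

end

lemma weighted_line_drift_shifted:
  assumes "I = {0<..} \<or> I = UNIV"
  shows "weighted_line I (drift_shifted \<gamma> l)"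
proof
  have "1 + \<bar>x\<bar> \<noteq> 0" for x :: real by linarith
  then show "continuous_on UNIV (drift_shifted \<gamma> l)"
    unfolding drift_shifted_def[abs_def] by (intro continuous_intros) auto
qed (rule assms)

lemma drift_shifted_nonpos: "0 < \<gamma> \<Longrightarrow> drift_shifted \<gamma> l x \<le> 0"
  by (simp add: drift_shifted_def)

text \<open>For \<open>l < 0\<close> the drift dies out at infinity, so arbitrarily long windows far
  out lose only a bounded factor of weight.\<close>

lemma inf_spectrum_shifted_negative_exponent:
  assumes I: "I = {0<..} \<or> I = UNIV" and \<gamma>: "0 < \<gamma>" and l: "l < 0"
  shows "inf_spectrum_H_D I (drift_shifted \<gamma> l) = 0"
proof (rule antisym)
  interpret weighted_line I "drift_shifted \<gamma> l" by (rule weighted_line_drift_shifted[OF I])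
  show "0 \<le> inf_spectrum_H_D I (drift_shifted \<gamma> l)" by (rule inf_spectrum_nonneg)
  show "inf_spectrum_H_D I (drift_shifted \<gamma> l) \<le> 0"
  proof (rule ereal_le_epsilon2)
    fix e :: real assume e: "0 < e"
    \<comment> \<open>Chosen together with \<open>\<beta> = 1 / (6 * L)\<close> so that the window
      bound equals \<open>exp 1 / L^2 = e\<close>.\<close>
    define L where "L = sqrt (exp 1 / e)"
    have L: "L > 0" "L\<^sup>2 = exp 1 / e" using e by (simp_all add: L_def)
    define \<beta> where "\<beta> = 1 / (6 * L)"
    have "((\<lambda>a. \<gamma> * (1 + a) powr l) \<longlongrightarrow> \<gamma> * 0) at_top"
    proof (intro tendsto_intros)
      have "((\<lambda>a. a powr l) \<longlongrightarrow> 0) at_top" using l by (intro tendsto_neg_powr filterlim_ident)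
      then show "((\<lambda>a. (1 + a) powr l) \<longlongrightarrow> 0) at_top"
        by (rule filterlim_compose) (rule filterlim_tendsto_add_at_top[OF tendsto_const filterlim_ident])
    qed
    then have "\<forall>\<^sub>F a in at_top. \<gamma> * (1 + a) powr l < \<beta>"
      by (rule order_tendstoD) (use L in \<open>simp add: \<beta>_def\<close>)
    then have "\<forall>\<^sub>F a in at_top. \<gamma> * (1 + a) powr l < \<beta> \<and> 0 < a"
      using eventually_gt_at_top by (rule eventually_conj)
    then obtain a where a: "\<gamma> * (1 + a) powr l < \<beta>" "0 < a" by (auto simp: eventually_at_top_linorder)
    have "inf_spectrum_H_D I (drift_shifted \<gamma> l) \<le> ereal (exp (6 * L * \<beta>) / L\<^sup>2)"
    proof (rule drift_window_upper_bound)
      show "- \<beta> \<le> drift_shifted \<gamma> l x" if "a \<le> x" for x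
      proof -
        have "(1 + x) powr l \<le> (1 + a) powr l" using that a l by (intro powr_mono2') auto
        then have "\<gamma> * (1 + x) powr l \<le> \<gamma> * (1 + a) powr l" using \<gamma> by simp
        then show ?thesis using a that by (simp add: drift_shifted_def)
      qed
    qed (use I a L drift_shifted_nonpos[OF \<gamma>] in auto)
    also have "exp (6 * L * \<beta>) / L\<^sup>2 = e" using L(1) e unfolding L(2) by (simp add: \<beta>_def)
    finally show "inf_spectrum_H_D I (drift_shifted \<gamma> l) \<le> 0 + ereal e" by simp
  qed
qed

text \<open>\<open>1 / s\<close> is the length at which the drift \<gamma> times
  \<open>x powr l\<close> equals the inverse length: stretching by \<open>s\<close> reduces a power
  drift to \<gamma> = 1, and eigenvalues scale by the square of \<open>s\<close>.\<close>

lemma powr_scale: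
  assumes "0 < \<gamma>" "0 \<le> (l::real)"
  defines "s \<equiv> \<gamma> powr (1 / (l + 1))"
  shows "0 < s" "s powr (l + 1) = \<gamma>" "\<gamma> = s * s powr l" "\<gamma> powr (2 / (l + 1)) = s\<^sup>2"
proof -
  show s: "0 < s" using assms by (simp add: s_def)
  show p: "s powr (l + 1) = \<gamma>" using assms by (simp add: s_def powr_powr)
  show "\<gamma> = s * s powr l" using s unfolding p[symmetric] by (simp add: powr_add)
  have "\<gamma> powr (2 / (l + 1)) = (\<gamma> powr (1 / (l + 1))) powr 2" by (simp add: powr_powr)
  then show "\<gamma> powr (2 / (l + 1)) = s\<^sup>2" using s by (simp add: s_def)
qed

text \<open>The windows occupy \<open>[L, 4 * L]\<close>, which lies in both choices of
  \<open>I\<close>; there \<open>1 + x\<close> is at most \<open>m\<close>, so the drift is at most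
  \<open>A / L\<close> in absolute value.\<close>

lemma inf_spectrum_shifted_upper_bound:
  assumes I: "I = {0<..} \<or> I = UNIV" and \<gamma>: "0 < \<gamma>" and l: "0 \<le> l"
    and L: "0 < L" "1 + 4 * L \<le> m" "L * \<gamma> * m powr l \<le> A"
  shows "inf_spectrum_H_D I (drift_shifted \<gamma> l) \<le> ereal (exp (6 * A) / L\<^sup>2)"
proof -
  interpret weighted_line I "drift_shifted \<gamma> l" by (rule weighted_line_drift_shifted[OF I])
  have "inf_spectrum_H_D I (drift_shifted \<gamma> l) \<le> ereal (exp (6 * L * (A / L)) / L\<^sup>2)"
  proof (rule drift_window_upper_bound[where a=L])
    show "- (A / L) \<le> drift_shifted \<gamma> l x" if x: "L \<le> x" "x \<le> L + 3 * L" for x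
    proof -
      have "(1 + x) powr l \<le> m powr l" using x L l by (intro powr_mono2) auto
      then have "L * \<gamma> * (1 + x) powr l \<le> L * \<gamma> * m powr l" using \<gamma> L by (intro mult_left_mono) auto
      then have "L * \<gamma> * (1 + x) powr l \<le> A" using L(3) by (rule order_trans)
      then show ?thesis using x L by (simp add: drift_shifted_def field_simps)
    qed
  qed (use I L drift_shifted_nonpos[OF \<gamma>] in auto)
  then show ?thesis using L by simp
qed

lemma inf_spectrum_shifted_upper_bounds:
  assumes I: "I = {0<..} \<or> I = UNIV" and \<gamma>: "0 < \<gamma>" and l: "0 \<le> l"
  shows "1 < \<gamma> \<Longrightarrow> inf_spectrum_H_D I (drift_shifted \<gamma> l) \<le> ereal (exp (6 * 5 powr l) * \<gamma>\<^sup>2)"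
    and "\<gamma> \<le> 1 \<Longrightarrow> inf_spectrum_H_D I (drift_shifted \<gamma> l) \<le> ereal (exp (6 * 5 powr l) * \<gamma> powr (2 / (l + 1)))"
proof -
  assume g: "1 < \<gamma>"
  \<comment> \<open>With \<open>L = 1 / \<gamma> < 1\<close> the windows end before 4, so
    \<open>m = 5\<close> suffices.\<close>
  show "inf_spectrum_H_D I (drift_shifted \<gamma> l) \<le> ereal (exp (6 * 5 powr l) * \<gamma>\<^sup>2)"
    using inf_spectrum_shifted_upper_bound[OF I \<gamma> l, of "1 / \<gamma>" 5 "5 powr l"] g
    by (simp add: power_divide field_simps)
next
  assume g: "\<gamma> \<le> 1"
  define s where "s = \<gamma> powr (1 / (l + 1))"
  note s = powr_scale[OF \<gamma> l, folded s_def]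
  have s1: "s \<le> 1" unfolding s_def using \<gamma> g l by (simp add: powr_le1)
  \<comment> \<open>The length is now \<open>1 / s\<close>, which is at least 1; hence
    \<open>1 + 4 / s\<close> is at most \<open>5 / s\<close>, and the scaling identity cancels
    \<gamma>.\<close>
  have "1 / s * \<gamma> * (5 / s) powr l = 5 powr l"
    using s(1) by (subst s(3)) (simp add: powr_divide)
  then have "inf_spectrum_H_D I (drift_shifted \<gamma> l) \<le> ereal (exp (6 * 5 powr l) / (1 / s)\<^sup>2)"
    using s s1 by (intro inf_spectrum_shifted_upper_bound[OF I \<gamma> l, where m="5 / s"]) (auto simp: field_simps)
  then show "inf_spectrum_H_D I (drift_shifted \<gamma> l) \<le> ereal (exp (6 * 5 powr l) * \<gamma> powr (2 / (l + 1)))"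
    unfolding s(4) by (simp add: power_divide)
qed

text \<open>Substitute \<open>\<eta> = \<psi> * w\<close>: the derivative of \<open>w\<close>
  contributes the drift term, and the common factor \<open>w\<close> drops out. Thus \<psi> is the
  logarithmic derivative of the positive supersolution.\<close>

lemma (in weighted_line) riccati_drift_lower_bound:
  assumes \<psi>: "\<And>x. (\<psi> has_real_derivative \<psi>' x) (at x)"
    and riccati: "\<And>x. \<psi>' x + 2 * b x * \<psi> x + (\<psi> x)\<^sup>2 \<le> - \<kappa>"
  shows "ereal (\<kappa> / 2) \<le> inf_spectrum_H_D I b"
proof (rule riccati_lower_bound)
  fix x
  show "((\<lambda>x. \<psi> x * w x) has_real_derivative \<psi>' x * w x + 2 * b x * w x * \<psi> x) (at x)"
    by (rule DERIV_mult[OF \<psi> w_has_derivative])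
  have "(\<psi>' x + 2 * b x * \<psi> x + (\<psi> x)\<^sup>2) * w x \<le> - \<kappa> * w x"
    using riccati[of x] w_pos[of x] by (intro mult_right_mono) auto
  then show "\<psi>' x * w x + 2 * b x * w x * \<psi> x + (\<psi> x * w x)\<^sup>2 / w x \<le> - \<kappa> * w x"
    using w_pos[of x] by (simp add: power2_eq_square algebra_simps)
qed

text \<open>For the first bound the constant \<open>\<psi> = \<gamma>\<close> suffices, because the
  drift is at least \<gamma> in absolute value. A constant of order \<open>s\<close> fails when
  \<gamma> is small, since near 0 the drift is then much weaker than \<open>s\<close>; the second
  bound uses a decreasing \<psi> on the scale \<open>1 / s\<close>. Its constant 1/800 is adopted
  for both.\<close>

lemma inf_spectrum_shifted_lower_bounds:
  assumes I: "I = {0<..} \<or> I = UNIV" and \<gamma>: "0 < \<gamma>" and l: "0 \<le> l"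
  shows "ereal (1 / 800 * \<gamma>\<^sup>2) \<le> inf_spectrum_H_D I (drift_shifted \<gamma> l)"
    and "ereal (1 / 800 * \<gamma> powr (2 / (l + 1))) \<le> inf_spectrum_H_D I (drift_shifted \<gamma> l)"
proof -
  interpret weighted_line I "drift_shifted \<gamma> l" by (rule weighted_line_drift_shifted[OF I])
  have "ereal (\<gamma>\<^sup>2 / 2) \<le> inf_spectrum_H_D I (drift_shifted \<gamma> l)"
  proof (rule riccati_drift_lower_bound)
    show "((\<lambda>x. \<gamma>) has_real_derivative 0) (at x)" for x by simp
    fix x :: real
    have "1 \<le> (1 + \<bar>x\<bar>) powr l" using l by (simp add: ge_one_powr_ge_zero)
    then have "\<gamma> * \<gamma> * 1 \<le> \<gamma> * \<gamma> * (1 + \<bar>x\<bar>) powr l" using \<gamma> by simp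
    then show "0 + 2 * drift_shifted \<gamma> l x * \<gamma> + \<gamma>\<^sup>2 \<le> - \<gamma>\<^sup>2"
      by (simp add: drift_shifted_def power2_eq_square algebra_simps)
  qed
  moreover have "ereal (1 / 800 * \<gamma>\<^sup>2) \<le> ereal (\<gamma>\<^sup>2 / 2)" by simp
  ultimately show "ereal (1 / 800 * \<gamma>\<^sup>2) \<le> inf_spectrum_H_D I (drift_shifted \<gamma> l)" by (rule order_trans[rotated])
  define s where "s = \<gamma> powr (1 / (l + 1))"
  note s = powr_scale[OF \<gamma> l, folded s_def]
  \<comment> \<open>The drift yields the Riccati inequality for \<open>\<bar>y\<bar> \<ge> 1\<close>, the decrease of \<open>- arctan\<close> for \<open>\<bar>y\<bar> \<le> 1\<close>.\<close>
  define \<phi> :: "real \<Rightarrow> real" where "\<phi> y = (3 - arctan y) / 100" for y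
  \<comment> \<open>\<open>arctan\<close> stays strictly between -2 and 2, so the constant 3 keeps
    \<phi> positive, and the factor 1/100 makes its square small against the linear terms.\<close>
  have \<phi>: "1 / 100 \<le> \<phi> y" "\<phi> y \<le> 1 / 20" for y
    using arctan_lbound[of y] arctan_ubound[of y] pi_less_4 by (auto simp: \<phi>_def)
  have "ereal (s\<^sup>2 / 400 / 2) \<le> inf_spectrum_H_D I (drift_shifted \<gamma> l)"
  proof (rule riccati_drift_lower_bound)
    fix x :: real
    define y where "y = s * x"
    let ?d = "- s\<^sup>2 / (100 * (1 + y\<^sup>2))"
    show "((\<lambda>x. s * \<phi> (s * x)) has_real_derivative - s\<^sup>2 / (100 * (1 + (s * x)\<^sup>2))) (at x)"
    proof -
      have d: "((\<lambda>x. s * \<phi> (s * x)) has_real_derivative s * ((0 - inverse (1 + (s * x)\<^sup>2) * s) / 100)) (at x)"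
        unfolding \<phi>_def by (auto intro!: derivative_eq_intros)
      have eq: "s * ((0 - inverse q * s) / 100) = - s\<^sup>2 / (100 * q)" for q
        by (simp add: power2_eq_square inverse_eq_divide)
      show ?thesis using d unfolding eq .
    qed
    have sq: "(\<phi> y)\<^sup>2 \<le> 1 / 400" using power_mono[of "\<phi> y" "1/20" 2] \<phi>[of y] by (simp add: power2_eq_square)
    \<comment> \<open>The budget: the linear terms gain \<open>s^2 / 200\<close>, the square costs
      at most \<open>s^2 / 400\<close>, and \<open>s^2 / 400\<close> is left as \<kappa>.\<close>
    have "?d + 2 * drift_shifted \<gamma> l x * (s * \<phi> y) \<le> - s\<^sup>2 / 200"
    proof (cases "\<bar>y\<bar> \<le> 1")
      case True
      then have "y\<^sup>2 \<le> 1" by (simp add: abs_square_le_1)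
      then have "s\<^sup>2 / 200 \<le> s\<^sup>2 / (100 * (1 + y\<^sup>2))"
        by (intro divide_left_mono) (auto simp: add_pos_nonneg)
      then have "?d \<le> - s\<^sup>2 / 200" by simp
      moreover have "drift_shifted \<gamma> l x * (s * \<phi> y) \<le> 0"
        using drift_shifted_nonpos[OF \<gamma>, of l x] s(1) \<phi>(1)[of y] by (intro mult_nonpos_nonneg) auto
      ultimately show ?thesis by linarith
    next
      case False
      \<comment> \<open>Outside the scale \<open>1 / s\<close> the drift has strength at least
        \<open>\<gamma> * (1 / s) powr l = s\<close>.\<close>
      then have "1 / s \<le> 1 + \<bar>x\<bar>" using s(1) by (simp add: y_def abs_mult field_simps)
      then have "(1 / s) powr l \<le> (1 + \<bar>x\<bar>) powr l" using l s(1) by (intro powr_mono2) auto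
      then have "\<gamma> * (1 / s) powr l \<le> \<gamma> * (1 + \<bar>x\<bar>) powr l" using \<gamma> by simp
      moreover have "\<gamma> * (1 / s) powr l = s" using s(1) by (subst s(3)) (simp add: powr_divide)
      ultimately have "drift_shifted \<gamma> l x \<le> - s" by (simp add: drift_shifted_def)
      then have "drift_shifted \<gamma> l x * (s * \<phi> y) \<le> - s * (s * \<phi> y)"
        using s(1) \<phi>(1)[of y] by (intro mult_right_mono) auto
      moreover have "s\<^sup>2 * (1 / 100) \<le> s\<^sup>2 * \<phi> y" using \<phi>(1)[of y] by (intro mult_left_mono) auto
      moreover have "- s * (s * \<phi> y) = - (s\<^sup>2 * \<phi> y)" by (simp add: power2_eq_square)
      moreover have "2 * drift_shifted \<gamma> l x * (s * \<phi> y) = 2 * (drift_shifted \<gamma> l x * (s * \<phi> y))" by simp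
      moreover have "?d \<le> 0" by (simp add: add_nonneg_nonneg)
      ultimately show ?thesis using zero_le_power2[of s] by linarith
    qed
    moreover have "(s * \<phi> y)\<^sup>2 \<le> s\<^sup>2 * (1 / 400)"
      unfolding power_mult_distrib using sq by (intro mult_left_mono) auto
    ultimately show "- s\<^sup>2 / (100 * (1 + (s * x)\<^sup>2)) + 2 * drift_shifted \<gamma> l x * (s * \<phi> (s * x)) + (s * \<phi> (s * x))\<^sup>2 \<le> - (s\<^sup>2 / 400)"
      unfolding y_def by simp
  qed
  then show "ereal (1 / 800 * \<gamma> powr (2 / (l + 1))) \<le> inf_spectrum_H_D I (drift_shifted \<gamma> l)"
    unfolding s(4) by simp
qed


subsection \<open>The power drift\<close>

lemma DERIV_diff_mono:
  fixes f g :: "real \<Rightarrow> real"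
  assumes "x \<le> y"
    and "\<And>z. (f has_real_derivative f' z) (at z)" "\<And>z. (g has_real_derivative g' z) (at z)"
    and "\<And>z. x \<le> z \<Longrightarrow> z \<le> y \<Longrightarrow> f' z \<le> g' z"
  shows "f y - f x \<le> g y - g x"
proof -
  have "g x - f x \<le> g y - f y"
  proof (rule DERIV_nonneg_imp_nondecreasing[OF assms(1)])
    fix z assume "x \<le> z" "z \<le> y"
    then show "\<exists>d. ((\<lambda>z. g z - f z) has_real_derivative d) (at z) \<and> 0 \<le> d"
      using DERIV_diff[OF assms(3,2), of z] assms(4)[of z] by (intro exI[of _ "g' z - f' z"]) auto
  qed
  then show ?thesis by simp
qed

text \<open>The power drift at \<gamma> = 1 with its sign removed, with the same exception at
  \<open>l = 0\<close> as \<open>drift_power\<close>.\<close>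

definition abs_power :: "real \<Rightarrow> real \<Rightarrow> real" where
  "abs_power l x = (if l = 0 then 1 else \<bar>x\<bar> powr l)"

definition abs_power_primitive :: "real \<Rightarrow> real \<Rightarrow> real" where
  "abs_power_primitive l = drift_primitive (abs_power l)"

definition power_weight :: "real \<Rightarrow> real \<Rightarrow> real" where
  "power_weight l x = exp (- 2 * abs_power_primitive l x)"

text \<open>The integral of the weight over \<open>[x, \<infinity>)\<close>, written through a
  primitive so that it is differentiable at every real \<open>x\<close>, negative ones included; the
  line case evaluates it there.\<close>

definition power_tail :: "real \<Rightarrow> real \<Rightarrow> real" where
  "power_tail l x = (SUP y. drift_primitive (power_weight l) y) - drift_primitive (power_weight l) x"

definition power_scale_fun :: "real \<Rightarrow> real \<Rightarrow> real" where
  "power_scale_fun l = drift_primitive (\<lambda>x. 1 / power_weight l x)"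

context
  fixes l :: real
  assumes l: "0 \<le> l"
begin

private abbreviation "U \<equiv> abs_power_primitive l"
private abbreviation "v \<equiv> power_weight l"
private abbreviation "G \<equiv> power_tail l"
private abbreviation "F \<equiv> power_scale_fun l"

lemma abs_power_continuous: "continuous_on S (abs_power l)"
proof (cases "l = 0")
  case True
  then show ?thesis by (simp add: abs_power_def[abs_def])
next
  case False
  then show ?thesis using l unfolding abs_power_def[abs_def]
    by (auto intro!: continuous_on_powr' continuous_on_rabs continuous_on_id continuous_on_const)
qed

lemma abs_power_nonneg: "0 \<le> abs_power l x"
  by (simp add: abs_power_def)

lemma abs_power_mono: "\<bar>x\<bar> \<le> \<bar>y\<bar> \<Longrightarrow> abs_power l x \<le> abs_power l y"
  using l by (auto simp: abs_power_def intro: powr_mono2)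

lemma abs_power_ge_1: "1 \<le> \<bar>x\<bar> \<Longrightarrow> 1 \<le> abs_power l x"
  using l by (auto simp: abs_power_def intro: ge_one_powr_ge_zero)

lemma abs_power_primitive_has_derivative: "(U has_real_derivative abs_power l x) (at x)"
  unfolding abs_power_primitive_def by (rule drift_primitive_has_derivative[OF abs_power_continuous])

lemma abs_power_primitive_0: "U 0 = 0"
  by (simp add: abs_power_primitive_def drift_primitive_0)

lemma abs_power_primitive_minus: "U (- x) = - U x"
proof -
  have "((\<lambda>x. - U (- x)) has_real_derivative abs_power l x) (at x)" for x
  proof -
    have "((\<lambda>x. U (- x)) has_real_derivative abs_power l (- x) * (- 1)) (at x)"
      by (rule DERIV_chain2[OF abs_power_primitive_has_derivative]) (auto intro!: derivative_eq_intros)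
    then show ?thesis using DERIV_minus by (fastforce simp: abs_power_def)
  qed
  then have "(\<lambda>x. - U (- x)) = U"
    unfolding abs_power_primitive_def[of l, symmetric]
    using DERIV_eq_primitive[OF abs_power_continuous, of "\<lambda>x. - U (- x)"] abs_power_primitive_0
    by (simp add: abs_power_primitive_def)
  then show ?thesis by (metis minus_minus)
qed

lemma abs_power_primitive_eq:
  assumes "0 \<le> x"
  shows "U x = x powr (l + 1) / (l + 1)"
proof (cases "x = 0")
  case False
  then have x: "0 < x" using assms by simp
  let ?h = "\<lambda>x. U x - x powr (l + 1) / (l + 1)"
  have "?h x = ?h 0"
  \<comment> \<open>The power is differentiated only at positive arguments; continuity carries the
    identity to 0.\<close>
  proof (rule DERIV_isconst2[OF x, of ?h x])
    show "continuous_on {0..x} ?h"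
    proof (intro continuous_on_diff continuous_on_divide continuous_on_powr' continuous_on_id continuous_on_const)
      show "continuous_on {0..x} U"
        by (rule DERIV_continuous_on) (rule has_field_derivative_at_within[OF abs_power_primitive_has_derivative])
    qed (use l in auto)
    show "(?h has_real_derivative 0) (at y)" if "0 < y" for y
    proof -
      have "((\<lambda>x. x powr (l + 1) / (l + 1)) has_real_derivative (l + 1) * y powr (l + 1 - 1) / (l + 1)) (at y)"
        by (intro DERIV_cdivide has_real_derivative_powr that)
      from DERIV_diff[OF abs_power_primitive_has_derivative this] show ?thesis
        using l that by (cases "l = 0") (simp_all add: abs_power_def)
    qed
  qed (use x in auto)
  then show ?thesis using l by (simp add: abs_power_primitive_0)
qed (use l in \<open>simp add: abs_power_primitive_0\<close>)

lemma abs_power_primitive_mono: "x \<le> y \<Longrightarrow> U x \<le> U y"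
  using DERIV_diff_mono[OF _ DERIV_const abs_power_primitive_has_derivative, of x y 0] abs_power_nonneg by simp

text \<open>The slope of the primitive is at least 1 beyond 1; the \<open>- 1\<close> pays for the
  part in \<open>[0, 1]\<close>, where it may be close to 0. This one estimate gives exponential
  control for all \<open>l\<close> at once.\<close>

lemma abs_power_primitive_increment_ge:
  assumes "0 \<le> z" "z \<le> x"
  shows "x - z - 1 \<le> U x - U z"
proof -
  have ge: "d - c \<le> U d - U c" if "1 \<le> c" "c \<le> d" for c d
    using DERIV_diff_mono[OF that(2) DERIV_ident abs_power_primitive_has_derivative] abs_power_ge_1 that by simp
  consider "1 \<le> z" | "x \<le> 1" | "z \<le> 1" "1 \<le> x" by linarith
  then show ?thesis
  proof cases
    case 1 then show ?thesis using ge[of z x] assms by simp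
  next
    case 2 then show ?thesis using abs_power_primitive_mono[of z x] assms by simp
  next
    case 3 then show ?thesis using ge[of 1 x] abs_power_primitive_mono[of z 1] assms by simp
  qed
qed

lemma power_weight_pos: "0 < v x" by (simp add: power_weight_def)

lemma power_weight_continuous: "continuous_on S v"
proof -
  have "continuous_on S U" by (rule DERIV_continuous_on) (rule has_field_derivative_at_within[OF abs_power_primitive_has_derivative])
  then show ?thesis unfolding power_weight_def[abs_def] by (intro continuous_intros)
qed

lemma power_weight_minus: "v (- x) = 1 / v x"
  by (simp add: power_weight_def abs_power_primitive_minus exp_minus inverse_eq_divide)

lemma power_weight_primitive_has_derivative: "(drift_primitive v has_real_derivative v x) (at x)"
  by (rule drift_primitive_has_derivative[OF power_weight_continuous])

lemma power_weight_primitive_strict_mono: "x < y \<Longrightarrow> drift_primitive v x < drift_primitive v y"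
  by (rule DERIV_pos_imp_increasing) (auto intro: power_weight_primitive_has_derivative power_weight_pos)

text \<open>Comparison with an exponential: for \<open>z\<close> beyond \<open>x\<close> the weight
  is at most \<open>exp 2 * v x * exp (- 2 * (z - x))\<close>, whose tail integrates to the
  bound.\<close>

lemma power_weight_primitive_increment_le:
  assumes "0 \<le> x" "x \<le> y"
  shows "drift_primitive v y - drift_primitive v x \<le> exp 2 / 2 * v x"
proof -
  let ?g = "\<lambda>z. - (exp (2 + 2 * x) * v x / 2) * exp (- 2 * z)"
  have "drift_primitive v y - drift_primitive v x \<le> ?g y - ?g x"
  proof (rule DERIV_diff_mono[OF assms(2) power_weight_primitive_has_derivative])
    show "(?g has_real_derivative exp (2 + 2 * x) * v x * exp (- 2 * z)) (at z)" for z
      by (auto intro!: derivative_eq_intros)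
    show "v z \<le> exp (2 + 2 * x) * v x * exp (- 2 * z)" if "x \<le> z" for z
      using abs_power_primitive_increment_ge[OF assms(1) that] by (simp add: power_weight_def flip: exp_add)
  qed
  also have "\<dots> \<le> - ?g x" using power_weight_pos[of x] by simp
  also have "\<dots> = exp 2 / 2 * v x" by (simp add: exp_add exp_minus field_simps)
  finally show ?thesis .
qed

lemma power_weight_primitive_bdd: "bdd_above (range (drift_primitive v))"
proof (rule bdd_aboveI2)
  fix y :: real
  have "drift_primitive v y \<le> drift_primitive v (max 0 y)"
    using power_weight_primitive_strict_mono[of y "max 0 y"] by (cases "y \<ge> 0") auto
  also have "\<dots> \<le> exp 2 / 2 * v 0" using power_weight_primitive_increment_le[of 0 "max 0 y"] by (simp add: drift_primitive_0)
  finally show "drift_primitive v y \<le> exp 2 / 2 * v 0" .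
qed

lemma power_tail_has_derivative: "(G has_real_derivative - v x) (at x)"
  unfolding power_tail_def[abs_def] using DERIV_diff[OF DERIV_const power_weight_primitive_has_derivative] by simp

lemma power_tail_pos: "0 < G x"
  using power_weight_primitive_strict_mono[of x "x + 1"] cSUP_upper[OF UNIV_I power_weight_primitive_bdd, of "x + 1"] by (simp add: power_tail_def)

lemma power_weight_primitive_tendsto: "(drift_primitive v \<longlongrightarrow> (SUP y. drift_primitive v y)) at_top"
proof (rule increasing_tendsto)
  show "\<forall>\<^sub>F x in at_top. drift_primitive v x \<le> (SUP y. drift_primitive v y)"
    by (intro always_eventually allI cSUP_upper power_weight_primitive_bdd UNIV_I)
  fix c assume "c < (SUP y. drift_primitive v y)"
  then obtain y where y: "c < drift_primitive v y" using less_cSUP_iff[OF _ power_weight_primitive_bdd] by auto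
  show "\<forall>\<^sub>F x in at_top. c < drift_primitive v x"
    using eventually_gt_at_top[of y] by eventually_elim (use y power_weight_primitive_strict_mono in force)
qed

lemma power_tail_tendsto: "(G \<longlongrightarrow> 0) at_top"
  using tendsto_diff[OF tendsto_const power_weight_primitive_tendsto, of "SUP y. drift_primitive v y"]
  unfolding power_tail_def[abs_def] by simp

lemma power_tail_le: "0 \<le> x \<Longrightarrow> G x \<le> exp 2 / 2 * v x"
proof -
  assume x: "0 \<le> x"
  have "(SUP y. drift_primitive v y) \<le> exp 2 / 2 * v x + drift_primitive v x"
  proof (rule cSUP_least)
    fix y
    show "drift_primitive v y \<le> exp 2 / 2 * v x + drift_primitive v x"
    proof (cases "x \<le> y")
      case True then show ?thesis using power_weight_primitive_increment_le[OF x] by fastforce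
    next
      case False
      then show ?thesis using power_weight_primitive_strict_mono[of y x] power_weight_pos[of x] by (smt (verit) exp_gt_zero half_gt_zero mult_pos_pos)
    qed
  qed simp
  then show ?thesis by (simp add: power_tail_def)
qed

lemma power_tail_eq_integral:
  assumes "0 \<le> x"
  shows "G x = (LBINT z:{x..}. exp (- (2 * z powr (l + 1) / (l + 1))))"
proof -
  have meas: "v \<in> borel_measurable borel" by (rule borel_measurable_continuous_onI[OF power_weight_continuous])
  have "(\<integral>\<^sup>+z. ennreal (v z) * indicator {x..} z \<partial>lborel) = ennreal ((SUP y. drift_primitive v y) - drift_primitive v x)"
    by (rule nn_integral_FTC_atLeast[OF meas power_weight_primitive_has_derivative _ power_weight_primitive_tendsto]) (simp add: power_weight_pos less_imp_le)
  moreover have "(\<integral>\<^sup>+z. ennreal (indicator {x..} z * v z) \<partial>lborel) = (\<integral>\<^sup>+z. ennreal (v z) * indicator {x..} z \<partial>lborel)"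
    by (intro nn_integral_cong) (simp add: indicator_def)
  ultimately have "(\<integral>\<^sup>+z. ennreal (indicator {x..} z * v z) \<partial>lborel) = ennreal (G x)"
    unfolding power_tail_def by simp
  then have "has_bochner_integral lborel (\<lambda>z. indicator {x..} z * v z) (G x)"
    by (intro has_bochner_integral_nn_integral)
      (use meas power_tail_pos[of x] power_weight_pos in \<open>auto simp: less_imp_le\<close>)
  then have "G x = (LBINT z:{x..}. v z)"
    unfolding set_lebesgue_integral_def by (simp add: has_bochner_integral_iff)
  also have "\<dots> = (LBINT z:{x..}. exp (- (2 * z powr (l + 1) / (l + 1))))"
    by (rule set_lebesgue_integral_cong) (use assms in \<open>auto simp: power_weight_def abs_power_primitive_eq\<close>)
  finally show ?thesis .
qed

lemma inverse_power_weight: "1 / v x = exp (2 * U x)"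
  by (simp add: power_weight_def exp_minus divide_inverse)

lemma inverse_power_weight_continuous: "continuous_on S (\<lambda>z. 1 / v z)"
  by (intro continuous_intros power_weight_continuous) (simp add: power_weight_def)

lemma power_scale_fun_has_derivative: "(F has_real_derivative 1 / v x) (at x)"
  unfolding power_scale_fun_def by (rule drift_primitive_has_derivative[OF inverse_power_weight_continuous])

lemma power_scale_fun_0: "F 0 = 0" by (simp add: power_scale_fun_def drift_primitive_0)

lemma power_scale_fun_pos: "0 < x \<Longrightarrow> 0 < F x"
  using DERIV_pos_imp_increasing[of 0 x F] power_scale_fun_has_derivative power_weight_pos power_scale_fun_0 by fastforce

text \<open>Mirror image of the tail estimate: below \<open>x\<close> the reciprocal weight is at
  most \<open>exp 2 * (1 / v x) * exp (- 2 * (x - z))\<close>.\<close>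

lemma power_scale_fun_le:
  assumes "0 \<le> x"
  shows "F x \<le> exp 2 / 2 * (1 / v x)"
proof -
  let ?g = "\<lambda>z. exp (2 - 2 * x) * (1 / v x) / 2 * exp (2 * z)"
  have "F x - F 0 \<le> ?g x - ?g 0"
  proof (rule DERIV_diff_mono[OF assms power_scale_fun_has_derivative])
    show "(?g has_real_derivative exp (2 - 2 * x) * (1 / v x) * exp (2 * z)) (at z)" for z
      by (auto intro!: derivative_eq_intros simp: power_weight_def)
    show "1 / v z \<le> exp (2 - 2 * x) * (1 / v x) * exp (2 * z)" if "0 \<le> z" "z \<le> x" for z
      using abs_power_primitive_increment_ge[OF that] unfolding inverse_power_weight exp_add[symmetric] by simp
  qed
  also have "\<dots> \<le> ?g x" using power_weight_pos[of x] by simp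
  also have "\<dots> = exp 2 / 2 * (1 / v x)" using power_weight_pos[of x] by (simp add: exp_diff field_simps)
  finally show ?thesis by (simp add: power_scale_fun_0)
qed

lemma power_scale_fun_eq_integral:
  assumes "0 \<le> x"
  shows "F x = (LBINT z:{0..x}. exp (2 * z powr (l + 1) / (l + 1)))"
proof -
  have "(LBINT z. 1 / v z * indicator {0..x} z) = F x - F 0"
    by (intro integral_FTC_Icc_real assms power_scale_fun_has_derivative)
      (use inverse_power_weight_continuous[of UNIV] in \<open>auto simp: continuous_on_eq_continuous_at\<close>)
  then have "F x = (LBINT z:{0..x}. 1 / v z)"
    unfolding set_lebesgue_integral_def by (simp add: power_scale_fun_0 mult.commute)
  also have "\<dots> = (LBINT z:{0..x}. exp (2 * z powr (l + 1) / (l + 1)))"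
    by (rule set_lebesgue_integral_cong) (auto simp: power_weight_def abs_power_primitive_eq exp_minus divide_inverse)
  finally show ?thesis .
qed

lemma C_half_line_eq: "C_half_line l = (SUP x\<in>{0<..}. F x * G x)"
  unfolding C_half_line_def by (intro SUP_cong refl) (simp add: power_scale_fun_eq_integral power_tail_eq_integral)

text \<open>The two exponential estimates carry reciprocal weights, which cancel. Boundedness is
  what gives the real supremum in \<open>C_half_line\<close> its meaning.\<close>

lemma power_scale_fun_tail_bdd: "bdd_above ((\<lambda>x. F x * G x) ` {0<..})"
proof (rule bdd_aboveI2)
  fix x :: real assume "x \<in> {0<..}"
  then have "F x * G x \<le> (exp 2 / 2 * (1 / v x)) * (exp 2 / 2 * v x)"
    using power_scale_fun_le[of x] power_tail_le[of x] power_scale_fun_pos[of x] power_tail_pos[of x] power_weight_pos[of x] by (intro mult_mono) auto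
  also have "\<dots> = exp 2 / 2 * (exp 2 / 2)" using power_weight_pos[of x] by simp
  finally show "F x * G x \<le> exp 2 / 2 * (exp 2 / 2)" .
qed

lemma C_half_line_upper: "0 < x \<Longrightarrow> F x * G x \<le> C_half_line l"
  unfolding C_half_line_eq by (intro cSUP_upper power_scale_fun_tail_bdd) auto

lemma C_half_line_pos: "0 < C_half_line l"
  using C_half_line_upper[of 1] mult_pos_pos[OF power_scale_fun_pos[of 1] power_tail_pos[of 1]] by simp

lemma C_line_eq: "C_line l = (G 0)\<^sup>2"
  by (simp add: C_line_def power_tail_eq_integral)

text \<open>
  For \<open>z \<ge> x \<ge> 0\<close> the drift on \<open>[x, z]\<close> is stronger than on \<open>[-x, z - 2x]\<close>, so the tail at \<open>x\<close> is
  dominated by the suitably scaled tail at \<open>-x\<close>.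
\<close>

lemma power_tail_reflect_le:
  assumes x: "0 \<le> x"
  shows "G x \<le> (v x)\<^sup>2 * G (- x)"
proof -
  \<comment> \<open>\<open>?D\<close> is nonincreasing on \<open>[x, \<infinity>)\<close> and tends
    to 0, so its value at \<open>x\<close> is nonnegative.\<close>
  let ?D = "\<lambda>z. (v x)\<^sup>2 * G (z - 2 * x) - G z"
  have shift: "((\<lambda>z. f (z - 2 * x)) has_real_derivative f' (z - 2 * x)) (at z)"
    if "\<And>z. (f has_real_derivative f' z) (at z)" for f f' z
    using DERIV_shift[of f "f' (z - 2 * x)" z "- 2 * x"] that by simp
  have v_le: "v z \<le> (v x)\<^sup>2 * v (z - 2 * x)" if z: "x \<le> z" for z
  proof -
    have "U (z - 2 * x) - U (x - 2 * x) \<le> U z - U x"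
      by (rule DERIV_diff_mono[OF z shift[OF abs_power_primitive_has_derivative] abs_power_primitive_has_derivative])
        (use x in \<open>auto intro!: abs_power_mono\<close>)
    then have "2 * U x + U (z - 2 * x) \<le> U z" using abs_power_primitive_minus[of x] by simp
    then show ?thesis by (simp add: power_weight_def power2_eq_square flip: exp_add)
  qed
  have D: "(?D has_real_derivative (v x)\<^sup>2 * (- v (z - 2 * x)) - (- v z)) (at z)" for z
    by (intro DERIV_diff DERIV_cmult power_tail_has_derivative shift[of G "\<lambda>x. - v x"])
  have "?D z \<le> ?D x" if "x \<le> z" for z
    by (rule DERIV_nonpos_imp_nonincreasing[OF that]) (use D v_le in force)
  then have ev: "\<forall>\<^sub>F z in at_top. ?D z \<le> ?D x"
    by (rule eventually_mono[OF eventually_ge_at_top])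
  have "filterlim (\<lambda>z. - 2 * x + z) at_top at_top"
    by (rule filterlim_tendsto_add_at_top[OF tendsto_const filterlim_ident])
  then have "((\<lambda>z. G (- 2 * x + z)) \<longlongrightarrow> 0) at_top" by (rule filterlim_compose[OF power_tail_tendsto])
  then have "((\<lambda>z. G (z - 2 * x)) \<longlongrightarrow> 0) at_top" by (simp add: add.commute)
  then have "(?D \<longlongrightarrow> (v x)\<^sup>2 * 0 - 0) at_top"
    by (intro tendsto_intros power_tail_tendsto)
  then have "(v x)\<^sup>2 * 0 - 0 \<le> ?D x" using ev by (rule tendsto_upperbound) simp
  then show ?thesis by simp
qed

text \<open>The product is even in \<open>x\<close>, and for positive arguments its derivative
  \<open>G / v - v * G (- y)\<close> is nonpositive by the reflection estimate; the maximum is at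
  0.\<close>

lemma power_tail_mult_reflect_le: "G (- x) * G x \<le> C_line l"
proof -
  have le: "G (- x) * G x \<le> (G 0)\<^sup>2" if "0 \<le> x" for x
  proof -
    let ?h = "\<lambda>x. G (- x) * G x"
    have d: "(?h has_real_derivative (1 / v y * G y + (- v y) * G (- y))) (at y)" for y
    proof -
      have "((\<lambda>y. G (- y)) has_real_derivative (- v (- y)) * (- 1)) (at y)"
        by (rule DERIV_chain2[OF power_tail_has_derivative]) (auto intro!: derivative_eq_intros)
      then have "((\<lambda>y. G (- y)) has_real_derivative 1 / v y) (at y)" by (simp add: power_weight_minus)
      from DERIV_mult[OF this power_tail_has_derivative] show ?thesis .
    qed
    have "?h x \<le> ?h 0"
    proof (rule DERIV_nonpos_imp_nonincreasing[OF that])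
      fix y :: real assume y: "0 \<le> y"
      have "1 / v y * G y \<le> 1 / v y * ((v y)\<^sup>2 * G (- y))"
        using power_tail_reflect_le[OF y] power_weight_pos[of y] by (intro mult_left_mono) auto
      also have "\<dots> = v y * G (- y)" using power_weight_pos[of y] by (simp add: power2_eq_square)
      finally show "\<exists>d. (?h has_real_derivative d) (at y) \<and> d \<le> 0" using d[of y] by (intro exI conjI) auto
    qed
    then show ?thesis by (simp add: power2_eq_square)
  qed
  show ?thesis unfolding C_line_eq using le[of x] le[of "- x"] by (cases "0 \<le> x") (auto simp: mult.commute)
qed

section \<open>Scaling to general \<gamma> and the two-sided bounds for the power drift\<close>

lemma weighted_line_drift_power:
  fixes I :: "real set"
  assumes "I = {0<..} \<or> I = UNIV"
  shows "weighted_line I (drift_power \<gamma> l)"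
proof
  show "continuous_on UNIV (drift_power \<gamma> l)"
    unfolding drift_power_def[abs_def] abs_power_def[symmetric] by (intro continuous_intros abs_power_continuous)
qed (rule assms)

text \<open>Both \<open>- U (s * x)\<close> and the primitive of the drift vanish at 0 and have the
  same derivative, by \<open>\<gamma> = s * s powr l\<close>.\<close>

lemma drift_power_weight:
  fixes I :: "real set"
  assumes I: "I = {0<..} \<or> I = UNIV" and \<gamma>: "0 < \<gamma>"
  defines "s \<equiv> \<gamma> powr (1 / (l + 1))"
  shows "weighted_line.w (drift_power \<gamma> l) x = v (s * x)"
proof -
  interpret weighted_line I "drift_power \<gamma> l" by (rule weighted_line_drift_power[OF I])
  note s = powr_scale[OF \<gamma> l, folded s_def]
  have "(\<lambda>x. - U (s * x)) = drift_primitive (drift_power \<gamma> l)"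
  proof (rule DERIV_eq_primitive[OF b_continuous])
    fix x :: real
    have "((\<lambda>x. U (s * x)) has_real_derivative abs_power l (s * x) * s) (at x)"
      by (rule DERIV_chain2[OF abs_power_primitive_has_derivative]) (auto intro!: derivative_eq_intros)
    moreover have "- (abs_power l (s * x) * s) = drift_power \<gamma> l x"
    proof (cases "l = 0")
      case True
      then show ?thesis using s(2) s(1) by (simp add: abs_power_def drift_power_def)
    next
      case False
      then show ?thesis using s(1) unfolding drift_power_def
        by (subst s(3)) (simp add: abs_power_def abs_mult powr_mult)
    qed
    ultimately show "((\<lambda>x. - U (s * x)) has_real_derivative drift_power \<gamma> l x) (at x)"
      using DERIV_minus by metis
  qed (simp add: abs_power_primitive_0)
  then have "drift_primitive (drift_power \<gamma> l) x = - U (s * x)" by metis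
  then show ?thesis by (simp add: w_def power_weight_def)
qed

lemma scaled_has_derivative:
  fixes H :: "real \<Rightarrow> real"
  assumes "\<And>x. (H has_real_derivative h x) (at x)" "s \<noteq> 0"
  shows "((\<lambda>x. H (s * x) / s) has_real_derivative h (s * x)) (at x)"
proof -
  have "((\<lambda>x. H (s * x)) has_real_derivative h (s * x) * s) (at x)"
    by (rule DERIV_chain2[OF assms(1)]) (auto intro!: derivative_eq_intros)
  from DERIV_cdivide[OF this, of s] show ?thesis using assms(2) by simp
qed

text \<open>After scaling, scale function and tail each acquire a factor \<open>1 / s\<close>, so
  their product, and with it the Muckenhoupt constant, is divided by the square of
  \<open>s\<close>.\<close>

lemma inf_spectrum_power_half_line:
  assumes \<gamma>: "0 < \<gamma>"
  shows "ereal (1 / (8 * C_half_line l) * \<gamma> powr (2 / (1 + l))) \<le> inf_spectrum_H_D {0<..} (drift_power \<gamma> l)"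
    and "inf_spectrum_H_D {0<..} (drift_power \<gamma> l) \<le> ereal (1 / (2 * C_half_line l) * \<gamma> powr (2 / (1 + l)))"
proof -
  let ?I = "{0<..} :: real set"
  have I: "?I = {0<..} \<or> ?I = UNIV" by simp
  interpret weighted_line ?I "drift_power \<gamma> l" by (rule weighted_line_drift_power[OF I])
  define s where "s = \<gamma> powr (1 / (l + 1))"
  note s = powr_scale[OF \<gamma> l, folded s_def]
  have s2: "\<gamma> powr (2 / (1 + l)) = s\<^sup>2" using s(4) by (simp add: add.commute)
  note w_eq = drift_power_weight[OF I \<gamma>, folded s_def]
  define Fs where "Fs x = F (s * x) / s" for x
  define Gs where "Gs x = G (s * x) / s" for x
  have Fs: "(Fs has_real_derivative 1 / w x) (at x)" and Gs: "(Gs has_real_derivative - w x) (at x)" for x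
    unfolding Fs_def Gs_def w_eq
    using scaled_has_derivative[of F "\<lambda>x. 1 / v x", OF power_scale_fun_has_derivative] scaled_has_derivative[of G "\<lambda>x. - v x", OF power_tail_has_derivative] s(1)
    by auto
  have FGs: "Fs x * Gs x = F (s * x) * G (s * x) / s\<^sup>2" for x by (simp add: Fs_def Gs_def power2_eq_square)
  have pos: "0 < Fs x" "0 < Gs x" if "0 < x" for x
    using power_scale_fun_pos[of "s * x"] power_tail_pos[of "s * x"] s(1) that by (simp_all add: Fs_def Gs_def)
  have "ereal (1 / (8 * (C_half_line l / s\<^sup>2))) \<le> inf_spectrum_H_D ?I (drift_power \<gamma> l)"
  proof (rule muckenhoupt_lower_bound[OF Fs Gs])
    show "Fs x * Gs x \<le> C_half_line l / s\<^sup>2" if "x \<in> ?I" for x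
      unfolding FGs using that s(1) by (intro divide_right_mono C_half_line_upper) auto
  qed (use pos s(1) C_half_line_pos in auto)
  then show "ereal (1 / (8 * C_half_line l) * \<gamma> powr (2 / (1 + l))) \<le> inf_spectrum_H_D ?I (drift_power \<gamma> l)"
    unfolding s2 by simp
  have upper: "inf_spectrum_H_D ?I (drift_power \<gamma> l) \<le> ereal (1 / (2 * (F y * G y / s\<^sup>2)))" if y: "0 < y" for y
  proof -
    have "(\<lambda>n. inverse (real (Suc n))) \<longlonglongrightarrow> 0" by (rule LIMSEQ_inverse_real_of_nat)
    then have ev: "\<forall>\<^sub>F n in sequentially. inverse (real (Suc n)) < y / s"
      by (rule order_tendstoD) (use y s(1) in simp)
    have "isCont Fs 0" using Fs by (rule DERIV_isCont)
    then have "(\<lambda>n. Fs (inverse (real (Suc n)))) \<longlonglongrightarrow> Fs 0"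
      using LIMSEQ_inverse_real_of_nat by (rule isCont_tendsto_compose)
    then have lim: "(\<lambda>n. Fs (inverse (real (Suc n)))) \<longlonglongrightarrow> 0" by (simp add: Fs_def power_scale_fun_0)
    have "((\<lambda>x. G (s * x) / s) \<longlongrightarrow> 0 / s) at_top"
      using s(1) by (intro tendsto_intros filterlim_compose[OF power_tail_tendsto] filterlim_tendsto_pos_mult_at_top[OF tendsto_const] filterlim_ident) auto
    then have Glim: "(Gs \<longlongrightarrow> 0) at_top" by (simp add: Gs_def[abs_def])
    have ev': "\<forall>\<^sub>F n in sequentially. inverse (real (Suc n)) \<in> ?I \<and> inverse (real (Suc n)) < y / s"
      using ev by eventually_elim simp
    have "inf_spectrum_H_D ?I (drift_power \<gamma> l) \<le> ereal (1 / (2 * (Fs (y / s) * Gs (y / s))))"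
      by (rule muckenhoupt_upper_bound[OF Fs Gs pos ev' lim Glim]) (use y s(1) in auto)
    then show ?thesis unfolding FGs using s(1) by simp
  qed
  \<comment> \<open>The upper bound holds for each \<open>y\<close> separately. Knowing that the
    infimum is a real \<Lambda> allows it to be rewritten as a bound on \<open>F y * G y\<close>,
    over which the supremum can be taken.\<close>
  have "inf_spectrum_H_D ?I (drift_power \<gamma> l) \<noteq> \<infinity>" "inf_spectrum_H_D ?I (drift_power \<gamma> l) \<noteq> - \<infinity>"
    using upper[of 1] inf_spectrum_nonneg by auto
  then obtain \<Lambda> where \<Lambda>: "inf_spectrum_H_D ?I (drift_power \<gamma> l) = ereal \<Lambda>" by (cases "inf_spectrum_H_D ?I (drift_power \<gamma> l)") auto
  have \<Lambda>0: "0 \<le> \<Lambda>" using inf_spectrum_nonneg unfolding \<Lambda> by simp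
  have "2 * \<Lambda> * (F y * G y) \<le> s\<^sup>2" if y: "0 < y" for y
  proof -
    have "\<Lambda> \<le> s\<^sup>2 / (2 * (F y * G y))" using upper[OF y] unfolding \<Lambda> by simp
    then show ?thesis using mult_pos_pos[OF power_scale_fun_pos[OF y] power_tail_pos[of y]] by (simp add: field_simps)
  qed
  then have "2 * \<Lambda> * C_half_line l \<le> s\<^sup>2"
  proof (cases "\<Lambda> = 0")
    case False
    then have p: "0 < \<Lambda>" using \<Lambda>0 by simp
    assume *: "\<And>y. 0 < y \<Longrightarrow> 2 * \<Lambda> * (F y * G y) \<le> s\<^sup>2"
    have "C_half_line l \<le> s\<^sup>2 / (2 * \<Lambda>)"
      unfolding C_half_line_eq by (rule cSUP_least) (use * p in \<open>auto simp: field_simps\<close>)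
    then show ?thesis using p by (simp add: field_simps)
  qed simp
  then show "inf_spectrum_H_D ?I (drift_power \<gamma> l) \<le> ereal (1 / (2 * C_half_line l) * \<gamma> powr (2 / (1 + l)))"
    unfolding \<Lambda> s2 using C_half_line_pos by (simp add: field_simps)
qed

text \<open>The scale function must vanish at minus infinity; since
  \<open>v (- x) = 1 / v x\<close>, the reflected tail does. The product with the tail attains its
  maximum at 0, so the single test point 0 gives the matching upper bound.\<close>

lemma inf_spectrum_power_line:
  assumes \<gamma>: "0 < \<gamma>"
  shows "ereal (1 / (8 * C_line l) * \<gamma> powr (2 / (1 + l))) \<le> inf_spectrum_H_D UNIV (drift_power \<gamma> l)"
    and "inf_spectrum_H_D UNIV (drift_power \<gamma> l) \<le> ereal (1 / (2 * C_line l) * \<gamma> powr (2 / (1 + l)))"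
proof -
  have I: "(UNIV :: real set) = {0<..} \<or> (UNIV :: real set) = UNIV" by simp
  interpret weighted_line UNIV "drift_power \<gamma> l" by (rule weighted_line_drift_power[OF I])
  define s where "s = \<gamma> powr (1 / (l + 1))"
  note s = powr_scale[OF \<gamma> l, folded s_def]
  have s2: "\<gamma> powr (2 / (1 + l)) = s\<^sup>2" using s(4) by (simp add: add.commute)
  note w_eq = drift_power_weight[OF I \<gamma>, folded s_def]
  define Fs where "Fs x = G (- (s * x)) / s" for x
  define Gs where "Gs x = G (s * x) / s" for x
  have Gm: "((\<lambda>x. G (- x)) has_real_derivative 1 / v x) (at x)" for x
  proof -
    have "((\<lambda>y. G (- y)) has_real_derivative (- v (- x)) * (- 1)) (at x)"
      by (rule DERIV_chain2[OF power_tail_has_derivative]) (auto intro!: derivative_eq_intros)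
    then show ?thesis by (simp add: power_weight_minus)
  qed
  have Fs: "(Fs has_real_derivative 1 / w x) (at x)" and Gs: "(Gs has_real_derivative - w x) (at x)" for x
    unfolding Fs_def Gs_def w_eq
    using scaled_has_derivative[of "\<lambda>x. G (- x)" "\<lambda>x. 1 / v x", OF Gm] scaled_has_derivative[of G "\<lambda>x. - v x", OF power_tail_has_derivative] s(1)
    by auto
  have pos: "0 < Fs x" "0 < Gs x" for x
    using power_tail_pos s(1) by (simp_all add: Fs_def Gs_def)
  have C: "0 < C_line l" unfolding C_line_eq using power_tail_pos[of 0] by simp
  have FGs: "Fs x * Gs x = G (- (s * x)) * G (s * x) / s\<^sup>2" for x by (simp add: Fs_def Gs_def power2_eq_square)
  have "ereal (1 / (8 * (C_line l / s\<^sup>2))) \<le> inf_spectrum_H_D UNIV (drift_power \<gamma> l)"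
  proof (rule muckenhoupt_lower_bound[OF Fs Gs pos])
    show "Fs x * Gs x \<le> C_line l / s\<^sup>2" for x
      unfolding FGs by (intro divide_right_mono power_tail_mult_reflect_le) simp
  qed (use s(1) C in auto)
  then show "ereal (1 / (8 * C_line l) * \<gamma> powr (2 / (1 + l))) \<le> inf_spectrum_H_D UNIV (drift_power \<gamma> l)"
    unfolding s2 by simp
  have "((\<lambda>x. G (s * x) / s) \<longlongrightarrow> 0 / s) at_top"
    using s(1) by (intro tendsto_intros filterlim_compose[OF power_tail_tendsto] filterlim_tendsto_pos_mult_at_top[OF tendsto_const] filterlim_ident) auto
  then have Glim: "(Gs \<longlongrightarrow> 0) at_top" by (simp add: Gs_def[abs_def])
  have "(\<lambda>n. Gs (real n)) \<longlonglongrightarrow> 0" by (rule filterlim_compose[OF Glim filterlim_real_sequentially])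
  then have Flim: "(\<lambda>n. Fs (- real n)) \<longlonglongrightarrow> 0" by (simp add: Fs_def Gs_def)
  have ev: "\<forall>\<^sub>F n in sequentially. - real n \<in> UNIV \<and> - real n < 0"
    using eventually_gt_at_top[of 0] by eventually_elim simp
  have "inf_spectrum_H_D UNIV (drift_power \<gamma> l) \<le> ereal (1 / (2 * (Fs 0 * Gs 0)))"
    by (rule muckenhoupt_upper_bound[OF Fs Gs pos ev Flim Glim])
  also have "1 / (2 * (Fs 0 * Gs 0)) = 1 / (2 * C_line l) * \<gamma> powr (2 / (1 + l))"
    unfolding FGs s2 C_line_eq by (simp add: power2_eq_square)
  finally show "inf_spectrum_H_D UNIV (drift_power \<gamma> l) \<le> ereal (1 / (2 * C_line l) * \<gamma> powr (2 / (1 + l)))" .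
qed

end

theorem proposition1:
  fixes I :: "real set"
  assumes "I = {0<..} \<or> I = UNIV"
  shows
    "(\<forall>\<gamma> l. 0 < \<gamma> \<longrightarrow> l < 0 \<longrightarrow> inf_spectrum_H_D I (drift_shifted \<gamma> l) = 0) \<and>
     (\<forall>l\<ge>0. \<exists>c C. 0 < c \<and> 0 < C \<and>
        (\<forall>\<gamma>>1.
           ereal (c * \<gamma>\<^sup>2) \<le> inf_spectrum_H_D I (drift_shifted \<gamma> l) \<and>
           inf_spectrum_H_D I (drift_shifted \<gamma> l) \<le> ereal (C * \<gamma>\<^sup>2)) \<and>
        (\<forall>\<gamma>. 0 < \<gamma> \<longrightarrow> \<gamma> \<le> 1 \<longrightarrow>
           ereal (c * \<gamma> powr (2 / (l + 1))) \<le> inf_spectrum_H_D I (drift_shifted \<gamma> l) \<and>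
           inf_spectrum_H_D I (drift_shifted \<gamma> l) \<le> ereal (C * \<gamma> powr (2 / (l + 1))))) \<and>
     (\<forall>l\<ge>0. \<forall>\<gamma>>0.
        let C = (if I = {0<..} then C_half_line l else C_line l) in
          ereal (1 / (8 * C) * \<gamma> powr (2 / (1 + l))) \<le> inf_spectrum_H_D I (drift_power \<gamma> l) \<and>
          inf_spectrum_H_D I (drift_power \<gamma> l) \<le> ereal (1 / (2 * C) * \<gamma> powr (2 / (1 + l))))"
proof (intro conjI)
  show "\<forall>\<gamma> l. 0 < \<gamma> \<longrightarrow> l < 0 \<longrightarrow> inf_spectrum_H_D I (drift_shifted \<gamma> l) = 0"
    using inf_spectrum_shifted_negative_exponent[OF assms] by blast
  show "\<forall>l\<ge>0. \<exists>c C. 0 < c \<and> 0 < C \<and>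
        (\<forall>\<gamma>>1.
           ereal (c * \<gamma>\<^sup>2) \<le> inf_spectrum_H_D I (drift_shifted \<gamma> l) \<and>
           inf_spectrum_H_D I (drift_shifted \<gamma> l) \<le> ereal (C * \<gamma>\<^sup>2)) \<and>
        (\<forall>\<gamma>. 0 < \<gamma> \<longrightarrow> \<gamma> \<le> 1 \<longrightarrow>
           ereal (c * \<gamma> powr (2 / (l + 1))) \<le> inf_spectrum_H_D I (drift_shifted \<gamma> l) \<and>
           inf_spectrum_H_D I (drift_shifted \<gamma> l) \<le> ereal (C * \<gamma> powr (2 / (l + 1))))"
  proof (intro allI impI)
    fix l :: real assume l: "0 \<le> l"
    show "\<exists>c C. 0 < c \<and> 0 < C \<and>
        (\<forall>\<gamma>>1.
           ereal (c * \<gamma>\<^sup>2) \<le> inf_spectrum_H_D I (drift_shifted \<gamma> l) \<and>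
           inf_spectrum_H_D I (drift_shifted \<gamma> l) \<le> ereal (C * \<gamma>\<^sup>2)) \<and>
        (\<forall>\<gamma>. 0 < \<gamma> \<longrightarrow> \<gamma> \<le> 1 \<longrightarrow>
           ereal (c * \<gamma> powr (2 / (l + 1))) \<le> inf_spectrum_H_D I (drift_shifted \<gamma> l) \<and>
           inf_spectrum_H_D I (drift_shifted \<gamma> l) \<le> ereal (C * \<gamma> powr (2 / (l + 1))))"
    proof (intro exI conjI allI impI)
      \<comment> \<open>Neither witness depends on \<gamma>, and the pair serves both ranges of
        \<gamma>.\<close>
      show "(0::real) < 1 / 800" "0 < exp (6 * 5 powr l)" by simp_all
    next
      fix \<gamma> :: real assume g: "1 < \<gamma>"
      then have g0: "0 < \<gamma>" by simp
      show "ereal (1 / 800 * \<gamma>\<^sup>2) \<le> inf_spectrum_H_D I (drift_shifted \<gamma> l)"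
        by (rule inf_spectrum_shifted_lower_bounds(1)[OF assms g0 l])
      show "inf_spectrum_H_D I (drift_shifted \<gamma> l) \<le> ereal (exp (6 * 5 powr l) * \<gamma>\<^sup>2)"
        by (rule inf_spectrum_shifted_upper_bounds(1)[OF assms g0 l g])
    next
      fix \<gamma> :: real assume g: "0 < \<gamma>" "\<gamma> \<le> 1"
      show "ereal (1 / 800 * \<gamma> powr (2 / (l + 1))) \<le> inf_spectrum_H_D I (drift_shifted \<gamma> l)"
        by (rule inf_spectrum_shifted_lower_bounds(2)[OF assms g(1) l])
      show "inf_spectrum_H_D I (drift_shifted \<gamma> l) \<le> ereal (exp (6 * 5 powr l) * \<gamma> powr (2 / (l + 1)))"
        by (rule inf_spectrum_shifted_upper_bounds(2)[OF assms g(1) l g(2)])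
    qed
  qed
  show "\<forall>l\<ge>0. \<forall>\<gamma>>0.
        let C = (if I = {0<..} then C_half_line l else C_line l) in
          ereal (1 / (8 * C) * \<gamma> powr (2 / (1 + l))) \<le> inf_spectrum_H_D I (drift_power \<gamma> l) \<and>
          inf_spectrum_H_D I (drift_power \<gamma> l) \<le> ereal (1 / (2 * C) * \<gamma> powr (2 / (1 + l)))"
  proof (intro allI impI)
    fix l \<gamma> :: real assume *: "0 \<le> l" "0 < \<gamma>"
    show "let C = (if I = {0<..} then C_half_line l else C_line l) in
          ereal (1 / (8 * C) * \<gamma> powr (2 / (1 + l))) \<le> inf_spectrum_H_D I (drift_power \<gamma> l) \<and>
          inf_spectrum_H_D I (drift_power \<gamma> l) \<le> ereal (1 / (2 * C) * \<gamma> powr (2 / (1 + l)))"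
    proof (cases "I = {0<..}")
      case True
      then show ?thesis using inf_spectrum_power_half_line[OF *] by (simp only: Let_def if_True refl simp_thms)
    next
      case False
      then have "I = UNIV" using assms by simp
      then show ?thesis using False inf_spectrum_power_line[OF *] by (simp only: Let_def if_False simp_thms)
    qed
  qed
qed

end
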